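(* Let $f:\Sigma\to\mathcal{Z}$ be a Legendre map and let $T\le T\Sigma$ be a rank $1$ distribution. There exists a spacelike rank $1$ subbundle $L$ of $f^\perp$ that is constant along the leaves of $T$ if and only if, where the projection immerses, $f$ projects to a surface with spherical curvature lines along the leaves of $T$ in some (and in fact, any) conformal Riemannian geometry.
   Context: Let $\mathbb{R}^{4,2}$ be $\mathbb{R}^6$ with a symmetric bilinear form $(\cdot,\cdot)$ of signature $(4,2)$, $\mathcal{L}$ its light cone, $\mathbb{P}(\mathcal{L})$ the Lie quadric, and $\mathcal{Z}$ the Grassmannian of totally isotropic 2-planes. $\Sigma$ is a simply connected 2-manifold. A smooth map $f:\Sigma\to\mathcal{Z}$ is identified with a rank 2 null subbundle of $\Sigma\times\mathbb{R}^{4,2}$; $f^{(1)}$ is the set of sections of $f$ and derivatives of sections of $f$. $f$ is a Legendre map if $f^{(1)}\le f^\perp$ and, for any $x\in\Sigma$, if $X\in T_x\Sigma$ satisfies $d\sigma(X)\in f$ for all $\sigma\in\Gamma f$, then $X=0$. Curvature lines: let $\beta(X)\in\mathrm{Hom}(f,f^\perp/f)$ be $\sigma\mapsto d_X\sigma \bmod f$ and $\mathcal{B}(X,Y)\,\xi_1\wedge\xi_2=\tfrac12(\beta(X)\xi_1\wedge\beta(Y)\xi_2+\beta(Y)\xi_1\wedge\beta(X)\xi_2)$ for $\xi_1,\xi_2\in\Gamma f$. The leaves of a rank 1 distribution $T$ are curvature lines of $f$ if $\mathcal{B}(T,T)=0$. A conformal Riemannian geometry is determined by a timelike vector $\mathfrak{p}\in\mathbb{R}^{4,2}$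 (point sphere complex), with $\langle\mathfrak{p}\rangle^\perp\cong\mathbb{R}^{4,1}$ and conformal 3-sphere $\mathbb{P}(\mathcal{L})\cap\langle\mathfrak{p}\rangle^\perp$. The projection of $f$ to this geometry is the point sphere map $\Lambda:=f\cap\langle\mathfrak{p}\rangle^\perp$. This projection has spherical curvature lines along the leaves of $T$ if $\mathcal{B}(T,T)=0$ and there is a smooth map $\nu:\Sigma\to\mathbb{P}(\mathcal{L})$, constant along the leaves of $T$, with $\Lambda\perp\nu$. Throughout, only spheres $\nu$ meeting the surface transversally are considered; in particular $\nu\cap f^\perp=\{0\}$.
   Formalization: The subbundle L obtained from spherical curvature lines is asserted only where the projection immerses, not on all of Σ (false if the point sphere map is constant); the some/any equivalence is stated over simply connected open sets on which some projection immerses. *)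

theory Defs
  imports "HOL-Analysis.Analysis"
begin

section \<open>Smooth maps between open subsets of vector spaces\<close>

primrec Ck_on :: "nat \<Rightarrow> 'a::real_normed_vector set \<Rightarrow> ('a \<Rightarrow> 'b::real_normed_vector) \<Rightarrow> bool" where
  "Ck_on 0 S g \<longleftrightarrow> continuous_on S g"
| "Ck_on (Suc k) S g \<longleftrightarrow> (\<forall>x\<in>S. g differentiable (at x)) \<and>
     (\<forall>v. Ck_on k S (\<lambda>x. frechet_derivative g (at x) v))"

(* intended for open S in a finite-dimensional space *)
definition smooth_on :: "'a::real_normed_vector set \<Rightarrow> ('a \<Rightarrow> 'b::real_normed_vector) \<Rightarrow> bool" where
  "smooth_on S g \<longleftrightarrow> (\<forall>k. Ck_on k S g)"

section \<open>Smooth surfaces\<close>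

(* The points of the surface form a type, a chart is a pair (domain, coordinate map), and the
   smooth structure is given by an atlas (not necessarily maximal). *)

type_synonym 'm chart = "'m set \<times> ('m \<Rightarrow> real^2)"

definition chart_inv :: "'m chart \<Rightarrow> real^2 \<Rightarrow> 'm" where
  "chart_inv c = inv_into (fst c) (snd c)"

definition smooth_atlas :: "'m::topological_space chart set \<Rightarrow> bool" where
  "smooth_atlas A \<longleftrightarrow>
     (\<forall>c\<in>A. open (fst c) \<and> open (snd c ` fst c) \<and>
        homeomorphism (fst c) (snd c ` fst c) (snd c) (chart_inv c)) \<and>
     (\<Union>c\<in>A. fst c) = UNIV \<and>
     (\<forall>c\<in>A. \<forall>d\<in>A. smooth_on (snd c ` (fst c \<inter> fst d)) (snd d \<circ> chart_inv c))"

definition smooth_map :: "'m chart set \<Rightarrow> 'm set \<Rightarrow> ('m \<Rightarrow> 'b::real_normed_vector) \<Rightarrow> bool" where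
  "smooth_map A W g \<longleftrightarrow> (\<forall>c\<in>A. smooth_on (snd c ` (fst c \<inter> W)) (g \<circ> chart_inv c))"

(* A tangent vector at x is the family of its coordinate vectors in the charts around x, related
   by the derivatives of the coordinate changes; the family is 0 at all other indices, so that
   \<lambda>_. 0 is the zero tangent vector. *)

type_synonym 'm tvec = "'m chart \<Rightarrow> real^2"

definition tangent_space :: "'m chart set \<Rightarrow> 'm \<Rightarrow> 'm tvec set" where
  "tangent_space A x = {X.
     (\<forall>c. c \<notin> A \<or> x \<notin> fst c \<longrightarrow> X c = 0) \<and>
     (\<forall>c\<in>A. \<forall>d\<in>A. x \<in> fst c \<and> x \<in> fst d \<longrightarrow>
        X d = frechet_derivative (snd d \<circ> chart_inv c) (at (snd c x)) (X c))}"

(* The derivative of g at x in the direction X; the value does not depend on the chart. *)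
definition dir_deriv :: "'m chart set \<Rightarrow> 'm \<Rightarrow> 'm tvec \<Rightarrow> ('m \<Rightarrow> 'b::real_normed_vector) \<Rightarrow> 'b" where
  "dir_deriv A x X g =
     (let c = (SOME c. c \<in> A \<and> x \<in> fst c)
      in frechet_derivative (g \<circ> chart_inv c) (at (snd c x)) (X c))"

definition rank1_distribution :: "'m::topological_space chart set \<Rightarrow> ('m \<Rightarrow> 'm tvec set) \<Rightarrow> bool" where
  "rank1_distribution A T \<longleftrightarrow>
     (\<forall>x. \<exists>N X. open N \<and> x \<in> N \<and>
        (\<forall>c\<in>A. smooth_on (snd c ` (fst c \<inter> N)) (\<lambda>u. X (chart_inv c u) c)) \<and>
        (\<forall>y\<in>N. X y \<in> tangent_space A y \<and> X y \<noteq> (\<lambda>_. 0) \<and>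
           T y = {\<lambda>c. r *\<^sub>R X y c | r. True}))"

definition velocity :: "'m chart set \<Rightarrow> (real \<Rightarrow> 'm) \<Rightarrow> real \<Rightarrow> 'm tvec" where
  "velocity A \<gamma> t =
     (\<lambda>c. if c \<in> A \<and> \<gamma> t \<in> fst c then vector_derivative (snd c \<circ> \<gamma>) (at t) else 0)"

(* Differentiability is enough here: since T is smooth, a regular differentiable curve tangent to
   T is, up to reparametrisation, a smooth integral curve. *)
definition integral_curve ::
  "'m::topological_space chart set \<Rightarrow> ('m \<Rightarrow> 'm tvec set) \<Rightarrow> 'm set \<Rightarrow> real \<Rightarrow> real \<Rightarrow> (real \<Rightarrow> 'm) \<Rightarrow> bool"
where
  "integral_curve A T W a b \<gamma> \<longleftrightarrow>
     (\<forall>t\<in>{a<..<b}. \<gamma> t \<in> W \<and> isCont \<gamma> t \<and>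
        (\<forall>c\<in>A. \<gamma> t \<in> fst c \<longrightarrow> (snd c \<circ> \<gamma>) differentiable (at t)) \<and>
        velocity A \<gamma> t \<in> T (\<gamma> t) - {\<lambda>_. 0})"

(* The leaf through x of the restriction of T to the open set W. *)
definition leaf :: "'m::topological_space chart set \<Rightarrow> ('m \<Rightarrow> 'm tvec set) \<Rightarrow> 'm set \<Rightarrow> 'm \<Rightarrow> 'm set" where
  "leaf A T W x = {y. \<exists>a b \<gamma>. integral_curve A T W a b \<gamma> \<and>
     (\<exists>s\<in>{a<..<b}. \<exists>t\<in>{a<..<b}. \<gamma> s = x \<and> \<gamma> t = y)}"

definition constant_along_leaves ::
  "'m::topological_space chart set \<Rightarrow> ('m \<Rightarrow> 'm tvec set) \<Rightarrow> 'm set \<Rightarrow> ('m \<Rightarrow> 'b) \<Rightarrow> bool" where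
  "constant_along_leaves A T W E \<longleftrightarrow> (\<forall>x\<in>W. \<forall>y\<in>leaf A T W x. E y = E x)"

section \<open>Subbundles of the trivial bundle\<close>

(* Rank k subbundles over the open set W, that is, smooth maps from W into the Grassmannian. *)
definition subbundle ::
  "'m::topological_space chart set \<Rightarrow> nat \<Rightarrow> 'm set \<Rightarrow> ('m \<Rightarrow> 'v::euclidean_space set) \<Rightarrow> bool" where
  "subbundle A k W E \<longleftrightarrow>
     (\<forall>x\<in>W. \<exists>N s. open N \<and> x \<in> N \<and> N \<subseteq> W \<and> (\<forall>i<k. smooth_map A N (s i)) \<and>
        (\<forall>y\<in>N. E y = span ((\<lambda>i::nat. s i y) ` {..<k}) \<and> dim (E y) = k))"

definition sections ::
  "'m chart set \<Rightarrow> 'm set \<Rightarrow> ('m \<Rightarrow> 'v::euclidean_space set) \<Rightarrow> ('m \<Rightarrow> 'v) set" where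
  "sections A N E = {\<sigma>. smooth_map A N \<sigma> \<and> (\<forall>y\<in>N. \<sigma> y \<in> E y)}"

definition local_sections ::
  "'m::topological_space chart set \<Rightarrow> 'm \<Rightarrow> ('m \<Rightarrow> 'v::euclidean_space set) \<Rightarrow> ('m \<Rightarrow> 'v) set" where
  "local_sections A x E = (\<Union>N\<in>{N. open N \<and> x \<in> N}. sections A N E)"

(* The fibre at x of the derived bundle E^(1). *)
definition derived_bundle ::
  "'m::topological_space chart set \<Rightarrow> ('m \<Rightarrow> 'v::euclidean_space set) \<Rightarrow> 'm \<Rightarrow> 'v set" where
  "derived_bundle A E x = span (E x \<union>
     {dir_deriv A x X \<sigma> | X \<sigma>. X \<in> tangent_space A x \<and> \<sigma> \<in> local_sections A x E})"

(* The derivative of a map E into a Grassmannian sends X to the homomorphism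
   \<sigma> \<mapsto> d_X \<sigma> mod E from E to V/E; it has to be injective. *)
definition immerses_at ::
  "'m::topological_space chart set \<Rightarrow> ('m \<Rightarrow> 'v::euclidean_space set) \<Rightarrow> 'm \<Rightarrow> bool" where
  "immerses_at A E x \<longleftrightarrow>
     (\<forall>X\<in>tangent_space A x. (\<forall>\<sigma>\<in>local_sections A x E. dir_deriv A x X \<sigma> \<in> E x) \<longrightarrow> X = (\<lambda>_. 0))"

section \<open>Lie sphere geometry\<close>

definition form_of_signature :: "('v::euclidean_space \<Rightarrow> 'v \<Rightarrow> real) \<Rightarrow> nat \<Rightarrow> nat \<Rightarrow> bool" where
  "form_of_signature ip p q \<longleftrightarrow>
     bilinear ip \<and> (\<forall>u v. ip u v = ip v u) \<and> p + q = DIM('v) \<and>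
     (\<exists>P. subspace P \<and> dim P = p \<and> (\<forall>v\<in>P. v \<noteq> 0 \<longrightarrow> ip v v > 0)) \<and>
     (\<exists>N. subspace N \<and> dim N = q \<and> (\<forall>v\<in>N. v \<noteq> 0 \<longrightarrow> ip v v < 0))"

definition perp :: "('v \<Rightarrow> 'v \<Rightarrow> real) \<Rightarrow> 'v set \<Rightarrow> 'v set" where
  "perp ip S = {v. \<forall>u\<in>S. ip u v = 0}"

definition legendre_map ::
  "'m::topological_space chart set \<Rightarrow> (real^6 \<Rightarrow> real^6 \<Rightarrow> real) \<Rightarrow> ('m \<Rightarrow> (real^6) set) \<Rightarrow> bool" where
  "legendre_map A ip f \<longleftrightarrow>
     subbundle A 2 UNIV f \<and> (\<forall>x. \<forall>u\<in>f x. \<forall>v\<in>f x. ip u v = 0) \<and>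
     (\<forall>x. derived_bundle A f x \<subseteq> perp ip (f x)) \<and>
     (\<forall>x. immerses_at A f x)"

(* The exterior square of f^perp / f is realised as the quotient of the exterior square of f^perp
   by the span of all a \<and> b with a in f and b in f^perp, a bivector being a skew matrix. *)

definition wedge :: "real^'n \<Rightarrow> real^'n \<Rightarrow> real^'n^'n" where
  "wedge u v = (\<chi> i j. u $ i * v $ j - u $ j * v $ i)"

(* A representative of B(X,Y) (\<xi>1 \<and> \<xi>2). *)
definition curv_rep ::
  "'m chart set \<Rightarrow> 'm \<Rightarrow> 'm tvec \<Rightarrow> 'm tvec \<Rightarrow> ('m \<Rightarrow> real^6) \<Rightarrow> ('m \<Rightarrow> real^6) \<Rightarrow> real^6^6" where
  "curv_rep A x X Y \<xi>1 \<xi>2 =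
     (1/2) *\<^sub>R (wedge (dir_deriv A x X \<xi>1) (dir_deriv A x Y \<xi>2)
            + wedge (dir_deriv A x Y \<xi>1) (dir_deriv A x X \<xi>2))"

(* B(T,T) = 0 on W. *)
definition curvature_lines ::
  "'m::topological_space chart set \<Rightarrow> (real^6 \<Rightarrow> real^6 \<Rightarrow> real) \<Rightarrow> ('m \<Rightarrow> (real^6) set) \<Rightarrow>
   ('m \<Rightarrow> 'm tvec set) \<Rightarrow> 'm set \<Rightarrow> bool" where
  "curvature_lines A ip f T W \<longleftrightarrow>
     (\<forall>x\<in>W. \<forall>X\<in>T x. \<forall>Y\<in>T x. \<forall>\<xi>1\<in>local_sections A x f. \<forall>\<xi>2\<in>local_sections A x f.
        curv_rep A x X Y \<xi>1 \<xi>2 \<in> span {wedge a b | a b. a \<in> f x \<and> b \<in> perp ip (f x)})"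

definition timelike :: "('v \<Rightarrow> 'v \<Rightarrow> real) \<Rightarrow> 'v \<Rightarrow> bool" where
  "timelike ip p \<longleftrightarrow> ip p p < 0"

definition point_sphere_map ::
  "('v \<Rightarrow> 'v \<Rightarrow> real) \<Rightarrow> ('m \<Rightarrow> 'v set) \<Rightarrow> 'v \<Rightarrow> 'm \<Rightarrow> 'v set" where
  "point_sphere_map ip f p x = f x \<inter> perp ip {p}"

(* The region where the projection to the geometry of p immerses. *)
definition immersed_region ::
  "'m::topological_space chart set \<Rightarrow> (real^6 \<Rightarrow> real^6 \<Rightarrow> real) \<Rightarrow> ('m \<Rightarrow> (real^6) set) \<Rightarrow>
   real^6 \<Rightarrow> 'm set" where
  "immersed_region A ip f p = {x. immerses_at A (point_sphere_map ip f p) x}"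

(* With \<Lambda> the point sphere map, the tangent space of the conformal 3-sphere at \<Lambda> is
   Hom(\<Lambda>, \<Lambda>^perp \<inter> p^perp / \<Lambda>); in it, the tangent plane of the surface corresponds to
   \<Lambda>^(1) and that of the sphere nu to \<Lambda>^perp \<inter> p^perp \<inter> nu^perp. Transversality says that these
   span. It does not follow from nu \<inter> f^perp = {0}: reversing the orientation of a sphere
   in contact with the surface gives nu outside f^perp, but tangent to the surface. *)
definition transversal_at ::
  "'m::topological_space chart set \<Rightarrow> (real^6 \<Rightarrow> real^6 \<Rightarrow> real) \<Rightarrow> ('m \<Rightarrow> (real^6) set) \<Rightarrow>
   real^6 \<Rightarrow> ('m \<Rightarrow> (real^6) set) \<Rightarrow> 'm \<Rightarrow> bool" where
  "transversal_at A ip f p nu x \<longleftrightarrow>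
     (let \<Lambda> = point_sphere_map ip f p in
        nu x \<inter> perp ip (f x) = {0} \<and>
        {a + b | a b. a \<in> derived_bundle A \<Lambda> x \<and> b \<in> perp ip (\<Lambda> x \<union> {p} \<union> nu x)}
          = perp ip (\<Lambda> x \<union> {p}))"

(* A smooth map into the projective light cone is a null line subbundle nu. *)
definition spherical_curvature_lines ::
  "'m::topological_space chart set \<Rightarrow> (real^6 \<Rightarrow> real^6 \<Rightarrow> real) \<Rightarrow> ('m \<Rightarrow> (real^6) set) \<Rightarrow>
   ('m \<Rightarrow> 'm tvec set) \<Rightarrow> real^6 \<Rightarrow> 'm set \<Rightarrow> bool" where
  "spherical_curvature_lines A ip f T p W \<longleftrightarrow>
     curvature_lines A ip f T W \<and>
     (\<exists>nu. subbundle A 1 W nu \<and> (\<forall>x\<in>W. \<forall>v\<in>nu x. ip v v = 0) \<and>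
        constant_along_leaves A T W nu \<and>
        (\<forall>x\<in>W. \<forall>u\<in>point_sphere_map ip f p x. \<forall>v\<in>nu x. ip u v = 0) \<and>
        (\<forall>x\<in>W. transversal_at A ip f p nu x))"

definition constant_spacelike_line ::
  "'m::topological_space chart set \<Rightarrow> (real^6 \<Rightarrow> real^6 \<Rightarrow> real) \<Rightarrow> ('m \<Rightarrow> (real^6) set) \<Rightarrow>
   ('m \<Rightarrow> 'm tvec set) \<Rightarrow> 'm set \<Rightarrow> ('m \<Rightarrow> (real^6) set) \<Rightarrow> bool" where
  "constant_spacelike_line A ip f T W L \<longleftrightarrow>
     subbundle A 1 W L \<and> (\<forall>x\<in>W. L x \<subseteq> perp ip (f x)) \<and>
     (\<forall>x\<in>W. \<forall>v\<in>L x. v \<noteq> 0 \<longrightarrow> ip v v > 0) \<and>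
     constant_along_leaves A T W L"

end

theory Submission
  imports Defs
begin

text \<open>
Let \<open>\<Lambda>\<close> be the point sphere map of the geometry given by the timelike vector \<open>p\<close>. The line
\<open>L = \<langle>l\<rangle>\<close> and the spheres \<open>\<nu> = \<langle>n\<rangle>\<close> correspond to each other by lying in the same pencil:
\<open>\<nu> \<oplus> \<langle>p\<rangle> = L \<oplus> \<langle>p\<rangle>\<close>. This plane is orthogonal to \<open>\<Lambda>\<close> in either case. Given \<open>L\<close>, it has signature
\<open>(1,1)\<close> and \<open>\<nu>\<close> is one of its two null lines; given \<open>\<nu>\<close>, the line \<open>L\<close> is the intersection of the
plane with \<open>f\<^sup>\<bottom>\<close>.

The geometry happens in \<open>f\<^sup>\<bottom> / f\<close>, which is a positive definite plane: a vector of \<open>f\<^sup>\<bottom>\<close> outside \<open>f\<close> is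
spacelike (\<open>perp_spacelike\<close>), and two vectors of \<open>f\<^sup>\<bottom>\<close> orthogonal to such a vector are dependent
modulo \<open>f\<close> (\<open>dependent_mod_null_plane\<close>).

From \<open>L\<close> to \<open>\<nu>\<close> (\<open>constant_line_imp_spherical\<close>). Since \<open>l\<close> is constant along a leaf up to scale and
orthogonal to \<open>f\<close>, the derivatives \<open>d\<^sub>X\<xi>\<close> of sections \<open>\<xi>\<close> of \<open>f\<close> in the direction \<open>X\<close> of \<open>T\<close> are
orthogonal to \<open>l\<close>, hence pairwise dependent modulo \<open>f\<close>, which is \<open>\<B>(T,T) = 0\<close>. Transversality holds
because the derivatives of \<open>\<Lambda>\<close> are independent modulo \<open>f\<close> where \<open>\<Lambda>\<close> immerses, so they cannot all be
orthogonal to \<open>l\<close>. Two ingredients are not algebraic. Constancy along leaves is a statement on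
integral curves, so one needs an integral curve through every point (\<open>integral_curve_exists\<close>, from the
Picard iteration). And a consistent choice between the two null lines of the pencil needs an
orientation of \<open>L\<close>; it exists over a simply connected domain because the map into the projective
space lifts to the sphere (\<open>line_field_orientable\<close>).

From \<open>\<nu>\<close> to \<open>L\<close> (\<open>spherical_imp_constant_line\<close>). Transversality makes \<open>l\<close> spacelike. Let \<open>X\<close> be tangent
to \<open>T\<close>, \<open>\<sigma>\<close> a section of \<open>\<Lambda>\<close> and \<open>s\<close> a section of \<open>f\<close> with \<open>(s,p) \<noteq> 0\<close>. As \<open>n\<close> is constant along the
leaf, \<open>d\<^sub>X\<sigma>\<close> is orthogonal to \<open>n\<close> and to \<open>p\<close>, hence to \<open>l\<close>, and it is not in \<open>f\<close> by the immersion
property. Now \<open>\<B>(T,T) = 0\<close> makes \<open>d\<^sub>Xs\<close> a multiple of \<open>d\<^sub>X\<sigma>\<close> modulo \<open>f\<close>, so that it is orthogonal to \<open>l\<close>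
as well (\<open>contact_bivectors_perp\<close>). This says that the quotient \<open>(s,n) / (s,p)\<close>, which determines the
position of \<open>L\<close> in the pencil, has derivative zero along the leaf.
\<close>

section \<open>Calculus of smooth maps on open sets\<close>

lemma Ck_on_Suc_imp_Ck_on: "Ck_on (Suc k) S g \<Longrightarrow> Ck_on k S g"
proof (induction k arbitrary: g)
  case 0
  then have "g differentiable_on S" by (simp add: differentiable_on_def differentiable_at_withinI)
  then show ?case by (simp add: differentiable_imp_continuous_on)
next
  case (Suc k)
  have "Ck_on k S (\<lambda>x. frechet_derivative g (at x) v)" for v
    by (rule Suc.IH) (use Suc.prems in simp)
  then show ?case using Suc.prems by simp
qed

lemma Ck_on_subset: "Ck_on k S g \<Longrightarrow> S' \<subseteq> S \<Longrightarrow> Ck_on k S' g"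
proof (induction k arbitrary: g)
  case 0
  then show ?case using continuous_on_subset by auto
next
  case (Suc k)
  then show ?case by (simp add: subset_iff)
qed

lemma frechet_derivative_eqI:
  assumes "open S" "x \<in> S" "\<And>y. y \<in> S \<Longrightarrow> g y = h y" "g differentiable (at x)"
  shows "h differentiable (at x)" "frechet_derivative h (at x) = frechet_derivative g (at x)"
proof -
  have "(g has_derivative frechet_derivative g (at x)) (at x)"
    using assms(4) frechet_derivative_works by blast
  then have "(h has_derivative frechet_derivative g (at x)) (at x)"
    by (rule has_derivative_transform_within_open) (use assms in auto)
  then show "h differentiable (at x)" "frechet_derivative h (at x) = frechet_derivative g (at x)"
    by (rule differentiableI, rule frechet_derivative_at[symmetric])
qed

lemma Ck_on_cong:
  assumes "open S" "\<And>x. x \<in> S \<Longrightarrow> g x = h x" "Ck_on k S g"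
  shows "Ck_on k S h"
  using assms(2,3)
proof (induction k arbitrary: g h)
  case 0
  then show ?case by (simp cong: continuous_on_cong)
next
  case (Suc k)
  have d: "g differentiable (at x)" if "x \<in> S" for x using Suc.prems that by auto
  have 1: "h differentiable (at x)" "frechet_derivative h (at x) = frechet_derivative g (at x)"
    if "x \<in> S" for x
    using frechet_derivative_eqI[OF assms(1) that Suc.prems(1) d[OF that]] by auto
  have "Ck_on k S (\<lambda>x. frechet_derivative h (at x) v)" for v
    using Suc.IH[of "\<lambda>x. frechet_derivative g (at x) v" "\<lambda>x. frechet_derivative h (at x) v"] 
      1 Suc.prems(2) by simp
  then show ?case using 1 by simp
qed

text \<open>The derivative may be given by any family of maps, not only by the chosen Frechet derivative.\<close>
lemma Ck_on_SucI:
  assumes "open S" "\<And>x. x \<in> S \<Longrightarrow> (g has_derivative g' x) (at x)" "\<And>v. Ck_on k S (\<lambda>x. g' x v)"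
  shows "Ck_on (Suc k) S g"
proof -
  have "frechet_derivative g (at x) = g' x" if "x \<in> S" for x
    using frechet_derivative_at[OF assms(2)[OF that]] by simp
  then have "Ck_on k S (\<lambda>x. frechet_derivative g (at x) v)" for v
    using Ck_on_cong[OF assms(1) _ assms(3)[of v], of "\<lambda>x. frechet_derivative g (at x) v"] by simp
  then show ?thesis using assms(2) by (auto simp: differentiable_def)
qed

lemma Ck_on_SucD:
  assumes "Ck_on (Suc k) S g" "x \<in> S"
  shows "(g has_derivative frechet_derivative g (at x)) (at x)"
  using assms frechet_derivative_works by auto

lemma Ck_on_const: "open S \<Longrightarrow> Ck_on k S (\<lambda>_. a)"
  by (induction k arbitrary: a) (auto simp: frechet_derivative_const)

lemma Ck_on_add:
  assumes "open S" "Ck_on k S g" "Ck_on k S h"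
  shows "Ck_on k S (\<lambda>x. g x + h x)"
  using assms(2,3)
proof (induction k arbitrary: g h)
  case 0
  then show ?case by (simp add: continuous_on_add)
next
  case (Suc k)
  show ?case
    by (rule Ck_on_SucI[OF assms(1) has_derivative_add[OF Ck_on_SucD[OF Suc.prems(1)] Ck_on_SucD[OF Suc.prems(2)]]])
       (use Suc in auto)
qed

lemma Ck_on_bilinear:
  assumes "bounded_bilinear B" "open S" "Ck_on k S g" "Ck_on k S h"
  shows "Ck_on k S (\<lambda>x. B (g x) (h x))"
  using assms(3,4)
proof (induction k arbitrary: g h)
  case 0
  then show ?case by (simp add: bounded_bilinear.continuous_on[OF assms(1)])
next
  case (Suc k)
  show ?case
  proof (rule Ck_on_SucI[OF assms(2) bounded_bilinear.FDERIV[OF assms(1) Ck_on_SucD[OF Suc.prems(1)] Ck_on_SucD[OF Suc.prems(2)]]])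
    fix v show "Ck_on k S (\<lambda>x. B (g x) (frechet_derivative h (at x) v) + B (frechet_derivative g (at x) v) (h x))"
      by (intro Ck_on_add[OF assms(2)] Suc.IH Ck_on_Suc_imp_Ck_on[OF Suc.prems(1)] Ck_on_Suc_imp_Ck_on[OF Suc.prems(2)])
        (use Suc.prems in auto)
  qed auto
qed

text \<open>The exponent is arbitrary so that the induction passes to the derivative; square roots and inverses
of positive functions are special cases.\<close>
lemma Ck_on_powr:
  fixes h :: "'a::real_normed_vector \<Rightarrow> real"
  assumes "open S" "Ck_on k S h" "\<And>x. x \<in> S \<Longrightarrow> h x > 0"
  shows "Ck_on k S (\<lambda>x. h x powr a)"
  using assms(2)
proof (induction k arbitrary: a)
  case 0
  then show ?case using assms(3) by (auto intro!: continuous_on_powr continuous_on_const simp: less_le)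
next
  case (Suc k)
  have der: "((\<lambda>x. h x powr a) has_derivative
      (\<lambda>v. (a * h x powr (a - 1)) * frechet_derivative h (at x) v)) (at x)" if "x \<in> S" for x
  proof -
    have "((\<lambda>t. t powr a) has_field_derivative a * h x powr (a - 1)) (at (h x))"
      using assms(3)[OF that] by (rule has_real_derivative_powr)
    then have "((\<lambda>t. t powr a) has_derivative (*) (a * h x powr (a - 1))) (at (h x))"
      by (simp add: has_field_derivative_def)
    from has_derivative_compose[OF Ck_on_SucD[OF Suc.prems that] this]
    show ?thesis .
  qed
  show ?case
  proof (rule Ck_on_SucI[OF assms(1) der])
    fix v show "Ck_on k S (\<lambda>x. (a * h x powr (a - 1)) * frechet_derivative h (at x) v)"
      using Suc.prems
      by (intro Ck_on_bilinear[OF bounded_bilinear_mult assms(1)] Ck_on_const[OF assms(1)] Suc.IH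
           Ck_on_Suc_imp_Ck_on[OF Suc.prems]) auto
  qed
qed

lemma smooth_on_const: "open S \<Longrightarrow> smooth_on S (\<lambda>_. a)"
  by (simp add: smooth_on_def Ck_on_const)

lemma smooth_on_add: "open S \<Longrightarrow> smooth_on S g \<Longrightarrow> smooth_on S h \<Longrightarrow> smooth_on S (\<lambda>x. g x + h x)"
  by (simp add: smooth_on_def Ck_on_add)

lemma smooth_on_bilinear:
  "bounded_bilinear B \<Longrightarrow> open S \<Longrightarrow> smooth_on S g \<Longrightarrow> smooth_on S h \<Longrightarrow> smooth_on S (\<lambda>x. B (g x) (h x))"
  by (simp add: smooth_on_def Ck_on_bilinear)

lemma smooth_on_powr:
  "open S \<Longrightarrow> smooth_on S h \<Longrightarrow> (\<And>x. x \<in> S \<Longrightarrow> h x > (0::real)) \<Longrightarrow> smooth_on S (\<lambda>x. h x powr a)"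
  by (simp add: smooth_on_def Ck_on_powr)

lemma smooth_on_imp_has_derivative:
  assumes "smooth_on S g" "x \<in> S"
  shows "(g has_derivative frechet_derivative g (at x)) (at x)"
proof -
  have "Ck_on (Suc 0) S g" using assms(1) unfolding smooth_on_def by blast
  then show ?thesis using assms(2) by (rule Ck_on_SucD)
qed

lemma smooth_on_imp_continuous_on: "smooth_on S g \<Longrightarrow> continuous_on S g"
  unfolding smooth_on_def by (metis Ck_on.simps(1))

section \<open>Solutions of ordinary differential equations\<close>

text \<open>The Picard iteration on the space of bounded continuous functions. The factor \<open>1/8\<close> in the length of
the time interval makes the integral operator a contraction with constant \<open>1/2\<close>.\<close>
lemma ode_global:
  fixes F :: "'a::banach \<Rightarrow> 'a"
  assumes lip: "\<And>u v. norm (F u - F v) \<le> C * norm (u - v)" and bd: "\<And>u. norm (F u) \<le> M"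
  obtains e w where "e > 0" "w 0 = u0" "\<And>t. \<bar>t\<bar> < e \<Longrightarrow> (w has_vector_derivative F (w t)) (at t)"
proof -
  define K where "K = max C 1"
  have K: "K \<ge> 1" "C \<le> K" "K > 0" by (auto simp: K_def)
  have lipK: "norm (F u - F v) \<le> K * norm (u - v)" for u v
    using lip[of u v] mult_right_mono[OF K(2), of "norm (u - v)"] by simp
  define e where "e = 1 / (8 * K)"
  have e: "e > 0" using K by (simp add: e_def)
  have M0: "M \<ge> 0" using bd[of 0] norm_ge_zero[of "F 0"] by linarith
  have contF: "continuous_on UNIV F"
    unfolding continuous_on_iff dist_norm
  proof (intro ballI allI impI)
    fix x :: 'a and d :: real assume "d > 0"
    have "norm (F y - F x) < d" if "norm (y - x) < d / K" for y
      using lipK[of y x] that K(3) by (simp add: field_simps)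
    then show "\<exists>\<delta>>0. \<forall>y\<in>UNIV. norm (y - x) < \<delta> \<longrightarrow> norm (F y - F x) < d"
      using K(3) \<open>d > 0\<close> by (intro exI[of _ "d/K"]) auto
  qed
  \<comment> \<open>Continuous functions on the interval are extended to the line by clamping the time.\<close>
  define cl where "cl t = max (-e) (min e t)" for t :: real
  have cl: "cl t \<in> {-e..e}" for t using e by (auto simp: cl_def)
  have clid: "cl t = t" if "t \<in> {-e..e}" for t using that by (auto simp: cl_def)
  have contcl: "continuous_on UNIV cl" unfolding cl_def by (intro continuous_intros)
  \<comment> \<open>Integrals start at the left end, so that negative times need no separate treatment.\<close>
  define I where "I g t = integral {-e..t} (\<lambda>s. F (apply_bcontfun g s))" for g :: "real \<Rightarrow>\<^sub>C 'a" and t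
  have contFg: "continuous_on S (\<lambda>s. F (apply_bcontfun g s))" for g :: "real \<Rightarrow>\<^sub>C 'a" and S
    by (intro continuous_on_compose2[OF contF] continuous_intros) auto
  have intFg: "(\<lambda>s. F (apply_bcontfun g s)) integrable_on {a..b}" for g :: "real \<Rightarrow>\<^sub>C 'a" and a b
    by (rule integrable_continuous_interval[OF contFg])
  have contI: "continuous_on {-e..e} (I g)" for g
    unfolding I_def by (rule indefinite_integral_continuous_1[OF intFg])
  have Ibound: "norm (I g t) \<le> M * (2*e)" if "t \<in> {-e..e}" for g t
  proof -
    have "norm (I g t) \<le> M * (t - (-e))"
      unfolding I_def by (rule integral_bound) (use that contFg bd in simp_all)
    also have "\<dots> \<le> M * (2*e)" using M0 that by (intro mult_left_mono) auto
    finally show ?thesis .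
  qed
  have Idiff: "norm (I g t - I h t) \<le> (K * dist g h) * (2*e)" if "t \<in> {-e..e}" for g h t
  proof -
    have "I g t - I h t = integral {-e..t} (\<lambda>s. F (apply_bcontfun g s) - F (apply_bcontfun h s))"
      unfolding I_def by (rule integral_diff[symmetric]) (rule intFg)+
    also have "norm \<dots> \<le> (K * dist g h) * (t - (-e))"
    proof (rule integral_bound)
      show "continuous_on {-e..t} (\<lambda>s. F (apply_bcontfun g s) - F (apply_bcontfun h s))"
        by (intro continuous_intros contFg)
      fix s
      have "norm (F (apply_bcontfun g s) - F (apply_bcontfun h s)) \<le> K * dist (apply_bcontfun g s) (apply_bcontfun h s)"
        unfolding dist_norm by (rule lipK)
      also have "\<dots> \<le> K * dist g h" using K dist_bounded by (intro mult_left_mono) auto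
      finally show "norm (F (apply_bcontfun g s) - F (apply_bcontfun h s)) \<le> K * dist g h" .
    qed (use that in simp)
    also have "\<dots> \<le> (K * dist g h) * (2*e)" using K that by (intro mult_left_mono) auto
    finally show ?thesis .
  qed
  define \<Phi> where "\<Phi> g t = u0 + (I g (cl t) - I g 0)" for g t
  have e0: "0 \<in> {-e..e}" using e by auto
  have \<Phi>b: "\<Phi> g \<in> bcontfun" for g
  proof (rule bcontfun_normI)
    show "continuous_on UNIV (\<Phi> g)"
      unfolding \<Phi>_def by (intro continuous_intros continuous_on_compose2[OF contI contcl]) (use cl in auto)
    show "norm (\<Phi> g x) \<le> norm u0 + (M*(2*e) + M*(2*e))" for x
      unfolding \<Phi>_def
      by (intro order_trans[OF norm_triangle_ineq] add_left_mono
          order_trans[OF norm_triangle_ineq4] add_mono Ibound cl e0)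
  qed
  define \<Psi> where "\<Psi> g = Bcontfun (\<Phi> g)" for g
  have \<Psi>: "apply_bcontfun (\<Psi> g) = \<Phi> g" for g
    unfolding \<Psi>_def using \<Phi>b by (simp add: Bcontfun_inverse)
  have "dist (\<Psi> g) (\<Psi> h) \<le> (1/2) * dist g h" for g h
  proof (rule dist_bound)
    fix t
    have "norm (\<Phi> g t - \<Phi> h t) = norm ((I g (cl t) - I h (cl t)) - (I g 0 - I h 0))"
      unfolding \<Phi>_def by (simp add: algebra_simps)
    also have "\<dots> \<le> norm (I g (cl t) - I h (cl t)) + norm (I g 0 - I h 0)" by (rule norm_triangle_ineq4)
    also have "\<dots> \<le> (K * dist g h) * (2*e) + (K * dist g h) * (2*e)"
      by (intro add_mono Idiff cl e0)
    also have "\<dots> = (1/2) * dist g h" using K by (simp add: e_def)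
    finally show "dist (apply_bcontfun (\<Psi> g) t) (apply_bcontfun (\<Psi> h) t) \<le> (1/2) * dist g h"
      by (simp add: \<Psi> dist_norm)
  qed
  then have "\<exists>!g. \<Psi> g = g" by (intro banach_fix_type[of "1/2"]) simp_all
  then obtain g where g: "\<Psi> g = g" by auto
  have eq: "apply_bcontfun g t = u0 + (I g t - I g 0)" if "t \<in> {-e..e}" for t
  proof -
    have "apply_bcontfun g t = \<Phi> g t" using g \<Psi> by metis
    then show ?thesis using clid[OF that] by (simp add: \<Phi>_def)
  qed
  have der: "(apply_bcontfun g has_vector_derivative F (apply_bcontfun g t)) (at t)" if "\<bar>t\<bar> < e" for t
  proof -
    have t: "t \<in> {-e..e}" "t \<in> {-e<..<e}" using that by auto
    have "(I g has_vector_derivative F (apply_bcontfun g t)) (at t within {-e..e})"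
      unfolding I_def by (rule integral_has_vector_derivative[OF contFg t(1)])
    then have "(I g has_vector_derivative F (apply_bcontfun g t)) (at t within {-e<..<e})"
      by (rule has_vector_derivative_within_subset) auto
    then have "(I g has_vector_derivative F (apply_bcontfun g t)) (at t)"
      using at_within_open[OF t(2)] by simp
    from has_vector_derivative_add[OF has_vector_derivative_const
        has_vector_derivative_diff[OF this has_vector_derivative_const]]
    have "((\<lambda>t. u0 + (I g t - I g 0)) has_vector_derivative F (apply_bcontfun g t)) (at t)"
      by simp
    then show ?thesis
      by (rule has_vector_derivative_transform_within_open[where S="{-e<..<e}"]) (use t eq in simp_all)
  qed
  have "apply_bcontfun g 0 = u0" using eq[OF e0] by simp
  then show ?thesis by (rule that[OF e _ der])
qed

lemma C1_imp_lipschitz_cball: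
  fixes F :: "'a::euclidean_space \<Rightarrow> 'b::euclidean_space"
  assumes "Ck_on 1 S F" "cball u r \<subseteq> S"
  obtains C where "\<And>v w. v \<in> cball u r \<Longrightarrow> w \<in> cball u r \<Longrightarrow> norm (F v - F w) \<le> C * norm (v - w)"
proof -
  let ?D = "\<lambda>x. frechet_derivative F (at x)"
  have d: "(F has_derivative ?D x) (at x)" if "x \<in> S" for x
    using Ck_on_SucD[of 0 S F x] assms(1) that by simp
  have cont: "continuous_on (cball u r) (\<lambda>x. \<Sum>b\<in>Basis. norm (?D x b))"
    using assms by (intro continuous_intros continuous_on_subset[OF _ assms(2)]) auto
  obtain C where C: "\<And>x. x \<in> cball u r \<Longrightarrow> norm (\<Sum>b\<in>Basis. norm (?D x b)) \<le> C"
    using compact_imp_bounded[OF compact_continuous_image[OF cont compact_cball]]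
    unfolding bounded_iff by blast
  have on: "onorm (?D x) \<le> C" if "x \<in> cball u r" for x
  proof (rule onorm_le)
    fix v
    have lin: "linear (?D x)" using d[of x] that assms(2) has_derivative_linear by blast
    have "?D x v = ?D x (\<Sum>b\<in>Basis. (v \<bullet> b) *\<^sub>R b)" by (simp add: euclidean_representation)
    also have "\<dots> = (\<Sum>b\<in>Basis. (v \<bullet> b) *\<^sub>R ?D x b)" using lin by (simp add: linear_sum linear_scale)
    also have "norm \<dots> \<le> (\<Sum>b\<in>Basis. norm v * norm (?D x b))"
      by (rule sum_norm_le) (auto intro!: mult_right_mono simp: Basis_le_norm)
    also have "\<dots> = (\<Sum>b\<in>Basis. norm (?D x b)) * norm v" by (simp add: sum_distrib_left mult.commute)
    also have "\<dots> \<le> C * norm v" using C[OF that] by (intro mult_right_mono) auto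
    finally show "norm (?D x v) \<le> C * norm v" .
  qed
  have "norm (F v - F w) \<le> C * norm (v - w)" if "v \<in> cball u r" "w \<in> cball u r" for v w
  proof (rule differentiable_bound[OF convex_cball _ on that])
    fix x assume x: "x \<in> cball u r"
    show "(F has_derivative ?D x) (at x within cball u r)"
      by (rule has_derivative_at_withinI[OF d]) (use x assms(2) in blast)
  qed
  then show ?thesis by (rule that)
qed

text \<open>Composition with the nearest point projection onto a ball extends the vector field to a bounded
Lipschitz one; for small times the solution stays inside the ball, where nothing was changed.\<close>
lemma ode_local:
  fixes F :: "'a::euclidean_space \<Rightarrow> 'a"
  assumes "Ck_on 1 S F" "open S" "u0 \<in> S"
  obtains e w where "e > 0" "w 0 = u0" 
    "\<And>t. \<bar>t\<bar> < e \<Longrightarrow> w t \<in> S \<and> (w has_vector_derivative F (w t)) (at t)"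
proof -
  obtain r where r: "r > 0" "cball u0 r \<subseteq> S" using assms open_contains_cball by metis
  obtain C where C: "\<And>v w. v \<in> cball u0 r \<Longrightarrow> w \<in> cball u0 r \<Longrightarrow> norm (F v - F w) \<le> C * norm (v - w)"
    using C1_imp_lipschitz_cball[OF assms(1) r(2)] by blast
  let ?c = "closest_point (cball u0 r)"
  define G where "G = F \<circ> ?c"
  have cin: "?c v \<in> cball u0 r" for v using r by (intro closest_point_in_set) auto
  have clip: "norm (?c v - ?c w) \<le> norm (v - w)" for v w
    using closest_point_lipschitz[of "cball u0 r" v w] r by (auto simp: dist_norm)
  have cself: "?c v = v" if "v \<in> cball u0 r" for v using that closest_point_self by metis
  have lip: "norm (G v - G w) \<le> \<bar>C\<bar> * norm (v - w)" for v w
  proof -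
    have "norm (G v - G w) \<le> C * norm (?c v - ?c w)" unfolding G_def comp_def by (intro C cin)
    also have "\<dots> \<le> \<bar>C\<bar> * norm (v - w)" by (intro mult_mono clip) auto
    finally show ?thesis .
  qed
  have "norm (G v) \<le> norm (F u0) + \<bar>C\<bar> * r" for v
  proof -
    have "norm (F (?c v) - F u0) \<le> C * norm (?c v - u0)" using r by (intro C cin) auto
    also have "\<dots> \<le> \<bar>C\<bar> * r" using cin[of v] by (intro mult_mono) (auto simp: dist_norm norm_minus_commute)
    finally show ?thesis unfolding G_def comp_def using norm_triangle_sub[of "F (?c v)" "F u0"] by simp
  qed
  then obtain e w where ew: "e > 0" "w 0 = u0" "\<And>t. \<bar>t\<bar> < e \<Longrightarrow> (w has_vector_derivative G (w t)) (at t)"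
    using ode_global[OF lip] by metis
  have "continuous (at 0) w" using ew(3)[of 0] ew(1) has_vector_derivative_continuous by fastforce
  then obtain d where d: "d > 0" "\<And>t. \<bar>t\<bar> < d \<Longrightarrow> dist (w t) u0 < r"
    using r(1) ew(2) unfolding continuous_at_eps_delta by (auto simp: dist_norm)
  show ?thesis
  proof (rule that[of "min d e" w])
    fix t :: real assume t: "\<bar>t\<bar> < min d e"
    then have "w t \<in> cball u0 r" using d(2)[of t] by (simp add: dist_commute)
    then show "w t \<in> S \<and> (w has_vector_derivative F (w t)) (at t)"
      using ew(3)[of t] t r(2) cself by (auto simp: G_def)
  qed (use ew d in auto)
qed

section \<open>Orientability of line fields over simply connected spaces\<close>

text \<open>The orthogonal projection onto the line spanned by \<open>v\<close>, as a matrix, when \<open>v\<close> is a unit vector. It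
embeds the projective space into a normed vector space.\<close>
definition line_proj :: "real^'n \<Rightarrow> real^'n^'n" where
  "line_proj v = (\<chi> i j. v $ i * v $ j)"

lemma line_proj_mult: "line_proj v *v w = (v \<bullet> w) *\<^sub>R v"
  by (simp add: line_proj_def matrix_vector_mult_def vec_eq_iff inner_vec_def sum_distrib_left
      algebra_simps)

lemma line_proj_minus: "line_proj (- v) = line_proj v"
  by (simp add: line_proj_def)

lemma continuous_on_line_proj: "continuous_on S line_proj"
  unfolding line_proj_def by (intro continuous_intros)

lemma line_proj_eqD:
  assumes "line_proj v = line_proj w" "norm v = 1" "norm w = 1"
  shows "v = w \<or> v = - w"
proof -
  have "v = (w \<bullet> v) *\<^sub>R w"
    using line_proj_mult[of v v] line_proj_mult[of w v] assms by (simp add: dot_square_norm)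
  moreover from this have "\<bar>w \<bullet> v\<bar> = 1" using assms(2,3) by (metis mult.right_neutral norm_scaleR)
  ultimately show ?thesis by (metis abs_1 abs_eq_iff scaleR_minus1_left scaleR_one)
qed

text \<open>The double covering of projective space by the sphere. Over the projections not orthogonal to
\<open>a\<close>, the two sheets are \<open>w \<bullet> a > 0\<close> and \<open>w \<bullet> a < 0\<close>, with inverse maps \<open>M \<mapsto> \<plusminus> M a / \<bar>M a\<bar>\<close>.\<close>
lemma line_proj_covering:
  "covering_space (sphere (0::real^'n) 1) line_proj (line_proj ` sphere 0 1)"
proof
  fix x :: "real^'n^'n" assume "x \<in> line_proj ` sphere 0 1"
  then obtain a :: "real^'n" where a: "norm a = 1" "x = line_proj a" by auto
  define T where "T = (line_proj ` sphere (0::real^'n) 1) \<inter> (\<lambda>M. (M *v a) \<bullet> a) -` {0<..}"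
  define V where "V e = sphere (0::real^'n) 1 \<inter> (\<lambda>w. e * (w \<bullet> a)) -` {0<..}" for e :: real
  have opT: "openin (top_of_set (line_proj ` sphere (0::real^'n) 1)) T"
    unfolding T_def matrix_vector_mult_def
    by (intro continuous_openin_preimage_gen continuous_intros open_greaterThan)
  have opV: "openin (top_of_set (sphere 0 1)) (V e)" for e
    unfolding V_def by (intro continuous_openin_preimage_gen continuous_intros open_greaterThan)
  have mT: "line_proj w \<in> T \<longleftrightarrow> w \<bullet> a \<noteq> 0" if "norm w = 1" for w
    using that by (auto simp: T_def line_proj_mult zero_less_mult_iff)
  have homeo: "homeomorphism (V e) T line_proj (\<lambda>M. e *\<^sub>R sgn (M *v a))" if e: "e = 1 \<or> e = -1" for e
  proof (rule homeomorphismI)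
    show "continuous_on (V e) line_proj" by (rule continuous_on_line_proj)
    have nz: "M *v a \<noteq> 0" if "M \<in> T" for M using that by (auto simp: T_def)
    show "continuous_on T (\<lambda>M. e *\<^sub>R sgn (M *v a))"
      using nz unfolding matrix_vector_mult_def
      by (intro continuous_on_scaleR continuous_on_const continuous_on_sgn)
        (auto intro!: continuous_intros)
    have inv: "e *\<^sub>R sgn (line_proj w *v a) = w" if "w \<in> V e" for w
      using that e by (auto simp: V_def line_proj_mult sgn_div_norm abs_if)
    then show "\<And>w. w \<in> V e \<Longrightarrow> e *\<^sub>R sgn (line_proj w *v a) = w" .
    show "line_proj ` V e \<subseteq> T" using mT by (auto simp: V_def)
    have ex: "\<exists>w\<in>V e. M = line_proj w" if M: "M \<in> T" for M
    proof -
      obtain w where w: "norm w = 1" "M = line_proj w" using M by (auto simp: T_def)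
      then have "w \<bullet> a \<noteq> 0" using mT M by auto
      then have "w \<in> V e \<or> - w \<in> V e" using e w(1) by (auto simp: V_def)
      then show ?thesis using w(2) line_proj_minus by metis
    qed
    show "(\<lambda>M. e *\<^sub>R sgn (M *v a)) ` T \<subseteq> V e" using ex inv by fastforce
    show "line_proj (e *\<^sub>R sgn (M *v a)) = M" if "M \<in> T" for M using ex[OF that] inv by auto
  qed
  show "\<exists>T. x \<in> T \<and> openin (top_of_set (line_proj ` sphere 0 1)) T \<and>
      (\<exists>v. \<Union> v = sphere 0 1 \<inter> line_proj -` T \<and> (\<forall>u\<in>v. openin (top_of_set (sphere 0 1)) u) \<and>
         pairwise disjnt v \<and> (\<forall>u\<in>v. \<exists>q. homeomorphism u T line_proj q))"
  proof (intro exI[of _ T] exI[of _ "{V 1, V (-1)}"] conjI)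
    show "x \<in> T" using mT[OF a(1)] a by (simp add: dot_square_norm)
    show "\<Union> {V 1, V (-1)} = sphere 0 1 \<inter> line_proj -` T"
      using mT by (auto simp: V_def)
    show "pairwise disjnt {V 1, V (-1)}"
      by (auto simp: pairwise_def disjnt_def V_def)
    show "\<forall>u\<in>{V 1, V (- 1)}. \<exists>q. homeomorphism u T line_proj q"
      using homeo[of 1] homeo[of "-1"] by blast
  qed (use opT opV in auto)
qed (auto intro: continuous_on_line_proj)

text \<open>Simply connected sets are path connected, in an arbitrary topological space.\<close>
lemma simply_connected_path_exists:
  fixes U :: "'m::topological_space set"
  assumes "simply_connected U" "x \<in> U" "y \<in> U"
  obtains g where "path g" "path_image g \<subseteq> U" "pathstart g = x" "pathfinish g = y"
proof -
  have p: "path (\<lambda>t::real. z)" "path_image (\<lambda>t::real. z) \<subseteq> U" if "z \<in> U" for z :: 'm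
    using that by (auto simp: path_def path_image_def)
  have "homotopic_loops U (\<lambda>_. x) (\<lambda>_. y)"
    using assms p unfolding simply_connected_def by (simp add: pathstart_def pathfinish_def)
  then obtain h :: "real \<times> real \<Rightarrow> 'm" where h: "continuous_on ({0..1} \<times> {0..1}) h"
     "\<And>t r. t \<in> {0..1} \<Longrightarrow> r \<in> {0..1} \<Longrightarrow> h (t, r) \<in> U" "\<And>t. t \<in> {0..1} \<Longrightarrow> h (0, t) = x" "\<And>t. t \<in> {0..1} \<Longrightarrow> h (1, t) = y"
    unfolding homotopic_loops Pi_iff by fastforce
  show ?thesis
  proof
    show "path (\<lambda>t. h (t, 0))"
      unfolding path_def by (rule continuous_on_compose2[OF h(1)]) (auto intro!: continuous_intros)
  qed (use h in \<open>auto simp: path_image_def pathstart_def pathfinish_def\<close>)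
qed

text \<open>The lift of a loop is a loop, for a map from a simply connected subset of an arbitrary topological
space into the base of a covering of normed spaces.\<close>
lemma simply_connected_lift_closed:
  fixes U :: "'m::topological_space set" and F :: "'m \<Rightarrow> 'b::real_normed_vector"
    and q :: "'a::real_normed_vector \<Rightarrow> 'b"
  assumes "simply_connected U" and cov: "covering_space C q S" and F: "continuous_on U F" "F \<in> U \<rightarrow> S"
    and g: "path g" "path_image g \<subseteq> U" "pathfinish g = pathstart g"
    and a: "a \<in> C" "q a = F (pathstart g)"
  obtains h where "path h" "path_image h \<subseteq> C" "pathstart h = a" "pathfinish h = a"
    "\<And>t. t \<in> {0..1} \<Longrightarrow> q (h t) = F (g t)"
proof -
  let ?x = "pathstart g"
  have "?x \<in> U" using g(2) pathstart_in_path_image by blast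
  then have p: "path (\<lambda>t::real. ?x)" "path_image (\<lambda>t::real. ?x) \<subseteq> U" 
    by (auto simp: path_def path_image_def)
  have "homotopic_loops U g (\<lambda>_. ?x)"
    using assms(1) p g unfolding simply_connected_def by (simp add: pathstart_def pathfinish_def)
  from homotopic_loops_continuous_image[OF this F]
  have "homotopic_loops S (F \<circ> g) (linepath (F ?x) (F ?x))"
    by (simp add: comp_def linepath_refl)
  from homotopic_loops_imp_homotopic_paths_null[OF this]
  have hom: "homotopic_paths S (linepath (F ?x) (F ?x)) (F \<circ> g)"
    by (simp add: pathstart_compose homotopic_paths_sym)
  show ?thesis
  proof (rule covering_space_lift_homotopic_path[OF cov hom, of "linepath a a" a a])
    fix h assume "path h" "path_image h \<subseteq> C" "pathstart h = a" "pathfinish h = a"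
      "\<And>t. t \<in> {0..1} \<Longrightarrow> q (h t) = (F \<circ> g) t"
    then show ?thesis using that[of h] by simp
  qed (use a in \<open>auto simp: linepath_refl path_image_def path_def pathstart_def pathfinish_def\<close>)
qed

text \<open>The end point of a lift depends only on the end points of the path: the lift of the first path
followed by the reversed second one is a loop, and its two halves are the given lifts.\<close>
lemma simply_connected_lift_unique:
  fixes U :: "'m::topological_space set" and F :: "'m \<Rightarrow> 'b::real_normed_vector"
    and q :: "'a::real_normed_vector \<Rightarrow> 'b"
  assumes "simply_connected U" and cov: "covering_space C q S" and F: "continuous_on U F" "F \<in> U \<rightarrow> S"
    and g1: "path g1" "path_image g1 \<subseteq> U" and g2: "path g2" "path_image g2 \<subseteq> U"
    and ends: "pathstart g1 = pathstart g2" "pathfinish g1 = pathfinish g2"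
    and h1: "path h1" "path_image h1 \<subseteq> C" "\<And>t. t \<in> {0..1} \<Longrightarrow> q (h1 t) = F (g1 t)"
    and h2: "path h2" "path_image h2 \<subseteq> C" "\<And>t. t \<in> {0..1} \<Longrightarrow> q (h2 t) = F (g2 t)"
    and start: "pathstart h1 = pathstart h2"
  shows "pathfinish h1 = pathfinish h2"
proof -
  let ?p = "g1 +++ reversepath g2"
  have p: "path ?p" "path_image ?p \<subseteq> U" "pathfinish ?p = pathstart ?p"
    using g1 g2 ends by (auto simp: subset_path_image_join)
  have a: "pathstart h1 \<in> C" "q (pathstart h1) = F (pathstart ?p)"
    using h1 pathstart_in_path_image by (auto simp: pathstart_def joinpaths_def)
  obtain h where h: "path h" "path_image h \<subseteq> C" "pathstart h = pathstart h1" "pathfinish h = pathstart h1"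
    "\<And>t. t \<in> {0..1} \<Longrightarrow> q (h t) = F (?p t)"
    using simply_connected_lift_closed[OF assms(1) cov F p a] by blast
  have ch: "continuous_on {0..1} h" "continuous_on {0..1} h1" "continuous_on {0..1} h2"
    using h h1 h2 by (auto simp: path_def)
  have hC: "h t \<in> C" "h1 t \<in> C" "h2 t \<in> C" if "t \<in> {0..1}" for t
    using that h(2) h1(2) h2(2) by (auto simp: path_image_def)
  have cont: "continuous_on {0..1} (F \<circ> g1)" "continuous_on {0..1} (F \<circ> g2)"
    using path_continuous_image[OF g1(1) continuous_on_subset[OF F(1) g1(2)]]
      path_continuous_image[OF g2(1) continuous_on_subset[OF F(1) g2(2)]] by (simp_all add: path_def)
  have im: "F (g1 t) \<in> S" "F (g2 t) \<in> S" if "t \<in> {0..1}" for t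
    using that g1(2) g2(2) F(2) unfolding path_image_def Pi_iff by blast+
  have "h1 1 = (\<lambda>t. h (t/2)) 1"
  proof (rule covering_space_lift_unique[OF cov, where f="F \<circ> g1" and ?g1.0=h1 and ?g2.0="\<lambda>t. h (t/2)" and T="{0..1}" and a=0])
    show "h1 0 = h (0/2)" using h(3) by (simp add: pathstart_def)
    show "continuous_on {0..1} (\<lambda>t. h (t/2))"
      by (rule continuous_on_compose2[OF ch(1)]) (auto intro!: continuous_intros)
    show "(F \<circ> g1) x = q (h (x/2))" if "x \<in> {0..1}" for x
      using h(5)[of "x/2"] that by (simp add: joinpaths_def)
  qed (use ch cont hC im h1(3) in auto)
  moreover have "h2 1 = (\<lambda>t. h (1 - t/2)) 1"
  proof (rule covering_space_lift_unique[OF cov, where f="F \<circ> g2" and ?g1.0=h2 and ?g2.0="\<lambda>t. h (1 - t/2)" and T="{0..1}" and a=0])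
    show "h2 0 = h (1 - 0/2)" using h(4) start by (simp add: pathstart_def pathfinish_def)
    show "continuous_on {0..1} (\<lambda>t. h (1 - t/2))"
      by (rule continuous_on_compose2[OF ch(1)]) (auto intro!: continuous_intros)
    show "(F \<circ> g2) x = q (h (1 - x/2))" if "x \<in> {0..1}" for x
      using h(5)[of "1 - x/2"] that ends(2) by (auto simp: joinpaths_def reversepath_def pathfinish_def split: if_splits)
  qed (use ch cont hC im h2(3) in auto)
  ultimately show ?thesis by (simp add: pathfinish_def)
qed

text \<open>A unit vector of the line at a base point is carried to any other point by lifting a path; the
result does not depend on the path. On a neighbourhood with a nowhere zero section it is this section
normalised, up to a constant sign, so it is continuous.\<close>
lemma line_field_orientable:
  fixes U :: "'m::t2_space set" and E :: "'m \<Rightarrow> (real^'n) set"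
  assumes sc: "simply_connected U"
    and triv: "\<And>x. x \<in> U \<Longrightarrow> \<exists>N s. open N \<and> x \<in> N \<and> N \<subseteq> U \<and> path_connected N \<and> continuous_on N s \<and>
       (\<forall>y\<in>N. E y = span {s y} \<and> s y \<noteq> 0)"
  obtains l where "continuous_on U l" "\<And>x. x \<in> U \<Longrightarrow> l x \<in> E x" "\<And>x. x \<in> U \<Longrightarrow> norm (l x) = 1"
proof (cases "U = {}")
  case True
  then show ?thesis using that[of "\<lambda>_. 0"] by simp
next
  case False
  then obtain x0 where x0: "x0 \<in> U" by auto
  let ?C = "sphere (0::real^'n) 1"
  let ?S = "line_proj ` ?C"
  define u where "u y = (SOME v. v \<in> E y \<and> norm v = 1)" for y
  define F where "F y = line_proj (u y)" for y
  have unit_pm: "v = sgn s \<or> v = - sgn s" if vs: "v \<in> span {s}" "norm v = 1" for v s :: "real^'n"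
  proof -
    obtain k where k: "v = k *\<^sub>R s" using vs(1) unfolding span_singleton by blast
    then have "s \<noteq> 0" "\<bar>k\<bar> = inverse (norm s)" using vs(2) by (auto simp: inverse_eq_divide eq_divide_eq)
    moreover from this have "k = inverse (norm s) \<or> k = - inverse (norm s)" by linarith
    ultimately show ?thesis using k by (auto simp: sgn_div_norm)
  qed
  have FN: "F y = line_proj (sgn s)" "u y \<in> E y" "norm (u y) = 1" if "E y = span {s}" "s \<noteq> 0" for y s
  proof -
    have "\<exists>v. v \<in> E y \<and> norm v = 1"
      using that by (intro exI[of _ "sgn s"]) (auto simp: norm_sgn sgn_div_norm span_base span_scale)
    from someI_ex[OF this] have u: "u y \<in> E y" "norm (u y) = 1" by (auto simp: u_def)
    then show "u y \<in> E y" "norm (u y) = 1" by auto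
    show "F y = line_proj (sgn s)"
      using unit_pm[of "u y" s] u that line_proj_minus by (auto simp: F_def)
  qed
  have contF: "continuous_on U F"
  proof (intro continuous_at_imp_continuous_on ballI)
    fix x assume x: "x \<in> U"
    obtain N s where N: "open N" "x \<in> N" "continuous_on N s" "\<forall>y\<in>N. E y = span {s y} \<and> s y \<noteq> 0"
      using triv[OF x] by blast
    have "continuous_on N (\<lambda>y. sgn (s y))"
      by (rule continuous_on_sgn[OF N(3)]) (use N(4) in blast)
    from continuous_on_compose2[OF continuous_on_line_proj this subset_UNIV]
    have "continuous_on N (\<lambda>y. line_proj (sgn (s y)))" .
    moreover have "line_proj (sgn (s y)) = F y" if "y \<in> N" for y
      using FN(1)[of y "s y"] N(4) that by metis
    ultimately have "continuous_on N F" by (rule continuous_on_eq)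
    from this[unfolded continuous_on_eq_continuous_at[OF N(1)]] N(2) show "isCont F x" by (rule bspec)
  qed
  have FS: "F \<in> U \<rightarrow> ?S"
  proof
    fix x assume x: "x \<in> U"
    obtain s where "E x = span {s}" "s \<noteq> 0" using triv[OF x] by blast
    from FN(3)[OF this] show "F x \<in> ?S" unfolding F_def by simp
  qed
  obtain a where a: "a \<in> ?C" "line_proj a = F x0" using funcset_mem[OF FS x0] by (metis imageE)
  \<comment> \<open>\<open>good y v\<close>: the vector \<open>a\<close> at \<open>x0\<close> is carried to \<open>v\<close> along some path from \<open>x0\<close> to \<open>y\<close>.\<close>
  define good where "good y v \<longleftrightarrow> (\<exists>g h. path g \<and> path_image g \<subseteq> U \<and> pathstart g = x0 \<and> pathfinish g = y \<and>
     path h \<and> path_image h \<subseteq> ?C \<and> pathstart h = a \<and> pathfinish h = v \<and>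
     (\<forall>t\<in>{0..1}. line_proj (h t) = F (g t)))" for y v
  have uniq: "v = v'" if gv: "good y v" and gv': "good y v'" for y v v'
  proof -
    obtain g1 h1 where 1: "path g1" "path_image g1 \<subseteq> U" "pathstart g1 = x0" "pathfinish g1 = y"
      "path h1" "path_image h1 \<subseteq> ?C" "pathstart h1 = a" "pathfinish h1 = v"
      "\<And>t. t \<in> {0..1} \<Longrightarrow> line_proj (h1 t) = F (g1 t)" using gv unfolding good_def by blast
    obtain g2 h2 where 2: "path g2" "path_image g2 \<subseteq> U" "pathstart g2 = x0" "pathfinish g2 = y"
      "path h2" "path_image h2 \<subseteq> ?C" "pathstart h2 = a" "pathfinish h2 = v'"
      "\<And>t. t \<in> {0..1} \<Longrightarrow> line_proj (h2 t) = F (g2 t)" using gv' unfolding good_def by blast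
    have "pathfinish h1 = pathfinish h2"
      by (rule simply_connected_lift_unique[OF sc line_proj_covering contF FS 1(1,2) 2(1,2) _ _ 1(5,6,9) 2(5,6,9)])
         (simp_all add: 1 2)
    then show ?thesis using 1 2 by simp
  qed
  have ex: "\<exists>v. good y v" if y: "y \<in> U" for y
  proof -
    obtain g where g: "path g" "path_image g \<subseteq> U" "pathstart g = x0" "pathfinish g = y"
      using simply_connected_path_exists[OF sc x0 y] by blast
    have "path (F \<circ> g)" by (rule path_continuous_image[OF g(1) continuous_on_subset[OF contF g(2)]])
    moreover have "path_image (F \<circ> g) \<subseteq> ?S" using g(2) FS by (auto simp: path_image_compose)
    moreover have "pathstart (F \<circ> g) = line_proj a" using a(2) g(3) by (simp add: pathstart_compose)
    ultimately obtain h where "path h" "path_image h \<subseteq> ?C" "pathstart h = a"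
      "\<And>t. t \<in> {0..1} \<Longrightarrow> line_proj (h t) = (F \<circ> g) t"
      using covering_space_lift_path_strong[OF line_proj_covering a(1)] by blast
    then have "good y (pathfinish h)"
      unfolding good_def using g by (intro exI[of _ g] exI[of _ h]) simp
    then show ?thesis ..
  qed
  have unit: "norm v = 1 \<and> line_proj v = F y" if "good y v" for y v
  proof -
    obtain g h where gh: "pathfinish g = y" "path_image h \<subseteq> ?C" "pathfinish h = v"
      "\<forall>t\<in>{0..1}. line_proj (h t) = F (g t)" using \<open>good y v\<close> unfolding good_def by blast
    have "v \<in> ?C" using gh(2,3) pathfinish_in_path_image by blast
    moreover have "line_proj v = F y" using gh by (auto simp: pathfinish_def)
    ultimately show ?thesis by simp
  qed
  have ext: "good z (e *\<^sub>R sgn (s z))"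
    if N: "N \<subseteq> U" "path_connected N" "continuous_on N s" "\<forall>y\<in>N. E y = span {s y} \<and> s y \<noteq> 0"
      and yz: "y \<in> N" "z \<in> N" and gy: "good y (e *\<^sub>R sgn (s y))" and e: "e = 1 \<or> e = -1"
    for N s y z and e :: real
  proof -
    obtain g h where gh: "path g" "path_image g \<subseteq> U" "pathstart g = x0" "pathfinish g = y"
      "path h" "path_image h \<subseteq> ?C" "pathstart h = a" "pathfinish h = e *\<^sub>R sgn (s y)"
      "\<forall>t\<in>{0..1}. line_proj (h t) = F (g t)" using gy unfolding good_def by blast
    obtain k where k: "path k" "path_image k \<subseteq> N" "pathstart k = y" "pathfinish k = z"
      using N(2) yz unfolding path_connected_def by blast
    let ?r = "(\<lambda>y. e *\<^sub>R sgn (s y)) \<circ> k"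
    have r: "path ?r"
      by (rule path_continuous_image[OF k(1)], rule continuous_on_subset[OF _ k(2)])
         (rule continuous_on_scaleR[OF continuous_on_const continuous_on_sgn[OF N(3)]], use N(4) in blast)
    have kN: "k t \<in> N" if "t \<in> {0..1}" for t using k(2) that by (auto simp: path_image_def)
    have rC: "?r t \<in> ?C" "line_proj (?r t) = F (k t)" if "t \<in> {0..1}" for t
      using kN[OF that] N(4) FN(1) e by (auto simp: norm_sgn line_proj_minus)
    have "line_proj ((h +++ ?r) t) = F ((g +++ k) t)" if "t \<in> {0..1}" for t
      using that gh(9) rC(2)[of "2*t-1"] by (auto simp: joinpaths_def)
    moreover have "path_image (h +++ ?r) \<subseteq> ?C"
      using gh(6) rC(1) by (intro subset_path_image_join) (auto simp: path_image_def)
    moreover have "path_image (g +++ k) \<subseteq> U"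
      using gh(2) k(2) N(1) by (intro subset_path_image_join) auto
    ultimately show ?thesis unfolding good_def using gh k r
      by (intro exI[of _ "g +++ k"] exI[of _ "h +++ ?r"]) (simp add: pathstart_compose pathfinish_compose)
  qed
  define l where "l y = (THE v. good y v)" for y
  have good_l: "good y (l y)" if "y \<in> U" for y
    unfolding l_def by (rule theI') (use ex[OF that] uniq in blast)
  have pm: "l x = sgn s \<or> l x = - sgn s" if "x \<in> U" "E x = span {s}" "s \<noteq> 0" for x s
    using unit[OF good_l[OF that(1)]] FN(1)[OF that(2,3)] line_proj_eqD[of "l x" "sgn s"] that(3)
    by (simp add: norm_sgn)
  show ?thesis
  proof (rule that[of l])
    show "continuous_on U l"
    proof (intro continuous_at_imp_continuous_on ballI)
      fix x assume x: "x \<in> U"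
      obtain N s where N: "open N" "x \<in> N" "N \<subseteq> U" "path_connected N" "continuous_on N s"
        "\<forall>y\<in>N. E y = span {s y} \<and> s y \<noteq> 0"
        using triv[OF x] by blast
      obtain e :: real where e: "e = 1 \<or> e = -1" "l x = e *\<^sub>R sgn (s x)"
        using pm[OF x, of "s x"] N(2,6) by (metis scaleR_minus1_left scaleR_one)
      have "l z = e *\<^sub>R sgn (s z)" if "z \<in> N" for z
      proof (rule uniq)
        show "good z (l z)" using good_l N(3) that by blast
        show "good z (e *\<^sub>R sgn (s z))"
          by (rule ext[OF N(3-6) N(2) that _ e(1)]) (use good_l[OF x] e(2) in simp)
      qed
      then have "e *\<^sub>R sgn (s z) = l z" if "z \<in> N" for z using that by metis
      moreover have "continuous_on N (\<lambda>z. e *\<^sub>R sgn (s z))"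
        by (rule continuous_on_scaleR[OF continuous_on_const continuous_on_sgn[OF N(5)]]) (use N(6) in blast)
      ultimately have "continuous_on N l" by (intro continuous_on_eq[of N _ l])
      from this[unfolded continuous_on_eq_continuous_at[OF N(1)]] N(2) show "isCont l x" by (rule bspec)
    qed
  next
    fix x assume x: "x \<in> U"
    obtain s where s: "E x = span {s}" "s \<noteq> 0" using triv[OF x] by blast
    have "sgn s \<in> span {s}" by (simp add: sgn_div_norm span_base span_scale)
    then show "l x \<in> E x" using pm[OF x s] s(1) span_neg by metis
    show "norm (l x) = 1" using unit[OF good_l[OF x]] by simp
  qed
qed

section \<open>Null planes for a form of signature (4,2)\<close>

lemma dim_Int_trivial_le:
  fixes S T :: "'a::euclidean_space set"
  assumes "subspace S" "subspace T" "S \<inter> T \<subseteq> {0}"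
  shows "dim S + dim T \<le> DIM('a)"
proof -
  have "dim (S \<inter> T) = 0" using assms(3) by (simp add: dim_eq_0)
  then have "dim S + dim T = dim {x + y |x y. x \<in> S \<and> y \<in> T}"
    using dim_sums_Int[OF assms(1,2)] by linarith
  also have "\<dots> \<le> DIM('a)" by (rule dim_subset_UNIV)
  finally show ?thesis .
qed

text \<open>For totally isotropic \<open>F\<close>, the kernel of the projection from the exterior square of \<open>F\<^sup>\<bottom>\<close> onto that of
\<open>F\<^sup>\<bottom> / F\<close>. With \<open>F = f x\<close>, the condition \<open>\<B>(T,T) = 0\<close> at \<open>x\<close> is membership in this space.\<close>
definition contact_bivectors :: "(real^6 \<Rightarrow> real^6 \<Rightarrow> real) \<Rightarrow> (real^6) set \<Rightarrow> (real^6^6) set" where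
  "contact_bivectors ip F = span {wedge a b | a b. a \<in> F \<and> b \<in> perp ip F}"

lemma wedge_simps:
  "wedge (a + b) c = wedge a c + wedge b c" "wedge a (b + c) = wedge a b + wedge a c"
  "wedge (r *\<^sub>R a) b = r *\<^sub>R wedge a b" "wedge a (r *\<^sub>R b) = r *\<^sub>R wedge a b"
  "wedge a a = 0" "wedge (a - b) c = wedge a c - wedge b c"
  by (simp_all add: wedge_def vec_eq_iff algebra_simps)

lemma wedge_swap: "wedge a b = - wedge b a"
  by (simp add: wedge_def vec_eq_iff)

text \<open>The space \<open>\<real>\<^sup>6\<close> with an arbitrary form of signature \<open>(4,2)\<close>.\<close>
locale lie_quadric =
  fixes ip :: "real^6 \<Rightarrow> real^6 \<Rightarrow> real"
  assumes signature: "form_of_signature ip 4 2"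
begin

lemma bilinear_ip: "bilinear ip"
  and ip_commute: "ip u v = ip v u"
  using signature unfolding form_of_signature_def by auto

lemma bounded_bilinear_ip: "bounded_bilinear ip"
  using bilinear_ip bilinear_conv_bounded_bilinear by blast

lemmas ip_simps = bilinear_ladd[OF bilinear_ip] bilinear_radd[OF bilinear_ip]
  bilinear_lmul[OF bilinear_ip] bilinear_rmul[OF bilinear_ip]
  bilinear_lsub[OF bilinear_ip] bilinear_rsub[OF bilinear_ip]
  bilinear_lzero[OF bilinear_ip] bilinear_rzero[OF bilinear_ip]
  bilinear_lneg[OF bilinear_ip] bilinear_rneg[OF bilinear_ip]

lemma subspace_perp: "subspace (perp ip S)"
  unfolding subspace_def perp_def by (auto simp: ip_simps)

lemma perp_span: "perp ip (span S) = perp ip S"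
proof
  show "perp ip S \<subseteq> perp ip (span S)"
  proof
    fix v assume v: "v \<in> perp ip S"
    have "subspace {u. ip u v = 0}" by (auto simp: subspace_def ip_simps)
    then have "span S \<subseteq> {u. ip u v = 0}"
      using v by (intro span_minimal) (auto simp: perp_def)
    then show "v \<in> perp ip (span S)" by (auto simp: perp_def)
  qed
qed (use span_superset in \<open>auto simp: perp_def\<close>)

text \<open>Such a subspace meets a positive definite subspace of dimension 4 only in zero.\<close>
lemma nonpos_dim_le:
  assumes "subspace S" "\<And>v. v \<in> S \<Longrightarrow> ip v v \<le> 0"
  shows "dim S \<le> 2"
proof -
  obtain P where P: "subspace P" "dim P = 4" "\<forall>v\<in>P. v \<noteq> 0 \<longrightarrow> ip v v > 0"
    using signature unfolding form_of_signature_def by auto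
  have "S \<inter> P \<subseteq> {0}" using P(3) assms(2) by fastforce
  then show ?thesis using dim_Int_trivial_le[OF assms(1) P(1)] P(2) by simp
qed

lemma nonneg_dim_le:
  assumes "subspace S" "\<And>v. v \<in> S \<Longrightarrow> ip v v \<ge> 0"
  shows "dim S \<le> 4"
proof -
  obtain P where P: "subspace P" "dim P = 2" "\<forall>v\<in>P. v \<noteq> 0 \<longrightarrow> ip v v < 0"
    using signature unfolding form_of_signature_def by auto
  have "S \<inter> P \<subseteq> {0}" using P(3) assms(2) by fastforce
  then show ?thesis using dim_Int_trivial_le[OF assms(1) P(1)] P(2) by simp
qed

text \<open>Totally isotropic subspaces of dimension 2, the points of the Grassmannian \<open>\<Z>\<close>.\<close>
definition null_plane :: "(real^6) set \<Rightarrow> bool" where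
  "null_plane F \<longleftrightarrow> subspace F \<and> dim F = 2 \<and> (\<forall>u\<in>F. \<forall>v\<in>F. ip u v = 0)"

text \<open>Otherwise \<open>v\<close> and \<open>F\<close> would span a subspace of dimension 3 on which the form is nonpositive.\<close>
lemma perp_nonpos_in_null_plane:
  assumes "null_plane F" "v \<in> perp ip F" "ip v v \<le> 0"
  shows "v \<in> F"
proof (rule ccontr)
  have F: "subspace F" "dim F = 2" "\<And>u w. u \<in> F \<Longrightarrow> w \<in> F \<Longrightarrow> ip u w = 0"
    using assms(1) by (auto simp: null_plane_def)
  assume "v \<notin> F"
  then have 3: "dim (span (insert v F)) = 3"
    using F(1,2) by (simp add: dim_insert span_eq_iff[THEN iffD2])
  have "dim (span (insert v F)) \<le> 2"
  proof (rule nonpos_dim_le)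
    fix w assume "w \<in> span (insert v F)"
    then obtain k where "w - k *\<^sub>R v \<in> span F" by (auto simp: span_insert)
    then obtain u where u: "u \<in> F" "w = u + k *\<^sub>R v"
      using span_eq_iff[of F] F(1) by (metis diff_add_cancel)
    have "ip u v = 0" using u(1) assms(2) by (auto simp: perp_def)
    then have "ip w w = k^2 * ip v v" 
      using u F(3)[of u u] ip_commute[of v u] by (simp add: ip_simps power2_eq_square)
    then show "ip w w \<le> 0" using assms(3) by (simp add: mult_nonneg_nonpos)
  qed simp
  then show False using 3 by simp
qed

lemma perp_spacelike:
  assumes "null_plane F" "v \<in> perp ip F" "v \<notin> F"
  shows "ip v v > 0"
  using perp_nonpos_in_null_plane[OF assms(1,2)] assms(3) by force

lemma null_plane_subset_perp: "null_plane F \<Longrightarrow> F \<subseteq> perp ip F"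
  by (auto simp: null_plane_def perp_def)

lemma timelike_not_perp:
  assumes "null_plane F" "timelike ip p"
  obtains s where "s \<in> F" "ip s p \<noteq> 0"
proof (rule ccontr)
  assume "\<not> thesis"
  then have "p \<in> perp ip F" using that by (auto simp: perp_def)
  then have "p \<in> F" using perp_nonpos_in_null_plane assms by (auto simp: timelike_def)
  then show False using assms by (auto simp: null_plane_def timelike_def)
qed

text \<open>The space \<open>F\<^sup>\<bottom>\<close> has dimension at most 4. If \<open>u\<close> and \<open>v\<close> were independent modulo \<open>F\<close>, they would
span it together with \<open>F\<close>, and \<open>w\<close> would be orthogonal to itself.\<close>
lemma dependent_mod_null_plane:
  assumes F: "null_plane F" and perp: "u \<in> perp ip F" "v \<in> perp ip F" "w \<in> perp ip F"
    and w: "w \<notin> F" and uw: "ip u w = 0" and vw: "ip v w = 0"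
  obtains a b where "a \<noteq> 0 \<or> b \<noteq> 0" "a *\<^sub>R u + b *\<^sub>R v \<in> F"
proof (rule ccontr)
  assume no: "\<not> thesis"
  have F': "subspace F" "dim F = 2" "span F = F" "F \<subseteq> perp ip F"
    using F null_plane_subset_perp span_eq_iff by (auto simp: null_plane_def)
  have "u \<notin> F" using no that[of 1 0] by auto
  have "v \<notin> span (insert u F)"
  proof
    assume "v \<in> span (insert u F)"
    then obtain k where "v - k *\<^sub>R u \<in> F" using F' by (auto simp: span_insert)
    then show False using no that[of "-k" 1] by (simp add: algebra_simps)
  qed
  then have 4: "dim (span (insert v (insert u F))) = 4"
    using \<open>u \<notin> F\<close> F'(2) by (simp add: dim_insert F'(3))
  have sub: "span (insert v (insert u F)) \<subseteq> perp ip F"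
    using perp F' by (intro span_minimal subspace_perp) auto
  have "dim (perp ip F) \<le> 4"
    using perp_spacelike[OF F] F
    by (intro nonneg_dim_le subspace_perp) (force simp: null_plane_def)
  then have "span (insert v (insert u F)) = perp ip F"
    using 4 by (intro subspace_dim_equal[OF _ subspace_perp sub]) auto
  then have "w \<in> span (insert v (insert u F))" using perp by simp
  moreover have "span (insert v (insert u F)) \<subseteq> {x. ip x w = 0}"
    using perp(3) uw vw by (intro span_minimal) (auto simp: subspace_def ip_simps perp_def)
  ultimately have "ip w w = 0" by auto
  then show False using perp_nonpos_in_null_plane[OF F perp(3)] w by simp
qed

text \<open>Dependent vectors of \<open>F\<^sup>\<bottom> / F\<close> have wedge product zero.\<close>
lemma wedge_mem_contact_bivectors:
  assumes F: "null_plane F" and perp: "u \<in> perp ip F" "v \<in> perp ip F"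
    and dep: "a \<noteq> 0 \<or> b \<noteq> 0" "a *\<^sub>R u + b *\<^sub>R v \<in> F"
  shows "wedge u v \<in> contact_bivectors ip F"
proof -
  let ?y = "a *\<^sub>R u + b *\<^sub>R v"
  have "wedge ?y v \<in> contact_bivectors ip F" "wedge ?y u \<in> contact_bivectors ip F"
    unfolding contact_bivectors_def using dep(2) perp by (blast intro: span_base)+
  moreover have "wedge ?y v = a *\<^sub>R wedge u v" "wedge ?y u = (-b) *\<^sub>R wedge u v"
    by (simp_all add: wedge_simps wedge_swap[of v u])
  ultimately have "a *\<^sub>R wedge u v \<in> contact_bivectors ip F" "(-b) *\<^sub>R wedge u v \<in> contact_bivectors ip F"
    by simp_all
  then have "(1/a) *\<^sub>R (a *\<^sub>R wedge u v) \<in> contact_bivectors ip F"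
    "(1/(-b)) *\<^sub>R ((-b) *\<^sub>R wedge u v) \<in> contact_bivectors ip F"
    unfolding contact_bivectors_def by - (rule span_scale, assumption)+
  then show ?thesis using dep(1) by (cases "a = 0") simp_all
qed

text \<open>If \<open>u \<and> v\<close> vanishes modulo \<open>F\<close> and \<open>u\<close> is not in \<open>F\<close>, then \<open>v\<close> is a multiple of \<open>u\<close> modulo \<open>F\<close>, so it
is orthogonal to \<open>w\<close> along with \<open>u\<close>. The proof evaluates on \<open>u \<and> v\<close> the linear functional
\<open>a \<and> b \<mapsto> (a,u)(b,w) - (b,u)(a,w)\<close>, which vanishes on the bivectors in question.\<close>
lemma contact_bivectors_perp:
  assumes F: "null_plane F" and perp: "u \<in> perp ip F" "w \<in> perp ip F"
    and u: "u \<notin> F" and uw: "ip u w = 0" and mem: "wedge u v \<in> contact_bivectors ip F"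
  shows "ip v w = 0"
proof -
  define \<phi> where "\<phi> M = (\<Sum>i\<in>UNIV. \<Sum>j\<in>UNIV. M $ i $ j * (ip (axis i 1) u * ip (axis j 1) w))" for M :: "real^6^6"
  have ip_sum: "ip a x = (\<Sum>i\<in>UNIV. a $ i * ip (axis i 1) x)" for a x
  proof -
    have "linear (\<lambda>a. ip a x)" using bilinear_ip by (simp add: bilinear_def)
    from linear_sum[OF this, of "\<lambda>i. a $ i *\<^sub>R axis i 1" UNIV]
    have "ip (\<Sum>i\<in>UNIV. a $ i *\<^sub>R axis i 1) x = (\<Sum>i\<in>UNIV. a $ i * ip (axis i 1) x)"
      by (simp add: ip_simps)
    then show ?thesis using basis_expansion[of a] by (simp add: scalar_mult_eq_scaleR)
  qed
  have \<phi>w: "\<phi> (wedge a b) = ip a u * ip b w - ip b u * ip a w" for a b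
    unfolding ip_sum[of a] ip_sum[of b] sum_product \<phi>_def wedge_def
    by (simp add: sum_subtractf[symmetric] algebra_simps)
  have "subspace {M. \<phi> M = 0}"
  proof -
    have "\<phi> (M + N) = \<phi> M + \<phi> N" for M N
      by (simp add: \<phi>_def distrib_right sum.distrib)
    moreover have "\<phi> (r *\<^sub>R M) = r * \<phi> M" for r M
      by (simp add: \<phi>_def sum_distrib_left mult.assoc)
    moreover have "\<phi> 0 = 0" by (simp add: \<phi>_def)
    ultimately show ?thesis by (simp add: subspace_def)
  qed
  then have "contact_bivectors ip F \<subseteq> {M. \<phi> M = 0}"
    unfolding contact_bivectors_def using perp
    by (intro span_minimal) (auto simp: \<phi>w perp_def)
  then have "ip u u * ip v w = 0" using mem \<phi>w[of u v] uw by auto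
  then show ?thesis using perp_spacelike[OF F perp(1) u] by simp
qed

text \<open>The generator is written as a sum, so that it is visibly a smooth expression in \<open>a\<close> and \<open>b\<close>.\<close>
lemma point_sphere_span:
  assumes F: "null_plane F" "F = span {a, b}" and p: "timelike ip p"
  shows "F \<inter> perp ip {p} = span {ip b p *\<^sub>R a + ip a (- p) *\<^sub>R b}"
    and "ip b p *\<^sub>R a + ip a (- p) *\<^sub>R b \<noteq> 0"
proof -
  let ?\<sigma> = "ip b p *\<^sub>R a + ip a (- p) *\<^sub>R b"
  have dim: "dim {a, b} = 2" using F unfolding null_plane_def by simp
  have "dim {b} \<le> 1" using dim_le_card'[of "{b}"] by simp
  then have a: "a \<notin> span {b}" using dim dim_insert[of a "{b}"] by (auto split: if_splits)
  have b: "b \<noteq> 0"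
  proof
    assume "b = 0"
    then have "dim {b} = 0" by simp
    then show False using dim dim_insert[of a "{b}"] by (auto split: if_splits)
  qed
  obtain s where s: "s \<in> F" "ip s p \<noteq> 0" using timelike_not_perp[OF F(1) p] by blast
  have mem: "u \<in> F \<longleftrightarrow> (\<exists>k l. u = k *\<^sub>R a + l *\<^sub>R b)" for u
    unfolding F(2) span_insert span_singleton by (auto simp: diff_eq_eq add.commute)
  have ab: "ip a p \<noteq> 0 \<or> ip b p \<noteq> 0" using s mem[of s] by (auto simp: ip_simps)
  show nz: "?\<sigma> \<noteq> 0"
  proof
    assume 0: "?\<sigma> = 0"
    show False
    proof (cases "ip b p = 0")
      case True
      then show False using 0 ab b by (simp add: ip_simps)
    next
      case False
      have "ip b p *\<^sub>R a = ip a p *\<^sub>R b" using 0 by (simp add: ip_simps)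
      then have "(1 / ip b p) *\<^sub>R (ip b p *\<^sub>R a) = (1 / ip b p) *\<^sub>R (ip a p *\<^sub>R b)" by simp
      then have "a = (ip a p / ip b p) *\<^sub>R b" using False by simp
      then show False using a span_mul span_base by (metis insertI1 span_scale)
    qed
  qed
  show "F \<inter> perp ip {p} = span {?\<sigma>}"
  proof
    show "span {?\<sigma>} \<subseteq> F \<inter> perp ip {p}"
    proof (rule span_minimal)
      have "?\<sigma> \<in> F" using mem by blast
      moreover have "ip ?\<sigma> p = 0" by (simp add: ip_simps)
      ultimately show "{?\<sigma>} \<subseteq> F \<inter> perp ip {p}" using ip_commute by (simp add: perp_def)
      show "subspace (F \<inter> perp ip {p})"
        using F(1) subspace_perp by (auto intro: subspace_inter simp: null_plane_def)
    qed
    show "F \<inter> perp ip {p} \<subseteq> span {?\<sigma>}"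
    proof
      fix u assume u: "u \<in> F \<inter> perp ip {p}"
      then obtain k l where kl: "u = k *\<^sub>R a + l *\<^sub>R b" using mem by blast
      have "ip u p = 0" using u ip_commute by (simp add: perp_def)
      then have 0: "k * ip a p + l * ip b p = 0" unfolding kl by (simp add: ip_simps)
      show "u \<in> span {?\<sigma>}"
      proof (cases "ip b p = 0")
        case False
        then have "l = - k * ip a p / ip b p" using 0 by (simp add: field_simps)
        then have "u = (k / ip b p) *\<^sub>R ?\<sigma>" using False by (simp add: kl ip_simps algebra_simps)
        then show ?thesis by (simp add: span_base span_scale)
      next
        case True
        then have "ip a p \<noteq> 0" "k = 0" using 0 ab by auto
        then have u: "u = (- l / ip a p) *\<^sub>R ?\<sigma>" using True by (simp add: kl ip_simps)
        show ?thesis unfolding u by (intro span_scale span_base) simp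
      qed
    qed
  qed
qed

text \<open>For timelike \<open>p\<close> and spacelike \<open>l\<close>, the positive root \<open>b\<close> of \<open>(l + b p, l + b p) = 0\<close>. It selects one
of the two null lines in the span of \<open>l\<close> and \<open>p\<close>. The square root is written as a power and the quotient
as a product, the forms for which smoothness is established.\<close>
definition null_coeff :: "real^6 \<Rightarrow> real^6 \<Rightarrow> real" where
  "null_coeff p l = (ip l p + (ip l p * ip l p + (- ip p p) * ip l l) powr (1/2)) * (1 / (- ip p p))"

lemma null_coeff:
  assumes p: "timelike ip p" and l: "ip l l > 0"
  shows "null_coeff p l > 0"
    and "ip (l + null_coeff p l *\<^sub>R p) (l + null_coeff p l *\<^sub>R p) = 0"
proof -
  define q where "q = - ip p p"
  define R where "R = sqrt (ip l p * ip l p + q * ip l l)"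
  have q: "q > 0" using p by (simp add: q_def timelike_def)
  have ql: "q * ip l l > 0" using q l by simp
  have pos: "ip l p * ip l p + q * ip l l > 0" using ql zero_le_square[of "ip l p"] by linarith
  have c: "null_coeff p l = (ip l p + R) / q"
    unfolding null_coeff_def R_def q_def[symmetric] powr_half_sqrt[OF less_imp_le[OF pos]] by simp
  have R2: "R * R = ip l p * ip l p + q * ip l l" unfolding R_def using pos by simp
  have "sqrt (ip l p * ip l p) < R" unfolding R_def by (rule real_sqrt_less_mono) (use ql in linarith)
  then have "\<bar>ip l p\<bar> < R" by (simp only: real_sqrt_abs2)
  then show "null_coeff p l > 0" unfolding c using q by (intro divide_pos_pos) linarith+
  have pp: "ip p p = - q" by (simp add: q_def)
  have "q * ip (l + null_coeff p l *\<^sub>R p) (l + null_coeff p l *\<^sub>R p)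
    = q * ip l l + 2 * (q * null_coeff p l) * ip l p - (q * null_coeff p l) * (q * null_coeff p l)"
    by (simp add: ip_simps pp ip_commute[of p l] algebra_simps)
  also have "q * null_coeff p l = ip l p + R" unfolding c using q by simp
  also have "q * ip l l + 2 * (ip l p + R) * ip l p - (ip l p + R) * (ip l p + R) = 0"
    using R2 by (simp add: algebra_simps)
  finally show "ip (l + null_coeff p l *\<^sub>R p) (l + null_coeff p l *\<^sub>R p) = 0" using q by simp
qed

text \<open>Modulo \<open>F \<inter> p\<^sup>\<bottom>\<close>, which is orthogonal to \<open>n\<close>, all vectors of \<open>F\<close> are proportional.\<close>
lemma null_plane_proportional:
  assumes F: "null_plane F" and n: "\<forall>u\<in>F \<inter> perp ip {p}. ip u n = 0"
    and s: "s \<in> F" and u: "u \<in> F"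
  shows "ip u n * ip s p = ip u p * ip s n"
proof -
  let ?v = "ip s p *\<^sub>R u - ip u p *\<^sub>R s"
  have "subspace F" using F unfolding null_plane_def by blast
  then have "?v \<in> F" using s u by (intro subspace_diff subspace_scale)
  moreover have "ip ?v p = 0" by (simp add: ip_simps)
  then have "?v \<in> perp ip {p}" by (simp add: perp_def ip_commute[of p])
  ultimately have "ip ?v n = 0" using n by blast
  then show ?thesis by (simp add: ip_simps algebra_simps)
qed

text \<open>The intersection of the pencil spanned by \<open>n\<close> and \<open>p\<close> with \<open>F\<^sup>\<bottom>\<close> is given by one linear equation.\<close>
lemma null_plane_perp_pencil:
  assumes F: "null_plane F" and n: "\<forall>u\<in>F \<inter> perp ip {p}. ip u n = 0"
    and s: "s \<in> F" "ip s p \<noteq> 0"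
  shows "a *\<^sub>R n + k *\<^sub>R p \<in> perp ip F \<longleftrightarrow> a * ip s n + k * ip s p = 0"
proof -
  have eq: "ip u (a *\<^sub>R n + k *\<^sub>R p) * ip s p = ip u p * (a * ip s n + k * ip s p)" if "u \<in> F" for u
    using null_plane_proportional[OF F n s(1) that] by (simp add: ip_simps algebra_simps)
  show ?thesis
  proof
    assume "a *\<^sub>R n + k *\<^sub>R p \<in> perp ip F"
    then have "ip s (a *\<^sub>R n + k *\<^sub>R p) = 0" using s(1) unfolding perp_def by blast
    then show "a * ip s n + k * ip s p = 0" by (simp add: ip_simps)
  next
    assume 0: "a * ip s n + k * ip s p = 0"
    have "ip u (a *\<^sub>R n + k *\<^sub>R p) = 0" if "u \<in> F" for u
      using eq[OF that] s(2) unfolding 0 by simp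
    then show "a *\<^sub>R n + k *\<^sub>R p \<in> perp ip F" unfolding perp_def by blast
  qed
qed

end

section \<open>Charts, tangent vectors and directional derivatives\<close>

text \<open>A surface with a smooth atlas; the underlying topological space is Hausdorff.\<close>
locale surface =
  fixes A :: "'m::t2_space chart set"
  assumes atlas: "smooth_atlas A"
begin

lemma
  assumes "c \<in> A"
  shows open_chart_domain: "open (fst c)"
    and open_chart_range: "open (snd c ` fst c)"
    and continuous_on_chart: "continuous_on (fst c) (snd c)"
    and continuous_on_chart_inv: "continuous_on (snd c ` fst c) (chart_inv c)"
    and chart_inv_chart: "\<And>x. x \<in> fst c \<Longrightarrow> chart_inv c (snd c x) = x"
  using atlas assms unfolding smooth_atlas_def homeomorphism_def by blast+

lemma chart_image_eq:
  assumes "c \<in> A"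
  shows "snd c ` (fst c \<inter> N) = snd c ` fst c \<inter> chart_inv c -` N"
  using chart_inv_chart[OF assms] by force

lemma open_chart_image:
  assumes "c \<in> A" "open N"
  shows "open (snd c ` (fst c \<inter> N))"
  unfolding chart_image_eq[OF assms(1)]
  by (rule continuous_open_preimage[OF continuous_on_chart_inv[OF assms(1)] open_chart_range[OF assms(1)] assms(2)])

text \<open>The chart in which \<open>dir_deriv\<close> computes derivatives at \<open>x\<close>.\<close>
definition chart_at :: "'m \<Rightarrow> 'm chart" where
  "chart_at x = (SOME c. c \<in> A \<and> x \<in> fst c)"

lemma chart_at: "chart_at x \<in> A" "x \<in> fst (chart_at x)"
proof -
  have "\<exists>c. c \<in> A \<and> x \<in> fst c" using atlas unfolding smooth_atlas_def by blast
  from someI_ex[OF this] show "chart_at x \<in> A" "x \<in> fst (chart_at x)"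
    unfolding chart_at_def by blast+
qed

lemma dir_deriv_chart_at:
  "dir_deriv A x X g = frechet_derivative (g \<circ> chart_inv (chart_at x)) (at (snd (chart_at x) x)) (X (chart_at x))"
  by (simp add: dir_deriv_def chart_at_def Let_def)

lemma smooth_map_const: "open N \<Longrightarrow> smooth_map A N (\<lambda>_. a)"
  by (simp add: smooth_map_def comp_def smooth_on_const open_chart_image)

lemma smooth_map_add:
  "open N \<Longrightarrow> smooth_map A N g \<Longrightarrow> smooth_map A N h \<Longrightarrow> smooth_map A N (\<lambda>y. g y + h y)"
  by (simp add: smooth_map_def comp_def smooth_on_add open_chart_image)

lemma smooth_map_bilinear:
  "bounded_bilinear B \<Longrightarrow> open N \<Longrightarrow> smooth_map A N g \<Longrightarrow> smooth_map A N h \<Longrightarrow>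
     smooth_map A N (\<lambda>y. B (g y) (h y))"
  unfolding smooth_map_def comp_def
  by (rule ballI, rule smooth_on_bilinear) (simp_all add: open_chart_image)

lemma smooth_map_powr:
  assumes "open N" "smooth_map A N h" "\<And>y. y \<in> N \<Longrightarrow> h y > (0::real)"
  shows "smooth_map A N (\<lambda>y. h y powr a)"
  unfolding smooth_map_def comp_def
proof (rule ballI)
  fix c assume c: "c \<in> A"
  show "smooth_on (snd c ` (fst c \<inter> N)) (\<lambda>x. h (chart_inv c x) powr a)"
    using assms(2,3) c
    by (intro smooth_on_powr open_chart_image assms(1)) (auto simp: smooth_map_def comp_def chart_inv_chart)
qed

lemma smooth_map_subset: "smooth_map A N g \<Longrightarrow> N' \<subseteq> N \<Longrightarrow> smooth_map A N' g"
  unfolding smooth_map_def smooth_on_def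
  by (intro ballI allI, rule Ck_on_subset[of _ "snd _ ` (fst _ \<inter> N)"]) auto

lemma smooth_map_cong:
  assumes "open N" "smooth_map A N g" "\<And>y. y \<in> N \<Longrightarrow> g y = h y"
  shows "smooth_map A N h"
  unfolding smooth_map_def smooth_on_def
proof (intro ballI allI)
  fix c k assume c: "c \<in> A"
  show "Ck_on k (snd c ` (fst c \<inter> N)) (h \<circ> chart_inv c)"
  proof (rule Ck_on_cong[OF open_chart_image[OF c assms(1)]])
    show "Ck_on k (snd c ` (fst c \<inter> N)) (g \<circ> chart_inv c)"
      using assms(2) c unfolding smooth_map_def smooth_on_def by blast
    show "\<And>u. u \<in> snd c ` (fst c \<inter> N) \<Longrightarrow> (g \<circ> chart_inv c) u = (h \<circ> chart_inv c) u"
      using assms(3) chart_inv_chart[OF c] by auto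
  qed
qed

lemma smooth_map_has_derivative:
  assumes "smooth_map A N g" "x \<in> N" "c \<in> A" "x \<in> fst c"
  shows "((g \<circ> chart_inv c) has_derivative frechet_derivative (g \<circ> chart_inv c) (at (snd c x))) (at (snd c x))"
  by (rule smooth_on_imp_has_derivative[of "snd c ` (fst c \<inter> N)"])
    (use assms in \<open>auto simp: smooth_map_def\<close>)

lemma transition_has_derivative:
  assumes "c \<in> A" "d \<in> A" "x \<in> fst c" "x \<in> fst d"
  shows "((snd d \<circ> chart_inv c) has_derivative frechet_derivative (snd d \<circ> chart_inv c) (at (snd c x))) (at (snd c x))"
proof (rule smooth_on_imp_has_derivative)
  show "smooth_on (snd c ` (fst c \<inter> fst d)) (snd d \<circ> chart_inv c)"
    using atlas assms unfolding smooth_atlas_def by blast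
qed (use assms in auto)

lemma frechet_derivative_change_chart:
  assumes c: "c \<in> A" "x \<in> fst c" and d: "d \<in> A" "x \<in> fst d"
    and g: "((g \<circ> chart_inv c) has_derivative g') (at (snd c x))"
  shows "((g \<circ> chart_inv d) has_derivative (\<lambda>v. g' (frechet_derivative (snd c \<circ> chart_inv d) (at (snd d x)) v)))
    (at (snd d x))"
proof -
  have g': "((g \<circ> chart_inv c) has_derivative g') (at ((snd c \<circ> chart_inv d) (snd d x)))"
    using g chart_inv_chart[OF d] by simp
  have "((\<lambda>u. (g \<circ> chart_inv c) ((snd c \<circ> chart_inv d) u)) has_derivative
      (\<lambda>v. g' (frechet_derivative (snd c \<circ> chart_inv d) (at (snd d x)) v))) (at (snd d x))"
    by (rule has_derivative_compose[OF transition_has_derivative[OF d(1) c(1) d(2) c(2)] g'])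
  then show ?thesis
    by (rule has_derivative_transform_within_open[OF _ open_chart_image[OF d(1) open_chart_domain[OF c(1)]]])
      (use c d in \<open>auto simp: chart_inv_chart\<close>)
qed

text \<open>The directional derivative may be computed in any chart.\<close>
lemma dir_deriv_chart:
  assumes "smooth_map A N g" "x \<in> N" "X \<in> tangent_space A x" "c \<in> A" "x \<in> fst c"
  shows "dir_deriv A x X g = frechet_derivative (g \<circ> chart_inv c) (at (snd c x)) (X c)"
proof -
  let ?d = "chart_at x"
  have X: "X c = frechet_derivative (snd c \<circ> chart_inv ?d) (at (snd ?d x)) (X ?d)"
    using assms(3,4,5) chart_at[of x] unfolding tangent_space_def by blast
  from frechet_derivative_at[OF frechet_derivative_change_chart[OF assms(4,5) chart_at
      smooth_map_has_derivative[OF assms(1,2,4,5)]]]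
  show ?thesis unfolding dir_deriv_chart_at X by metis
qed

text \<open>Together with \<open>tangent_space_eq_zero\<close>: a tangent vector is the same as its coordinate vector in one chart.\<close>
lemma tangent_space_chart_ex:
  assumes c: "c \<in> A" "x \<in> fst c"
  obtains X where "X \<in> tangent_space A x" "X c = v"
proof -
  let ?X = "\<lambda>d. if d \<in> A \<and> x \<in> fst d then frechet_derivative (snd d \<circ> chart_inv c) (at (snd c x)) v else 0"
  have "((snd c \<circ> chart_inv c) has_derivative (\<lambda>v. v)) (at (snd c x))"
    by (rule has_derivative_transform_within_open[OF has_derivative_ident open_chart_range[OF c(1)]])
      (use c in \<open>auto simp: chart_inv_chart\<close>)
  from frechet_derivative_at[OF this] have "?X c = v" using c by metis
  moreover have "?X \<in> tangent_space A x"
    unfolding tangent_space_def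
  proof (intro CollectI conjI allI impI ballI)
    fix d e assume d: "d \<in> A" and e: "e \<in> A" and de: "x \<in> fst d \<and> x \<in> fst e"
    from frechet_derivative_at[OF frechet_derivative_change_chart[OF d conjunct1[OF de] c 
        transition_has_derivative[OF d e conjunct1[OF de] conjunct2[OF de]]]]
    show "?X e = frechet_derivative (snd e \<circ> chart_inv d) (at (snd d x)) (?X d)"
      using d e de by (simp add: fun_eq_iff)
  qed auto
  ultimately show ?thesis using that by blast
qed

lemma tangent_space_eq_zero:
  assumes "X \<in> tangent_space A x" "c \<in> A" "x \<in> fst c" "X c = 0"
  shows "X = (\<lambda>_. 0)"
proof
  fix d
  show "X d = 0"
  proof (cases "d \<in> A \<and> x \<in> fst d")
    case True
    then have "X d = frechet_derivative (snd d \<circ> chart_inv c) (at (snd c x)) (X c)"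
      using assms(1-3) unfolding tangent_space_def by blast
    moreover have "linear (frechet_derivative (snd d \<circ> chart_inv c) (at (snd c x)))"
      using transition_has_derivative[OF assms(2) _ assms(3)] True has_derivative_linear by blast
    ultimately show ?thesis using assms(4) linear_0 by simp
  next
    case False
    then show ?thesis using assms(1) unfolding tangent_space_def by blast
  qed
qed

lemma tangent_space_combination:
  assumes "X \<in> tangent_space A x" "Y \<in> tangent_space A x"
  shows "(\<lambda>c. r *\<^sub>R X c + s *\<^sub>R Y c) \<in> tangent_space A x"
  unfolding tangent_space_def
proof (intro CollectI conjI allI impI ballI)
  fix c d assume cd: "c \<in> A" "d \<in> A" "x \<in> fst c \<and> x \<in> fst d"
  let ?D = "frechet_derivative (snd d \<circ> chart_inv c) (at (snd c x))"
  have "linear ?D" using transition_has_derivative cd has_derivative_linear by blast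
  then have "?D (r *\<^sub>R X c + s *\<^sub>R Y c) = r *\<^sub>R ?D (X c) + s *\<^sub>R ?D (Y c)"
    by (simp add: linear_add linear_scale)
  moreover have "X d = ?D (X c)" "Y d = ?D (Y c)" using assms cd unfolding tangent_space_def by blast+
  ultimately show "r *\<^sub>R X d + s *\<^sub>R Y d = ?D (r *\<^sub>R X c + s *\<^sub>R Y c)" by simp
qed (use assms in \<open>auto simp: tangent_space_def\<close>)

text \<open>Smoothness on some neighbourhood of the point.\<close>
definition smooth_at :: "'m \<Rightarrow> ('m \<Rightarrow> 'b::real_normed_vector) \<Rightarrow> bool" where
  "smooth_at x g \<longleftrightarrow> (\<exists>N. open N \<and> x \<in> N \<and> smooth_map A N g)"

lemma smooth_atI: "open N \<Longrightarrow> x \<in> N \<Longrightarrow> smooth_map A N g \<Longrightarrow> smooth_at x g"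
  unfolding smooth_at_def by blast

lemma smooth_at_has_derivative:
  assumes "smooth_at x g" "c \<in> A" "x \<in> fst c"
  shows "((g \<circ> chart_inv c) has_derivative frechet_derivative (g \<circ> chart_inv c) (at (snd c x))) (at (snd c x))"
  using assms smooth_map_has_derivative unfolding smooth_at_def by blast

lemma dir_deriv_eqI:
  assumes "((g \<circ> chart_inv (chart_at x)) has_derivative g') (at (snd (chart_at x) x))"
  shows "dir_deriv A x X g = g' (X (chart_at x))"
  unfolding dir_deriv_chart_at frechet_derivative_at[OF assms, symmetric] ..

lemma dir_deriv_const: "dir_deriv A x X (\<lambda>_. a) = 0"
  unfolding dir_deriv_chart_at by (simp add: comp_def)

lemma dir_deriv_bilinear:
  assumes "bounded_bilinear B" "smooth_at x g" "smooth_at x h"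
  shows "dir_deriv A x X (\<lambda>y. B (g y) (h y)) = B (g x) (dir_deriv A x X h) + B (dir_deriv A x X g) (h x)"
proof -
  let ?c = "chart_at x"
  have "((\<lambda>u. B ((g \<circ> chart_inv ?c) u) ((h \<circ> chart_inv ?c) u)) has_derivative
     (\<lambda>v. B ((g \<circ> chart_inv ?c) (snd ?c x)) (frechet_derivative (h \<circ> chart_inv ?c) (at (snd ?c x)) v) + 
          B (frechet_derivative (g \<circ> chart_inv ?c) (at (snd ?c x)) v) ((h \<circ> chart_inv ?c) (snd ?c x)))) (at (snd ?c x))"
    by (rule bounded_bilinear.FDERIV[OF assms(1) smooth_at_has_derivative[OF assms(2) chart_at]
          smooth_at_has_derivative[OF assms(3) chart_at]])
  then have "((\<lambda>y. B (g y) (h y)) \<circ> chart_inv ?c has_derivative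
     (\<lambda>v. B (g x) (frechet_derivative (h \<circ> chart_inv ?c) (at (snd ?c x)) v) + 
          B (frechet_derivative (g \<circ> chart_inv ?c) (at (snd ?c x)) v) (h x))) (at (snd ?c x))"
    unfolding comp_def chart_inv_chart[OF chart_at] .
  from dir_deriv_eqI[OF this] show ?thesis unfolding dir_deriv_chart_at .
qed

lemma dir_deriv_combination:
  assumes "smooth_at x g"
  shows "dir_deriv A x (\<lambda>c. r *\<^sub>R X c + s *\<^sub>R Y c) g = r *\<^sub>R dir_deriv A x X g + s *\<^sub>R dir_deriv A x Y g"
proof -
  have "linear (frechet_derivative (g \<circ> chart_inv (chart_at x)) (at (snd (chart_at x) x)))"
    using smooth_at_has_derivative[OF assms chart_at] by (rule has_derivative_linear)
  then show ?thesis unfolding dir_deriv_chart_at by (simp add: linear_add linear_scale)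
qed

lemma dir_deriv_scale:
  assumes "smooth_at x g"
  shows "dir_deriv A x (\<lambda>c. r *\<^sub>R X c) g = r *\<^sub>R dir_deriv A x X g"
  using dir_deriv_combination[OF assms, of r X 0] by simp

lemma dir_deriv_cong:
  assumes "open N" "x \<in> N" "\<And>y. y \<in> N \<Longrightarrow> g y = h y" "smooth_at x g"
  shows "dir_deriv A x X g = dir_deriv A x X h"
proof -
  let ?c = "chart_at x"
  have "((h \<circ> chart_inv ?c) has_derivative frechet_derivative (g \<circ> chart_inv ?c) (at (snd ?c x))) (at (snd ?c x))"
    by (rule has_derivative_transform_within_open[OF smooth_at_has_derivative[OF assms(4) chart_at]
        open_chart_image[OF chart_at(1) assms(1)]])
      (use assms chart_at chart_inv_chart[OF chart_at(1)] in auto)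
  from dir_deriv_eqI[OF this] show ?thesis unfolding dir_deriv_chart_at by simp
qed

lemma local_sectionsD:
  assumes "\<sigma> \<in> local_sections A x E"
  obtains N where "open N" "x \<in> N" "smooth_map A N \<sigma>" "\<And>y. y \<in> N \<Longrightarrow> \<sigma> y \<in> E y"
  using assms unfolding local_sections_def sections_def by blast

lemma local_sectionsI:
  assumes "open N" "x \<in> N" "smooth_map A N \<sigma>" "\<And>y. y \<in> N \<Longrightarrow> \<sigma> y \<in> E y"
  shows "\<sigma> \<in> local_sections A x E"
  using assms unfolding local_sections_def sections_def by blast

lemma local_sections_smooth_at: "\<sigma> \<in> local_sections A x E \<Longrightarrow> smooth_at x \<sigma>"
  by (rule local_sectionsD) (auto intro: smooth_atI)

lemma smooth_map_imp_continuous_on: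
  assumes "open N" "smooth_map A N g"
  shows "continuous_on N g"
proof (intro continuous_at_imp_continuous_on ballI)
  fix x assume x: "x \<in> N"
  let ?c = "chart_at x"
  have N': "open (fst ?c \<inter> N)" "x \<in> fst ?c \<inter> N"
    using open_chart_domain[OF chart_at(1)] assms(1) x chart_at(2) by auto
  have "continuous_on (snd ?c ` (fst ?c \<inter> N)) (g \<circ> chart_inv ?c)"
    using assms(2) chart_at(1) by (intro smooth_on_imp_continuous_on) (simp add: smooth_map_def)
  moreover have "continuous_on (fst ?c \<inter> N) (snd ?c)"
    by (rule continuous_on_subset[OF continuous_on_chart[OF chart_at(1)]]) auto
  ultimately have "continuous_on (fst ?c \<inter> N) (\<lambda>y. (g \<circ> chart_inv ?c) (snd ?c y))"
    by (rule continuous_on_compose2) auto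
  then have "continuous_on (fst ?c \<inter> N) g"
    by (rule continuous_on_eq) (simp add: chart_inv_chart[OF chart_at(1)])
  from this[unfolded continuous_on_eq_continuous_at[OF N'(1)]] N'(2) show "isCont g x" by (rule bspec)
qed

lemma path_connected_neighbourhood:
  fixes U :: "'m set"
  assumes "open U" "x \<in> U"
  obtains N where "open N" "x \<in> N" "N \<subseteq> U" "path_connected N"
proof -
  let ?c = "chart_at x"
  have "open (snd ?c ` (fst ?c \<inter> U))" "snd ?c x \<in> snd ?c ` (fst ?c \<inter> U)"
    using open_chart_image[OF chart_at(1) assms(1)] chart_at(2) assms(2) by auto
  then obtain r where r: "r > 0" "ball (snd ?c x) r \<subseteq> snd ?c ` (fst ?c \<inter> U)"
    using openE by blast
  define N where "N = fst ?c \<inter> snd ?c -` ball (snd ?c x) r"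
  have "N = chart_inv ?c ` ball (snd ?c x) r"
  proof
    show "N \<subseteq> chart_inv ?c ` ball (snd ?c x) r"
      unfolding N_def using chart_inv_chart[OF chart_at(1)] by force
    show "chart_inv ?c ` ball (snd ?c x) r \<subseteq> N"
      unfolding N_def using r(2) chart_inv_chart[OF chart_at(1)] by force
  qed
  moreover have "path_connected (chart_inv ?c ` ball (snd ?c x) r)"
    using r(2) by (intro path_connected_continuous_image continuous_on_subset[OF continuous_on_chart_inv[OF chart_at(1)]])
      (auto simp: convex_imp_path_connected)
  ultimately have "path_connected N" by simp
  moreover have "open N"
    unfolding N_def
    by (rule continuous_open_preimage[OF continuous_on_chart[OF chart_at(1)] open_chart_domain[OF chart_at(1)]]) simp
  moreover have "N \<subseteq> U"
    unfolding \<open>N = chart_inv ?c ` _\<close> using r(2) chart_inv_chart[OF chart_at(1)] by force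
  moreover have "x \<in> N" using chart_at(2) r(1) by (simp add: N_def)
  ultimately show ?thesis using that by blast
qed

text \<open>The chain rule for a function along a curve in the surface.\<close>
lemma has_vector_derivative_along_curve:
  assumes "smooth_at (\<gamma> t) g" "isCont \<gamma> t"
    and diff: "\<forall>c\<in>A. \<gamma> t \<in> fst c \<longrightarrow> (snd c \<circ> \<gamma>) differentiable (at t)"
  shows "((\<lambda>\<tau>. g (\<gamma> \<tau>)) has_vector_derivative dir_deriv A (\<gamma> t) (velocity A \<gamma> t) g) (at t)"
proof -
  let ?c = "chart_at (\<gamma> t)"
  let ?D = "frechet_derivative (g \<circ> chart_inv ?c) (at (snd ?c (\<gamma> t)))"
  have vel: "velocity A \<gamma> t ?c = vector_derivative (snd ?c \<circ> \<gamma>) (at t)"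
    using chart_at by (simp add: velocity_def)
  have D: "((g \<circ> chart_inv ?c) has_derivative ?D) (at (snd ?c (\<gamma> t)))"
    by (rule smooth_at_has_derivative[OF assms(1) chart_at])
  have "(snd ?c \<circ> \<gamma>) differentiable (at t)" using diff chart_at by blast
  then have "((snd ?c \<circ> \<gamma>) has_vector_derivative velocity A \<gamma> t ?c) (at t)"
    unfolding vel by (simp add: vector_derivative_works)
  then have "((snd ?c \<circ> \<gamma>) has_derivative (\<lambda>s. s *\<^sub>R velocity A \<gamma> t ?c)) (at t)"
    by (simp add: has_vector_derivative_def)
  from has_derivative_compose[OF this, of "g \<circ> chart_inv ?c" ?D] D
  have "((\<lambda>\<tau>. (g \<circ> chart_inv ?c) ((snd ?c \<circ> \<gamma>) \<tau>)) has_derivative (\<lambda>s. ?D (s *\<^sub>R velocity A \<gamma> t ?c))) (at t)"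
    by simp
  moreover have "?D (s *\<^sub>R velocity A \<gamma> t ?c) = s *\<^sub>R ?D (velocity A \<gamma> t ?c)" for s
    using linear_scale[OF has_derivative_linear[OF D]] .
  ultimately have 1: "((\<lambda>\<tau>. (g \<circ> chart_inv ?c) ((snd ?c \<circ> \<gamma>) \<tau>)) has_vector_derivative
      dir_deriv A (\<gamma> t) (velocity A \<gamma> t) g) (at t)"
    unfolding has_vector_derivative_def dir_deriv_chart_at by simp
  have "eventually (\<lambda>\<tau>. \<gamma> \<tau> \<in> fst ?c) (at t)"
    using topological_tendstoD[OF assms(2)[unfolded isCont_def] open_chart_domain[OF chart_at(1)] chart_at(2)] .
  then have ev: "eventually (\<lambda>\<tau>. (g \<circ> chart_inv ?c) ((snd ?c \<circ> \<gamma>) \<tau>) = g (\<gamma> \<tau>)) (at t)"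
    by eventually_elim (simp add: chart_inv_chart[OF chart_at(1)])
  show ?thesis
    using has_derivative_transform_eventually[OF 1[unfolded has_vector_derivative_def] ev _ UNIV_I]
      chart_at chart_inv_chart
    unfolding has_vector_derivative_def by simp
qed

lemma smooth_at_bilinear:
  assumes "bounded_bilinear B" "smooth_at x g" "smooth_at x h"
  shows "smooth_at x (\<lambda>y. B (g y) (h y))"
proof -
  obtain N N' where "open N" "x \<in> N" "smooth_map A N g" "open N'" "x \<in> N'" "smooth_map A N' h"
    using assms(2,3) unfolding smooth_at_def by blast
  moreover from this have "smooth_map A (N \<inter> N') g" "smooth_map A (N \<inter> N') h"
    by (auto elim!: smooth_map_subset)
  ultimately show ?thesis
    by (intro smooth_atI[of "N \<inter> N'"] smooth_map_bilinear[OF assms(1)]) auto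
qed

lemma smooth_at_const: "smooth_at x (\<lambda>_. a)"
  by (rule smooth_atI[of UNIV]) (simp_all add: smooth_map_const)

section \<open>Integral curves of a distribution\<close>

lemma rank1_distribution_tangent:
  assumes "rank1_distribution A T" "X \<in> T x"
  shows "X \<in> tangent_space A x"
proof -
  obtain Z where Z: "Z \<in> tangent_space A x" "T x = {\<lambda>c. r *\<^sub>R Z c | r. True}"
    using assms(1) unfolding rank1_distribution_def by blast
  then obtain r where "X = (\<lambda>c. r *\<^sub>R Z c)" using assms(2) by blast
  then show ?thesis using tangent_space_combination[OF Z(1) Z(1), of r 0] by simp
qed

lemma rank1_distribution_scale:
  assumes "rank1_distribution A T" "X \<in> T x - {\<lambda>_. 0}" "Y \<in> T x"
  obtains r where "Y = (\<lambda>c. r *\<^sub>R X c)"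
proof -
  obtain Z where Z: "T x = {\<lambda>c. r *\<^sub>R Z c | r. True}"
    using assms(1) unfolding rank1_distribution_def by blast
  obtain r s where rs: "X = (\<lambda>c. r *\<^sub>R Z c)" "Y = (\<lambda>c. s *\<^sub>R Z c)" using assms(2,3) Z by blast
  have "r \<noteq> 0" using assms(2) rs(1) by auto
  then have "Y = (\<lambda>c. (s / r) *\<^sub>R X c)" using rs by simp
  then show ?thesis by (rule that)
qed

text \<open>In a chart, a local generator of \<open>T\<close> is a smooth vector field in the plane.\<close>
lemma integral_curve_exists:
  fixes W :: "'m set"
  assumes T: "rank1_distribution A T" and W: "open W" "x \<in> W"
  obtains e \<gamma> where "e > 0" "integral_curve A T W (- e) e \<gamma>" "\<gamma> 0 = x"
proof -
  obtain N X where NX: "open N \<and> x \<in> N \<and>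
        (\<forall>c\<in>A. smooth_on (snd c ` (fst c \<inter> N)) (\<lambda>u. X (chart_inv c u) c)) \<and>
        (\<forall>y\<in>N. X y \<in> tangent_space A y \<and> X y \<noteq> (\<lambda>_. 0) \<and>
           T y = {\<lambda>c. r *\<^sub>R X y c | r. True})"
    using T[unfolded rank1_distribution_def, THEN spec, of x] by (elim exE)
  then have N: "open N" "x \<in> N"
    and sm: "\<And>c. c \<in> A \<Longrightarrow> smooth_on (snd c ` (fst c \<inter> N)) (\<lambda>u. X (chart_inv c u) c)"
    and X: "\<And>y. y \<in> N \<Longrightarrow> X y \<in> tangent_space A y \<and> X y \<noteq> (\<lambda>_. 0) \<and> T y = {\<lambda>c. r *\<^sub>R X y c | r. True}"
    by simp_all
  let ?c = "chart_at x"
  let ?F = "\<lambda>u. X (chart_inv ?c u) ?c"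
  let ?S = "snd ?c ` (fst ?c \<inter> (N \<inter> W))"
  have opS: "open ?S" by (rule open_chart_image[OF chart_at(1) open_Int[OF N(1) W(1)]])
  have "Ck_on 1 (snd ?c ` (fst ?c \<inter> N)) ?F" using sm[OF chart_at(1)] unfolding smooth_on_def by blast
  then have C1: "Ck_on 1 ?S ?F" by (rule Ck_on_subset) auto
  have x: "snd ?c x \<in> ?S" using chart_at(2) N W by blast
  obtain e w where e: "e > 0" and w0: "w 0 = snd ?c x"
    and w: "\<And>t. \<bar>t\<bar> < e \<Longrightarrow> w t \<in> ?S \<and> (w has_vector_derivative ?F (w t)) (at t)"
    using ode_local[OF C1 opS x] by metis
  define \<gamma> where "\<gamma> = chart_inv ?c \<circ> w"
  have \<gamma>0: "\<gamma> 0 = x" by (simp add: \<gamma>_def w0 chart_inv_chart[OF chart_at])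
  have "integral_curve A T W (- e) e \<gamma>"
    unfolding integral_curve_def
  proof (intro ballI)
    fix t assume "t \<in> {- e<..<e}"
    then have t: "\<bar>t\<bar> < e" by auto
    obtain y where y: "y \<in> fst ?c" "y \<in> N" "y \<in> W" "w t = snd ?c y" using w[OF t] by auto
    have \<gamma>t: "\<gamma> t = y" by (simp add: \<gamma>_def y(4) chart_inv_chart[OF chart_at(1) y(1)])
    have contw: "isCont w t" by (rule has_vector_derivative_continuous[OF conjunct2[OF w[OF t]]])
    have "isCont (chart_inv ?c) (w t)"
      by (rule bspec[OF continuous_on_chart_inv[OF chart_at(1),
            unfolded continuous_on_eq_continuous_at[OF open_chart_range[OF chart_at(1)]]]])
        (simp add: y)
    then have cont: "isCont \<gamma> t" unfolding \<gamma>_def comp_def by (rule isCont_o2[OF contw])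
    have der: "((snd d \<circ> \<gamma>) has_vector_derivative X y d) (at t)" if d: "d \<in> A" "y \<in> fst d" for d
    proof -
      let ?D = "frechet_derivative (snd d \<circ> chart_inv ?c) (at (snd ?c y))"
      have tr: "((snd d \<circ> chart_inv ?c) has_derivative ?D) (at (w t))"
        unfolding y(4) by (rule transition_has_derivative[OF chart_at(1) d(1) y(1) d(2)])
      have "(w has_derivative (\<lambda>s. s *\<^sub>R X y ?c)) (at t)"
        using w[OF t] unfolding has_vector_derivative_def y(4) chart_inv_chart[OF chart_at(1) y(1)] by blast
      from has_derivative_compose[OF this tr]
      have "((snd d \<circ> \<gamma>) has_derivative (\<lambda>s. ?D (s *\<^sub>R X y ?c))) (at t)"
        unfolding \<gamma>_def comp_def .
      moreover have "?D (s *\<^sub>R X y ?c) = s *\<^sub>R ?D (X y ?c)" for s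
        using linear_scale[OF has_derivative_linear[OF tr]] .
      moreover have "X y d = ?D (X y ?c)"
        using X[OF y(2)] d y(1) chart_at(1) unfolding tangent_space_def by blast
      ultimately show ?thesis unfolding has_vector_derivative_def by simp
    qed
    have "velocity A \<gamma> t = X y"
    proof
      fix d
      show "velocity A \<gamma> t d = X y d"
      proof (cases "d \<in> A \<and> y \<in> fst d")
        case True
        then show ?thesis using vector_derivative_at[OF der] by (simp add: velocity_def \<gamma>t)
      next
        case False
        then have "X y d = 0" using X[OF y(2)] unfolding tangent_space_def by blast
        then show ?thesis using False by (auto simp: velocity_def \<gamma>t)
      qed
    qed
    moreover have "X y = (\<lambda>c. 1 *\<^sub>R X y c)" by simp
    then have "X y \<in> T y - {\<lambda>_. 0}" using X[OF y(2)] by blast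
    ultimately have "velocity A \<gamma> t \<in> T (\<gamma> t) - {\<lambda>_. 0}" by (simp add: \<gamma>t)
    moreover have "\<forall>c\<in>A. \<gamma> t \<in> fst c \<longrightarrow> (snd c \<circ> \<gamma>) differentiable at t"
      using differentiableI_vector[OF der] unfolding \<gamma>t by blast
    ultimately show "\<gamma> t \<in> W \<and> isCont \<gamma> t \<and> (\<forall>c\<in>A. \<gamma> t \<in> fst c \<longrightarrow> (snd c \<circ> \<gamma>) differentiable at t) \<and>
        velocity A \<gamma> t \<in> T (\<gamma> t) - {\<lambda>_. 0}" using y(3) cont \<gamma>t by blast
  qed
  then show ?thesis by (rule that[of e \<gamma>, OF e _ \<gamma>0])
qed

lemma integral_curveD:
  assumes "integral_curve A T W a b \<gamma>" "t \<in> {a<..<b}"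
  shows "\<gamma> t \<in> W" "isCont \<gamma> t" "velocity A \<gamma> t \<in> T (\<gamma> t) - {\<lambda>_. 0}"
    and "smooth_at (\<gamma> t) g \<Longrightarrow>
      ((\<lambda>\<tau>. g (\<gamma> \<tau>)) has_vector_derivative dir_deriv A (\<gamma> t) (velocity A \<gamma> t) g) (at t)"
  using assms has_vector_derivative_along_curve[of \<gamma> t g] unfolding integral_curve_def by blast+

lemma constant_along_leavesD:
  assumes "constant_along_leaves A T W E" "integral_curve A T W a b \<gamma>" "s \<in> {a<..<b}" "t \<in> {a<..<b}"
  shows "E (\<gamma> t) = E (\<gamma> s)"
proof -
  have "\<gamma> t \<in> leaf A T W (\<gamma> s)" using assms(2-4) unfolding leaf_def by blast
  then show ?thesis using assms(1) integral_curveD(1)[OF assms(2,3)] unfolding constant_along_leaves_def by blast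
qed

lemma constant_along_leavesI:
  assumes "\<And>a b \<gamma> s t. integral_curve A T W a b \<gamma> \<Longrightarrow> s \<in> {a<..<b} \<Longrightarrow> t \<in> {a<..<b} \<Longrightarrow> E (\<gamma> t) = E (\<gamma> s)"
  shows "constant_along_leaves A T W E"
  using assms unfolding constant_along_leaves_def leaf_def by blast

lemma integral_curve_mono: "integral_curve A T W a b \<gamma> \<Longrightarrow> W \<subseteq> U \<Longrightarrow> integral_curve A T U a b \<gamma>"
  unfolding integral_curve_def by blast

lemma eventually_along_curve:
  assumes "integral_curve A T W a b \<gamma>" "t \<in> {a<..<b}" "open N" "\<gamma> t \<in> N"
  shows "eventually (\<lambda>\<tau>. \<tau> \<in> {a<..<b} \<and> \<gamma> \<tau> \<in> N) (at t)"
proof -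
  have "eventually (\<lambda>\<tau>. \<gamma> \<tau> \<in> N) (at t)"
    using topological_tendstoD[OF integral_curveD(2)[OF assms(1,2), unfolded isCont_def] assms(3,4)] .
  moreover have "eventually (\<lambda>\<tau>. \<tau> \<in> {a<..<b}) (at t)"
    using assms(2) by (intro eventually_at_in_open') auto
  ultimately show ?thesis by eventually_elim simp
qed

section \<open>Line bundles and their immersions\<close>

lemma line_bundle_frame:
  assumes "subbundle A 1 W E" "x \<in> W"
  obtains N s where "open N" "x \<in> N" "N \<subseteq> W" "smooth_map A N s"
    "\<And>y. y \<in> N \<Longrightarrow> E y = span {s y}" "\<And>y. y \<in> N \<Longrightarrow> s y \<noteq> 0"
proof -
  obtain N s where Ns: "open N \<and> x \<in> N \<and> N \<subseteq> W \<and> (\<forall>i<1. smooth_map A N (s i)) \<and>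
        (\<forall>y\<in>N. E y = span ((\<lambda>i::nat. s i y) ` {..<1}) \<and> dim (E y) = 1)"
    using assms(1)[unfolded subbundle_def, THEN bspec, OF assms(2)] by (elim exE)
  have im: "(\<lambda>i::nat. s i y) ` {..<1} = {s 0 y}" for y by auto
  have N: "open N" "x \<in> N" "N \<subseteq> W" "smooth_map A N (s 0)"
    using Ns by simp_all
  have E: "\<And>y. y \<in> N \<Longrightarrow> E y = span {s 0 y} \<and> dim (E y) = 1"
    using Ns unfolding im by blast
  have "s 0 y \<noteq> 0" if "y \<in> N" for y
  proof
    assume 0: "s 0 y = 0"
    have "dim (span {s 0 y}) = 1" using E[OF that] by metis
    then show False unfolding 0 by simp
  qed
  then show ?thesis using that[OF N] E by blast
qed

lemma line_bundleI:
  assumes "\<And>x. x \<in> W \<Longrightarrow> \<exists>N s. open N \<and> x \<in> N \<and> N \<subseteq> W \<and> smooth_map A N s \<and>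
     (\<forall>y\<in>N. E y = span {s y} \<and> s y \<noteq> 0)"
  shows "subbundle A 1 W E"
  unfolding subbundle_def
proof
  fix x assume "x \<in> W"
  then obtain N s where N: "open N" "x \<in> N" "N \<subseteq> W" "smooth_map A N s"
     and E: "\<forall>y\<in>N. E y = span {s y} \<and> s y \<noteq> 0" using assms by metis
  have im: "(\<lambda>i::nat. s y) ` {..<1} = {s y}" for y by auto
  have "dim (span {s y}) = 1" if "y \<in> N" for y
    using E that by (simp add: dim_insert)
  then have "E y = span ((\<lambda>i::nat. s y) ` {..<1}) \<and> dim (E y) = 1" if "y \<in> N" for y
    using E that unfolding im by metis
  then show "\<exists>N s. open N \<and> x \<in> N \<and> N \<subseteq> W \<and> (\<forall>i<1. smooth_map A N (s i)) \<and>
        (\<forall>y\<in>N. E y = span ((\<lambda>i::nat. s i y) ` {..<1}) \<and> dim (E y) = 1)"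
    using N by (intro exI[of _ N] exI[of _ "\<lambda>_. s"]) blast
qed

text \<open>For sections of a line bundle, the derivative modulo the bundle need only be tested on a frame \<open>s\<close>. For
\<open>\<tau> = h s\<close> the smoothness of \<open>h\<close> is avoided by differentiating \<open>(s \<bullet> s) \<tau> = (\<tau> \<bullet> s) s\<close>.\<close>
lemma dir_deriv_section_mem:
  fixes E :: "'m \<Rightarrow> ('v::euclidean_space) set"
  assumes N: "open N" "x \<in> N" "smooth_map A N s" "\<And>y. y \<in> N \<Longrightarrow> E y = span {s y}"
    and nz: "s x \<noteq> 0"
    and \<tau>: "\<tau> \<in> local_sections A x E" and D: "dir_deriv A x X s \<in> E x"
  shows "dir_deriv A x X \<tau> \<in> E x"
proof -
  have ss: "smooth_at x s" and st: "smooth_at x \<tau>"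
    using N \<tau> smooth_atI local_sections_smooth_at by blast+
  obtain N' where N': "open N'" "x \<in> N'" "\<And>y. y \<in> N' \<Longrightarrow> \<tau> y \<in> E y"
    using \<tau> unfolding local_sections_def sections_def by blast
  let ?D = "dir_deriv A x X"
  have eq: "(s y \<bullet> s y) *\<^sub>R \<tau> y = (\<tau> y \<bullet> s y) *\<^sub>R s y" if "y \<in> N \<inter> N'" for y
  proof -
    obtain k where "\<tau> y = k *\<^sub>R s y" using N(4) N'(3) \<open>y \<in> N \<inter> N'\<close> span_singleton by blast
    then show ?thesis by simp
  qed
  note sm = smooth_at_bilinear[OF bounded_bilinear_inner ss ss] smooth_at_bilinear[OF bounded_bilinear_inner st ss]
  have "?D (\<lambda>y. (s y \<bullet> s y) *\<^sub>R \<tau> y) = ?D (\<lambda>y. (\<tau> y \<bullet> s y) *\<^sub>R s y)"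
    by (rule dir_deriv_cong[of "N \<inter> N'"])
      (use N N' eq smooth_at_bilinear[OF bounded_bilinear_scaleR sm(1) st] in auto)
  then have "(s x \<bullet> s x) *\<^sub>R ?D \<tau> + ?D (\<lambda>y. s y \<bullet> s y) *\<^sub>R \<tau> x
      = (\<tau> x \<bullet> s x) *\<^sub>R ?D s + ?D (\<lambda>y. \<tau> y \<bullet> s y) *\<^sub>R s x"
    by (simp add: dir_deriv_bilinear[OF bounded_bilinear_scaleR] sm ss st)
  then have eq1: "(s x \<bullet> s x) *\<^sub>R ?D \<tau> = (\<tau> x \<bullet> s x) *\<^sub>R ?D s + ?D (\<lambda>y. \<tau> y \<bullet> s y) *\<^sub>R s x
      - ?D (\<lambda>y. s y \<bullet> s y) *\<^sub>R \<tau> x"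
    by (simp add: algebra_simps)
  have E: "E x = span {s x}" "s x \<in> E x" "\<tau> x \<in> E x"
    using N N' by (auto simp: span_base)
  have "(s x \<bullet> s x) *\<^sub>R ?D \<tau> \<in> E x"
    unfolding eq1 using D E by (auto intro!: span_add span_diff span_scale)
  then have "(1 / (s x \<bullet> s x)) *\<^sub>R ((s x \<bullet> s x) *\<^sub>R ?D \<tau>) \<in> E x"
    unfolding E(1) by (rule span_scale)
  then show ?thesis using nz by simp
qed

lemma immerses_at_frame_iff:
  fixes E :: "'m \<Rightarrow> ('v::euclidean_space) set"
  assumes N: "open N" "x \<in> N" "smooth_map A N s" "\<And>y. y \<in> N \<Longrightarrow> E y = span {s y}"
    and nz: "s x \<noteq> 0"
  shows "immerses_at A E x \<longleftrightarrow> (\<forall>X\<in>tangent_space A x. dir_deriv A x X s \<in> E x \<longrightarrow> X = (\<lambda>_. 0))"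
proof -
  have "s \<in> local_sections A x E"
    by (rule local_sectionsI[OF N(1,2,3)]) (simp add: N(4) span_base)
  then show ?thesis
    unfolding immerses_at_def using dir_deriv_section_mem[OF N nz] by blast
qed

text \<open>Up to the factor \<open>s \<bullet> s\<close>, the vectors \<open>a\<close> and \<open>b\<close> are the projections of \<open>u\<close> and \<open>v\<close> orthogonally to \<open>s\<close>. Their Gram
determinant tests the independence of \<open>u\<close> and \<open>v\<close> modulo the span of \<open>s\<close>.\<close>
lemma gram_independent_iff:
  fixes s u v :: "'v::real_inner"
  assumes "s \<noteq> 0"
  defines "a \<equiv> (s \<bullet> s) *\<^sub>R u - (u \<bullet> s) *\<^sub>R s" and "b \<equiv> (s \<bullet> s) *\<^sub>R v - (v \<bullet> s) *\<^sub>R s"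
  shows "(a \<bullet> a) * (b \<bullet> b) - (a \<bullet> b)\<^sup>2 \<noteq> 0 \<longleftrightarrow>
    (\<forall>r t. r *\<^sub>R u + t *\<^sub>R v \<in> span {s} \<longrightarrow> r = 0 \<and> t = 0)"
proof -
  have mem: "r *\<^sub>R u + t *\<^sub>R v \<in> span {s} \<longleftrightarrow> r *\<^sub>R a + t *\<^sub>R b = 0" for r t
  proof -
    let ?w = "r *\<^sub>R u + t *\<^sub>R v"
    have eq: "r *\<^sub>R a + t *\<^sub>R b = (s \<bullet> s) *\<^sub>R ?w - (?w \<bullet> s) *\<^sub>R s"
      by (simp add: a_def b_def algebra_simps inner_add_left)
    show ?thesis
    proof
      assume "?w \<in> span {s}"
      then obtain k where "?w = k *\<^sub>R s" unfolding span_singleton by blast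
      then show "r *\<^sub>R a + t *\<^sub>R b = 0" unfolding eq by simp
    next
      assume "r *\<^sub>R a + t *\<^sub>R b = 0"
      then have "(s \<bullet> s) *\<^sub>R ?w = (?w \<bullet> s) *\<^sub>R s" unfolding eq by simp
      then have "(1 / (s \<bullet> s)) *\<^sub>R ((s \<bullet> s) *\<^sub>R ?w) = (1 / (s \<bullet> s)) *\<^sub>R ((?w \<bullet> s) *\<^sub>R s)" by simp
      then have "?w = ((?w \<bullet> s) / (s \<bullet> s)) *\<^sub>R s" using assms(1) by simp
      then show "?w \<in> span {s}" by (metis span_base span_scale insertI1)
    qed
  qed
  show ?thesis unfolding mem
  proof (intro iffI allI impI)
    fix r t
    assume G: "(a \<bullet> a) * (b \<bullet> b) - (a \<bullet> b)\<^sup>2 \<noteq> 0" and 0: "r *\<^sub>R a + t *\<^sub>R b = 0"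
    have "(r *\<^sub>R a + t *\<^sub>R b) \<bullet> a = 0" "(r *\<^sub>R a + t *\<^sub>R b) \<bullet> b = 0" using 0 by simp_all
    then have 1: "r * (a \<bullet> a) + t * (a \<bullet> b) = 0" "r * (a \<bullet> b) + t * (b \<bullet> b) = 0"
      unfolding inner_add_left inner_scaleR_left inner_commute[of b a] .
    have "r * ((a \<bullet> a) * (b \<bullet> b) - (a \<bullet> b)\<^sup>2) = 
      (r * (a \<bullet> a) + t * (a \<bullet> b)) * (b \<bullet> b) - (r * (a \<bullet> b) + t * (b \<bullet> b)) * (a \<bullet> b)"
      "t * ((a \<bullet> a) * (b \<bullet> b) - (a \<bullet> b)\<^sup>2) = 
      (r * (a \<bullet> b) + t * (b \<bullet> b)) * (a \<bullet> a) - (r * (a \<bullet> a) + t * (a \<bullet> b)) * (a \<bullet> b)"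
      by (simp_all add: algebra_simps power2_eq_square)
    then show "r = 0 \<and> t = 0" using G unfolding 1 by simp
  next
    assume ind: "\<forall>r t. r *\<^sub>R a + t *\<^sub>R b = 0 \<longrightarrow> r = 0 \<and> t = 0"
    then have "b \<noteq> 0" using ind[rule_format, of 0 1] by auto
    then have "(b \<bullet> b) *\<^sub>R a + (- (a \<bullet> b)) *\<^sub>R b \<noteq> 0" using ind[rule_format, of "b \<bullet> b" "- (a \<bullet> b)"] by auto
    then have "((b \<bullet> b) *\<^sub>R a + (- (a \<bullet> b)) *\<^sub>R b) \<bullet> ((b \<bullet> b) *\<^sub>R a + (- (a \<bullet> b)) *\<^sub>R b) \<noteq> 0"
      using inner_eq_zero_iff by blast
    moreover have "((b \<bullet> b) *\<^sub>R a + (- (a \<bullet> b)) *\<^sub>R b) \<bullet> ((b \<bullet> b) *\<^sub>R a + (- (a \<bullet> b)) *\<^sub>R b)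
       = (b \<bullet> b) * ((a \<bullet> a) * (b \<bullet> b) - (a \<bullet> b)\<^sup>2)"
      by (simp add: inner_add_left inner_add_right inner_diff_left inner_diff_right inner_commute[of b a]
          algebra_simps power2_eq_square)
    ultimately show "(a \<bullet> a) * (b \<bullet> b) - (a \<bullet> b)\<^sup>2 \<noteq> 0" by auto
  qed
qed

text \<open>Immersion at a point is the nonvanishing of the Gram determinant of the two partial derivatives of a
frame, modulo the frame.\<close>
lemma open_immersed:
  fixes E :: "'m \<Rightarrow> ('v::euclidean_space) set"
  assumes "subbundle A 1 UNIV E"
  shows "open {x. immerses_at A E x}"
proof (subst open_subopen, rule ballI)
  fix x assume "x \<in> {x. immerses_at A E x}"
  then have imm: "immerses_at A E x" by simp
  obtain N s where N: "open N" "x \<in> N" "smooth_map A N s"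
    "\<And>y. y \<in> N \<Longrightarrow> E y = span {s y}" "\<And>y. y \<in> N \<Longrightarrow> s y \<noteq> 0"
    using line_bundle_frame[OF assms UNIV_I] by metis
  let ?c = "chart_at x"
  let ?D = "\<lambda>y. frechet_derivative (s \<circ> chart_inv ?c) (at (snd ?c y))"
  let ?M = "fst ?c \<inter> N"
  have M: "open ?M" "x \<in> ?M"
    using open_chart_domain[OF chart_at(1)] N(1,2) chart_at(2) by auto
  define a where "a i y = (s y \<bullet> s y) *\<^sub>R ?D y (axis i 1) - (?D y (axis i 1) \<bullet> s y) *\<^sub>R s y" for i :: 2 and y
  define G where "G y = (a 1 y \<bullet> a 1 y) * (a 2 y \<bullet> a 2 y) - (a 1 y \<bullet> a 2 y)\<^sup>2" for y
  have contD: "continuous_on ?M (\<lambda>y. ?D y v)" for v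
  proof -
    have "Ck_on (Suc 0) (snd ?c ` ?M) (s \<circ> chart_inv ?c)"
      using N(3) chart_at(1) unfolding smooth_map_def smooth_on_def by blast
    then have "continuous_on (snd ?c ` ?M) (\<lambda>u. frechet_derivative (s \<circ> chart_inv ?c) (at u) v)" by simp
    moreover have "continuous_on ?M (snd ?c)"
      by (rule continuous_on_subset[OF continuous_on_chart[OF chart_at(1)]]) auto
    ultimately show ?thesis by (rule continuous_on_compose2) auto
  qed
  have conts: "continuous_on ?M s"
    by (rule continuous_on_subset[OF smooth_map_imp_continuous_on[OF N(1,3)]]) auto
  have conta: "continuous_on ?M (a i)" for i
    unfolding a_def by (intro continuous_on_diff continuous_on_scaleR continuous_on_inner contD conts)
  have contG: "continuous_on ?M G"
    unfolding G_def by (intro continuous_on_diff continuous_on_mult continuous_on_power continuous_on_inner conta)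
  have iff: "immerses_at A E y \<longleftrightarrow> G y \<noteq> 0" if y: "y \<in> ?M" for y
  proof -
    have yN: "y \<in> N" "y \<in> fst ?c" using y by auto
    have lin: "linear (?D y)"
      by (rule has_derivative_linear[OF smooth_map_has_derivative[OF N(3) yN(1) chart_at(1) yN(2)]])
    have Dv: "?D y v = (v $ 1) *\<^sub>R ?D y (axis 1 1) + (v $ 2) *\<^sub>R ?D y (axis 2 1)" for v :: "real^2"
    proof -
      have "v = (v $ 1) *\<^sub>R axis 1 1 + (v $ 2) *\<^sub>R axis 2 1"
        by (simp add: vec_eq_iff forall_2 axis_def)
      then have "?D y v = ?D y ((v $ 1) *\<^sub>R axis 1 1 + (v $ 2) *\<^sub>R axis 2 1)" by (rule arg_cong)
      then show ?thesis by (simp add: linear_add[OF lin] linear_scale[OF lin])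
    qed
    have "immerses_at A E y \<longleftrightarrow> (\<forall>X\<in>tangent_space A y. dir_deriv A y X s \<in> E y \<longrightarrow> X = (\<lambda>_. 0))"
      by (rule immerses_at_frame_iff[OF N(1) yN(1) N(3,4) N(5)[OF yN(1)]])
    also have "\<dots> \<longleftrightarrow> (\<forall>v. ?D y v \<in> span {s y} \<longrightarrow> v = 0)"
    proof (intro iffI allI impI ballI)
      fix v assume *: "\<forall>X\<in>tangent_space A y. dir_deriv A y X s \<in> E y \<longrightarrow> X = (\<lambda>_. 0)"
        and v: "?D y v \<in> span {s y}"
      obtain X where X: "X \<in> tangent_space A y" "X ?c = v"
        using tangent_space_chart_ex[OF chart_at(1) yN(2)] by blast
      have "dir_deriv A y X s \<in> E y"
        using v by (simp add: dir_deriv_chart[OF N(3) yN(1) X(1) chart_at(1) yN(2)] X(2) N(4)[OF yN(1)])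
      then show "v = 0" using * X by auto
    next
      fix X assume *: "\<forall>v. ?D y v \<in> span {s y} \<longrightarrow> v = 0" and X: "X \<in> tangent_space A y"
        and m: "dir_deriv A y X s \<in> E y"
      have "X ?c = 0"
        using * m by (simp add: dir_deriv_chart[OF N(3) yN(1) X(1) chart_at(1) yN(2)] N(4)[OF yN(1)])
      then show "X = (\<lambda>_. 0)" by (rule tangent_space_eq_zero[OF X chart_at(1) yN(2)])
    qed
    also have "\<dots> \<longleftrightarrow> (\<forall>r t. r *\<^sub>R ?D y (axis 1 1) + t *\<^sub>R ?D y (axis 2 1) \<in> span {s y} \<longrightarrow> r = 0 \<and> t = 0)"
    proof (intro iffI allI impI)
      fix r t assume *: "\<forall>v. ?D y v \<in> span {s y} \<longrightarrow> v = 0"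
        and m: "r *\<^sub>R ?D y (axis 1 1) + t *\<^sub>R ?D y (axis 2 1) \<in> span {s y}"
      have "vector [r, t] = (0 :: real^2)"
        using * Dv[of "vector [r, t]"] m by (simp add: vector_2)
      then show "r = 0 \<and> t = 0" by (metis vector_2 zero_index)
    next
      fix v assume "\<forall>r t. r *\<^sub>R ?D y (axis 1 1) + t *\<^sub>R ?D y (axis 2 1) \<in> span {s y} \<longrightarrow> r = 0 \<and> t = 0"
        and "?D y v \<in> span {s y}"
      then have "v $ 1 = 0 \<and> v $ 2 = 0" unfolding Dv[of v] by blast
      then show "v = 0" by (simp add: vec_eq_iff forall_2)
    qed
    also have "\<dots> \<longleftrightarrow> G y \<noteq> 0"
      unfolding G_def a_def using gram_independent_iff[OF N(5)[OF yN(1)]] by simp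
    finally show ?thesis .
  qed
  have "open (?M \<inter> G -` (- {0}))"
    by (rule continuous_open_preimage[OF contG M(1)]) auto
  moreover have "x \<in> ?M \<inter> G -` (- {0})" using iff[OF M(2)] imm M(2) by simp
  moreover have "?M \<inter> G -` (- {0}) \<subseteq> {x. immerses_at A E x}" using iff by auto
  ultimately show "\<exists>T. open T \<and> x \<in> T \<and> T \<subseteq> {x. immerses_at A E x}" by blast
qed

text \<open>A continuous section of unit length is the normalisation of a smooth frame, up to a sign which is
locally constant.\<close>
lemma normalised_section_smooth:
  fixes L :: "'m \<Rightarrow> ('v::euclidean_space) set"
  assumes L: "subbundle A 1 U L" and l: "continuous_on U l" "\<And>x. x \<in> U \<Longrightarrow> l x \<in> L x" "\<And>x. x \<in> U \<Longrightarrow> norm (l x) = 1"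
    and x: "x \<in> U"
  obtains N where "open N" "x \<in> N" "N \<subseteq> U" "smooth_map A N l"
proof -
  obtain N s where N: "open N" "x \<in> N" "N \<subseteq> U" "smooth_map A N s"
    and Ls: "\<And>y. y \<in> N \<Longrightarrow> L y = span {s y}" "\<And>y. y \<in> N \<Longrightarrow> s y \<noteq> 0"
    using line_bundle_frame[OF L x] by metis
  have lN: "\<exists>k. l y = k *\<^sub>R s y" if "y \<in> N" for y
    using l(2) Ls(1)[OF that] N(3) that unfolding span_singleton by blast
  define M where "M = N \<inter> (\<lambda>y. (l x \<bullet> s x) * (l y \<bullet> s y)) -` {0<..}"
  have "continuous_on N l" by (rule continuous_on_subset[OF l(1) N(3)])
  then have opM: "open M"
    unfolding M_def
    by (intro continuous_open_preimage[OF _ N(1)] continuous_on_mult continuous_on_const continuous_on_inner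
        smooth_map_imp_continuous_on[OF N(1,4)] open_greaterThan)
  have ls: "l y = sgn (l y \<bullet> s y) *\<^sub>R ((s y \<bullet> s y) powr (- 1/2) *\<^sub>R s y)" "l y \<bullet> s y \<noteq> 0" if yN: "y \<in> N" for y
  proof -
    obtain k where k: "l y = k *\<^sub>R s y" using lN[OF yN] by blast
    have s: "s y \<bullet> s y > 0" "norm (s y) > 0" using Ls(2)[OF yN] by simp_all
    have kn: "\<bar>k\<bar> * norm (s y) = 1" using k l(3)[of y] N(3) yN by (metis norm_scaleR subsetD)
    then have "\<bar>k\<bar> = 1 / norm (s y)" using s(2) by (simp add: eq_divide_eq)
    also have "\<dots> = (s y \<bullet> s y) powr (- 1/2)"
      using s by (simp add: powr_minus powr_half_sqrt norm_eq_sqrt_inner inverse_eq_divide)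
    finally have abs_k: "(s y \<bullet> s y) powr (- 1/2) = \<bar>k\<bar>" ..
    have sgn_k: "sgn (l y \<bullet> s y) = sgn k" unfolding k using s(1) by (simp add: sgn_mult)
    show "l y = sgn (l y \<bullet> s y) *\<^sub>R ((s y \<bullet> s y) powr (- 1/2) *\<^sub>R s y)"
      unfolding abs_k sgn_k scaleR_scaleR sgn_mult_abs by (rule k)
    show "l y \<bullet> s y \<noteq> 0" using kn s unfolding k by auto
  qed
  have xM: "x \<in> M" using N(2) ls(2)[OF N(2)] by (auto simp: M_def zero_less_mult_iff)
  have sM: "smooth_map A M s" by (rule smooth_map_subset[OF N(4)]) (simp add: M_def)
  have ssM: "smooth_map A M (\<lambda>y. s y \<bullet> s y)" by (rule smooth_map_bilinear[OF bounded_bilinear_inner opM sM sM])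
  have pM: "smooth_map A M (\<lambda>y. (s y \<bullet> s y) powr (- 1/2))"
    by (rule smooth_map_powr[OF opM ssM]) (use Ls(2) in \<open>simp add: M_def\<close>)
  have "smooth_map A M (\<lambda>y. sgn (l x \<bullet> s x) *\<^sub>R ((s y \<bullet> s y) powr (- 1/2) *\<^sub>R s y))"
    by (rule smooth_map_bilinear[OF bounded_bilinear_scaleR opM smooth_map_const[OF opM]
        smooth_map_bilinear[OF bounded_bilinear_scaleR opM pM sM]])
  moreover have "sgn (l x \<bullet> s x) *\<^sub>R ((s y \<bullet> s y) powr (- 1/2) *\<^sub>R s y) = l y" if "y \<in> M" for y
  proof -
    have "y \<in> N" "(l x \<bullet> s x) * (l y \<bullet> s y) > 0" using that by (auto simp: M_def)
    then have "sgn (l x \<bullet> s x) = sgn (l y \<bullet> s y)" by (auto simp: zero_less_mult_iff)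
    then show ?thesis using ls(1)[OF \<open>y \<in> N\<close>] by simp
  qed
  ultimately have "smooth_map A M l" by (rule smooth_map_cong[OF opM])
  moreover have "M \<subseteq> U" using N(3) by (auto simp: M_def)
  ultimately show ?thesis using that[OF opM xM] by blast
qed

end

section \<open>Legendre maps and point sphere maps\<close>

text \<open>A Legendre map together with a rank 1 distribution on its domain.\<close>
locale legendre = surface A + lie_quadric ip
  for A :: "'m::t2_space chart set" and ip +
  fixes f :: "'m \<Rightarrow> (real^6) set" and T :: "'m \<Rightarrow> 'm tvec set"
  assumes legendre: "legendre_map A ip f" and distribution: "rank1_distribution A T"
begin

text \<open>The point sphere map of the geometry given by \<open>p\<close>.\<close>
abbreviation \<Lambda> :: "real^6 \<Rightarrow> 'm \<Rightarrow> (real^6) set" where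
  "\<Lambda> p \<equiv> point_sphere_map ip f p"

lemmas tangent_T = rank1_distribution_tangent[OF distribution]

lemma smooth_map_ip:
  "open N \<Longrightarrow> smooth_map A N g \<Longrightarrow> smooth_map A N h \<Longrightarrow> smooth_map A N (\<lambda>y. ip (g y) (h y))"
  by (rule smooth_map_bilinear[OF bounded_bilinear_ip])

lemma smooth_map_ip_const: "open N \<Longrightarrow> smooth_map A N g \<Longrightarrow> smooth_map A N (\<lambda>y. ip (g y) w)"
  by (rule smooth_map_ip[OF _ _ smooth_map_const])

lemma smooth_at_ip_const: "smooth_at x g \<Longrightarrow> smooth_at x (\<lambda>y. ip (g y) w)"
  by (rule smooth_at_bilinear[OF bounded_bilinear_ip _ smooth_at_const])

lemma dir_deriv_ip_const:
  assumes "smooth_at x g"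
  shows "dir_deriv A x X (\<lambda>y. ip (g y) w) = ip (dir_deriv A x X g) w"
  using dir_deriv_bilinear[OF bounded_bilinear_ip assms smooth_at_const, of X w]
  by (simp add: dir_deriv_const ip_simps)

lemma f_frame:
  obtains N s t where "open N" "x \<in> N" "smooth_map A N s" "smooth_map A N t"
    "\<And>y. y \<in> N \<Longrightarrow> f y = span {s y, t y}"
proof -
  have "subbundle A 2 UNIV f" using legendre unfolding legendre_map_def by blast
  then obtain N s where Ns: "open N \<and> x \<in> N \<and> N \<subseteq> UNIV \<and> (\<forall>i<2. smooth_map A N (s i)) \<and>
        (\<forall>y\<in>N. f y = span ((\<lambda>i::nat. s i y) ` {..<2}) \<and> dim (f y) = 2)"
    unfolding subbundle_def by (elim ballE[of _ _ x] exE) auto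
  have im: "(\<lambda>i::nat. s i y) ` {..<2} = {s 0 y, s 1 y}" for y
    by (auto simp: numeral_2_eq_2 lessThan_Suc)
  have sm: "smooth_map A N (s 0)" "smooth_map A N (s 1)" using Ns by simp_all
  show ?thesis
    by (rule that[OF _ _ sm]) (use Ns[unfolded im] in blast)+
qed

lemma null_plane_f: "null_plane (f x)"
proof -
  have "subbundle A 2 UNIV f" using legendre unfolding legendre_map_def by blast
  then have "dim (f x) = 2" unfolding subbundle_def by (elim ballE[of _ _ x] exE) auto
  moreover obtain a b where "f x = span {a, b}" using f_frame[of x] by metis
  then have "subspace (f x)" by simp
  moreover have "\<forall>u\<in>f x. \<forall>v\<in>f x. ip u v = 0" using legendre unfolding legendre_map_def by blast
  ultimately show ?thesis unfolding null_plane_def by blast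
qed

lemma dir_deriv_f_perp:
  assumes "X \<in> tangent_space A x" "\<xi> \<in> local_sections A x f"
  shows "dir_deriv A x X \<xi> \<in> perp ip (f x)"
proof -
  have "dir_deriv A x X \<xi> \<in> derived_bundle A f x"
    unfolding derived_bundle_def using assms by (intro span_base) blast
  then show ?thesis using legendre unfolding legendre_map_def by blast
qed

lemma f_section_not_perp:
  assumes p: "timelike ip p"
  obtains N s where "open N" "x \<in> N" "smooth_map A N s" "\<And>y. y \<in> N \<Longrightarrow> s y \<in> f y"
    "\<And>y. y \<in> N \<Longrightarrow> ip (s y) p \<noteq> 0"
proof -
  obtain N a b where N: "open N" "x \<in> N" and ab: "smooth_map A N a" "smooth_map A N b"
    and f: "\<And>y. y \<in> N \<Longrightarrow> f y = span {a y, b y}" using f_frame[of x] by metis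
  have "\<exists>s. smooth_map A N s \<and> (\<forall>y\<in>N. s y \<in> f y) \<and> ip (s x) p \<noteq> 0"
  proof (rule ccontr)
    assume "\<not> ?thesis"
    then have "ip (a x) p = 0" "ip (b x) p = 0" using ab f by (auto simp: span_base)
    then have "p \<in> perp ip (span {a x, b x})" unfolding perp_span by (simp add: perp_def)
    then have "p \<in> perp ip (f x)" using f[OF N(2)] by simp
    then show False using timelike_not_perp[OF null_plane_f p, of x] unfolding perp_def by blast
  qed
  then obtain s where s: "smooth_map A N s" "\<forall>y\<in>N. s y \<in> f y" "ip (s x) p \<noteq> 0" by blast
  let ?M = "N \<inter> (\<lambda>y. ip (s y) p) -` (- {0})"
  have "open ?M"
    by (rule continuous_open_preimage[OF smooth_map_imp_continuous_on[OF N(1) smooth_map_ip_const[OF N(1) s(1)]] N(1)])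
      auto
  moreover have "x \<in> ?M" using N(2) s(3) by simp
  moreover have "smooth_map A ?M s" by (rule smooth_map_subset[OF s(1)]) auto
  ultimately show ?thesis by (rule that) (use s(2) in auto)
qed

lemma point_sphere_subbundle:
  assumes p: "timelike ip p"
  shows "subbundle A 1 UNIV (\<Lambda> p)"
proof (rule line_bundleI)
  fix x
  obtain N a b where N: "open N" "x \<in> N" and ab: "smooth_map A N a" "smooth_map A N b"
    and f: "\<And>y. y \<in> N \<Longrightarrow> f y = span {a y, b y}" using f_frame[of x] by metis
  let ?\<sigma> = "\<lambda>y. ip (b y) p *\<^sub>R a y + ip (a y) (- p) *\<^sub>R b y"
  have "smooth_map A N ?\<sigma>"
    by (rule smooth_map_add[OF N(1)
        smooth_map_bilinear[OF bounded_bilinear_scaleR N(1) smooth_map_ip_const[OF N(1) ab(2)] ab(1)]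
        smooth_map_bilinear[OF bounded_bilinear_scaleR N(1) smooth_map_ip_const[OF N(1) ab(1)] ab(2)]])
  moreover have "\<Lambda> p y = span {?\<sigma> y} \<and> ?\<sigma> y \<noteq> 0" if "y \<in> N" for y
    unfolding point_sphere_map_def using point_sphere_span[OF null_plane_f f[OF that] p] by blast
  ultimately show "\<exists>N s. open N \<and> x \<in> N \<and> N \<subseteq> UNIV \<and> smooth_map A N s \<and> (\<forall>y\<in>N. \<Lambda> p y = span {s y} \<and> s y \<noteq> 0)"
    using N by (intro exI[of _ N] exI[of _ ?\<sigma>]) simp
qed

lemma point_sphere_frame:
  assumes "timelike ip p"
  obtains N \<sigma> where "open N" "x \<in> N" "smooth_map A N \<sigma>" "\<And>y. y \<in> N \<Longrightarrow> \<Lambda> p y = span {\<sigma> y}"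
    "\<And>y. y \<in> N \<Longrightarrow> \<sigma> y \<noteq> 0" "\<sigma> \<in> local_sections A x f" "\<sigma> \<in> local_sections A x (\<Lambda> p)"
proof -
  obtain N \<sigma> where N: "open N" "x \<in> N" "smooth_map A N \<sigma>" "\<And>y. y \<in> N \<Longrightarrow> \<Lambda> p y = span {\<sigma> y}"
    "\<And>y. y \<in> N \<Longrightarrow> \<sigma> y \<noteq> 0"
    using line_bundle_frame[OF point_sphere_subbundle[OF assms] UNIV_I, of x] by metis
  have mem: "\<sigma> y \<in> \<Lambda> p y" if "y \<in> N" for y using N(4)[OF that] by (simp add: span_base)
  have "\<sigma> \<in> local_sections A x (\<Lambda> p)" by (rule local_sectionsI[OF N(1-3) mem])
  moreover have "\<sigma> \<in> local_sections A x f"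
    by (rule local_sectionsI[OF N(1-3)]) (use mem in \<open>simp add: point_sphere_map_def\<close>)
  ultimately show ?thesis using that[OF N] by blast
qed

lemma open_immersed_region: "timelike ip p \<Longrightarrow> open (immersed_region A ip f p)"
  unfolding immersed_region_def by (rule open_immersed[OF point_sphere_subbundle])

lemma dir_deriv_point_sphere_perp:
  assumes X: "X \<in> tangent_space A x" and \<sigma>: "\<sigma> \<in> local_sections A x (\<Lambda> p)"
  shows "dir_deriv A x X \<sigma> \<in> perp ip (f x)" and "ip (dir_deriv A x X \<sigma>) p = 0"
proof -
  obtain N where N: "open N" "x \<in> N" "smooth_map A N \<sigma>" "\<And>y. y \<in> N \<Longrightarrow> \<sigma> y \<in> \<Lambda> p y"
    using \<sigma> unfolding local_sections_def sections_def by blast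
  have "\<sigma> \<in> local_sections A x f"
    by (rule local_sectionsI[OF N(1-3)]) (use N(4) in \<open>simp add: point_sphere_map_def\<close>)
  then show "dir_deriv A x X \<sigma> \<in> perp ip (f x)" by (rule dir_deriv_f_perp[OF X])
  have sm: "smooth_at x \<sigma>" by (rule smooth_atI[OF N(1-3)])
  have 0: "ip (\<sigma> y) p = 0" if "y \<in> N" for y
    using N(4)[OF that] ip_commute by (simp add: point_sphere_map_def perp_def)
  have "dir_deriv A x X (\<lambda>y. ip (\<sigma> y) p) = dir_deriv A x X (\<lambda>y. 0)"
    by (rule dir_deriv_cong[OF N(1,2) 0 smooth_at_ip_const[OF sm]])
  then show "ip (dir_deriv A x X \<sigma>) p = 0" unfolding dir_deriv_ip_const[OF sm] dir_deriv_const .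
qed

lemma derived_point_sphere_perp:
  "derived_bundle A (\<Lambda> p) x \<subseteq> perp ip (f x \<union> {p})"
  unfolding derived_bundle_def
proof (rule span_minimal[OF _ subspace_perp], rule Un_least)
  show "\<Lambda> p x \<subseteq> perp ip (f x \<union> {p})"
    using null_plane_f[of x] unfolding null_plane_def point_sphere_map_def perp_def by auto
  show "{dir_deriv A x X \<sigma> |X \<sigma>. X \<in> tangent_space A x \<and> \<sigma> \<in> local_sections A x (\<Lambda> p)} \<subseteq> perp ip (f x \<union> {p})"
  proof clarify
    fix X \<sigma> assume *: "X \<in> tangent_space A x" "\<sigma> \<in> local_sections A x (\<Lambda> p)"
    show "dir_deriv A x X \<sigma> \<in> perp ip (f x \<union> {p})"
      using dir_deriv_point_sphere_perp[OF *] ip_commute[of p] unfolding perp_def by auto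
  qed
qed

text \<open>The derivative is orthogonal to \<open>p\<close>; if it were in \<open>f\<close>, it would be in \<open>\<Lambda>\<close>, against the immersion property.\<close>
lemma immersed_dir_deriv_notin:
  assumes imm: "x \<in> immersed_region A ip f p" and X: "X \<in> tangent_space A x" "X \<noteq> (\<lambda>_. 0)"
    and N: "open N" "x \<in> N" "smooth_map A N \<sigma>" "\<And>y. y \<in> N \<Longrightarrow> \<Lambda> p y = span {\<sigma> y}" "\<sigma> x \<noteq> 0"
    and \<sigma>: "\<sigma> \<in> local_sections A x (\<Lambda> p)"
  shows "dir_deriv A x X \<sigma> \<notin> f x"
proof
  assume "dir_deriv A x X \<sigma> \<in> f x"
  then have "dir_deriv A x X \<sigma> \<in> \<Lambda> p x"
    using dir_deriv_point_sphere_perp(2)[OF X(1) \<sigma>] ip_commute[of p]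
    unfolding point_sphere_map_def perp_def by simp
  then show False
    using imm X immerses_at_frame_iff[OF N] unfolding immersed_region_def by blast
qed

section \<open>Spherical curvature lines from a constant line\<close>

text \<open>The function \<open>(\<xi>, l)\<close> vanishes along an integral curve through \<open>x\<close>, because the fixed vector \<open>l\<close> stays in
\<open>L\<close> and therefore orthogonal to \<open>f\<close>.\<close>
lemma constant_line_perp_dir_deriv:
  assumes L: "constant_spacelike_line A ip f T U L" and U: "open U" "x \<in> U"
    and l: "l \<in> L x" and X: "X \<in> T x" and \<xi>: "\<xi> \<in> local_sections A x f"
  shows "ip (dir_deriv A x X \<xi>) l = 0"
proof -
  have sm: "smooth_at x \<xi>" by (rule local_sections_smooth_at[OF \<xi>])
  obtain N where N: "open N" "x \<in> N" "\<And>y. y \<in> N \<Longrightarrow> \<xi> y \<in> f y" using \<xi> unfolding local_sections_def sections_def by blast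
  obtain e \<gamma> where e: "e > 0" and \<gamma>: "integral_curve A T U (- e) e \<gamma>" "\<gamma> 0 = x"
    using integral_curve_exists[OF distribution U] by metis
  have 0: "0 \<in> {- e<..<e}" using e by simp
  let ?V = "velocity A \<gamma> 0"
  have der: "((\<lambda>\<tau>. ip (\<xi> (\<gamma> \<tau>)) l) has_vector_derivative ip (dir_deriv A x ?V \<xi>) l) (at 0)"
    using integral_curveD(4)[OF \<gamma>(1) 0, of "\<lambda>y. ip (\<xi> y) l"] smooth_at_ip_const[OF sm, of l]
      dir_deriv_ip_const[OF sm, of ?V l] by (simp add: \<gamma>(2))
  have "eventually (\<lambda>\<tau>. \<tau> \<in> {- e<..<e} \<and> \<gamma> \<tau> \<in> N) (at 0)"
    by (rule eventually_along_curve[OF \<gamma>(1) 0 N(1)]) (simp add: \<gamma>(2) N(2))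
  moreover have zero: "ip (\<xi> (\<gamma> \<tau>)) l = 0" if "\<tau> \<in> {- e<..<e}" "\<gamma> \<tau> \<in> N" for \<tau>
  proof -
    have "L (\<gamma> \<tau>) = L (\<gamma> 0)"
      using L constant_along_leavesD[OF _ \<gamma>(1) 0 that(1)] unfolding constant_spacelike_line_def by blast
    then have "l \<in> L (\<gamma> \<tau>)" using l \<gamma>(2) by simp
    then have "l \<in> perp ip (f (\<gamma> \<tau>))"
      using L integral_curveD(1)[OF \<gamma>(1) that(1)] unfolding constant_spacelike_line_def by blast
    then show ?thesis using N(3)[OF that(2)] unfolding perp_def by blast
  qed
  ultimately have ev: "eventually (\<lambda>\<tau>. ip (\<xi> (\<gamma> \<tau>)) l = 0) (at 0)" by (auto elim: eventually_mono)
  have "((\<lambda>\<tau>. 0) has_derivative (\<lambda>s. s *\<^sub>R ip (dir_deriv A x ?V \<xi>) l)) (at 0)"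
    by (rule has_derivative_transform_eventually[OF der[unfolded has_vector_derivative_def] ev _ UNIV_I])
      (use zero[OF 0] \<gamma>(2) N(2) in simp)
  then have "((\<lambda>\<tau>. 0) has_vector_derivative ip (dir_deriv A x ?V \<xi>) l) (at (0::real))"
    unfolding has_vector_derivative_def .
  from vector_derivative_unique_at[OF this has_vector_derivative_const]
  have V0: "ip (dir_deriv A x ?V \<xi>) l = 0" .
  have "?V \<in> T x - {\<lambda>_. 0}" using integral_curveD(3)[OF \<gamma>(1) 0] \<gamma>(2) by simp
  from rank1_distribution_scale[OF distribution this X] obtain r where "X = (\<lambda>c. r *\<^sub>R ?V c)" by blast
  then show ?thesis using V0 by (simp add: dir_deriv_scale[OF sm] ip_simps)
qed

lemma constant_line_imp_curvature_lines:
  assumes L: "constant_spacelike_line A ip f T U L" and U: "open U"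
  shows "curvature_lines A ip f T U"
  unfolding curvature_lines_def contact_bivectors_def[symmetric]
proof (intro ballI)
  fix x X Y \<xi>1 \<xi>2
  assume x: "x \<in> U" and XY: "X \<in> T x" "Y \<in> T x"
    and \<xi>: "\<xi>1 \<in> local_sections A x f" "\<xi>2 \<in> local_sections A x f"
  obtain l where l: "l \<in> L x" "l \<noteq> 0"
    using line_bundle_frame[of U L x] L x unfolding constant_spacelike_line_def
    by (metis span_base insertI1)
  have lp: "l \<in> perp ip (f x)" and ll: "ip l l > 0"
    using L x l unfolding constant_spacelike_line_def by blast+
  have lf: "l \<notin> f x" using ll null_plane_f[of x] unfolding null_plane_def by force
  obtain Z where Z: "Z \<in> tangent_space A x" "Z \<noteq> (\<lambda>_. 0)" "T x = {\<lambda>c. r *\<^sub>R Z c | r. True}"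
    using distribution unfolding rank1_distribution_def by blast
  have "Z = (\<lambda>c. 1 *\<^sub>R Z c)" by simp
  then have ZT: "Z \<in> T x" unfolding Z(3) by blast
  obtain r s where rs: "X = (\<lambda>c. r *\<^sub>R Z c)" "Y = (\<lambda>c. s *\<^sub>R Z c)" using XY unfolding Z(3) by blast
  let ?u = "dir_deriv A x Z \<xi>1" and ?v = "dir_deriv A x Z \<xi>2"
  have sm: "smooth_at x \<xi>1" "smooth_at x \<xi>2" using \<xi> by (simp_all add: local_sections_smooth_at)
  have perp: "?u \<in> perp ip (f x)" "?v \<in> perp ip (f x)" using dir_deriv_f_perp[OF Z(1)] \<xi> by blast+
  have "ip ?u l = 0" "ip ?v l = 0" using constant_line_perp_dir_deriv[OF L U x l(1) ZT] \<xi> by blast+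
  from dependent_mod_null_plane[OF null_plane_f perp lp lf this]
  obtain a b where "a \<noteq> 0 \<or> b \<noteq> 0" "a *\<^sub>R ?u + b *\<^sub>R ?v \<in> f x" by blast
  then have "wedge ?u ?v \<in> contact_bivectors ip (f x)"
    by (rule wedge_mem_contact_bivectors[OF null_plane_f perp])
  then have "(r * s) *\<^sub>R wedge ?u ?v \<in> contact_bivectors ip (f x)"
    unfolding contact_bivectors_def by (rule span_scale)
  moreover have "curv_rep A x X Y \<xi>1 \<xi>2 = (r * s) *\<^sub>R wedge ?u ?v"
    unfolding curv_rep_def rs dir_deriv_scale[OF sm(1)] dir_deriv_scale[OF sm(2)]
    by (simp add: wedge_simps mult.commute flip: scaleR_2)
  ultimately show "curv_rep A x X Y \<xi>1 \<xi>2 \<in> contact_bivectors ip (f x)" by simp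
qed

text \<open>A derivative \<open>d\<^sub>X\<sigma>\<close> not orthogonal to \<open>l\<close> complements the hyperplane given by \<open>\<nu>\<close>. If there were none,
two independent tangent vectors would give derivatives dependent modulo \<open>f\<close>, against the immersion property.\<close>
lemma transversalI:
  assumes imm: "x \<in> immersed_region A ip f p" and p: "timelike ip p"
    and l: "l \<in> perp ip (f x)" "ip l l > 0" and b: "b \<noteq> 0" and nu: "nu x = span {l + b *\<^sub>R p}"
  shows "transversal_at A ip f p nu x"
proof -
  let ?n = "l + b *\<^sub>R p"
  obtain s where s: "s \<in> f x" "ip s p \<noteq> 0" using timelike_not_perp[OF null_plane_f p] by blast
  have sl: "ip u l = 0" if "u \<in> f x" for u using that l(1) unfolding perp_def by blast
  have lf: "l \<notin> f x" using l(2) sl by force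
  have 1: "nu x \<inter> perp ip (f x) = {0}"
  proof -
    have "k = 0" if "k *\<^sub>R ?n \<in> perp ip (f x)" for k
    proof -
      have "ip s (k *\<^sub>R ?n) = 0" using that s(1) unfolding perp_def by blast
      then have "k * (b * ip s p) = 0" using sl[OF s(1)] by (simp add: ip_simps)
      then show ?thesis using b s(2) by simp
    qed
    moreover have "0 \<in> perp ip (f x)" using subspace_0[OF subspace_perp] .
    ultimately show ?thesis unfolding nu span_singleton by auto
  qed
  obtain N \<sigma> where N: "open N" "x \<in> N" "smooth_map A N \<sigma>" "\<And>y. y \<in> N \<Longrightarrow> \<Lambda> p y = span {\<sigma> y}"
    "\<And>y. y \<in> N \<Longrightarrow> \<sigma> y \<noteq> 0" and \<sigma>: "\<sigma> \<in> local_sections A x (\<Lambda> p)"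
    using point_sphere_frame[OF p] by metis
  have sm: "smooth_at x \<sigma>" by (rule smooth_atI[OF N(1-3)])
  obtain X where X: "X \<in> tangent_space A x" "ip (dir_deriv A x X \<sigma>) l \<noteq> 0"
  proof (rule ccontr)
    assume "\<not> thesis"
    then have zero: "ip (dir_deriv A x X \<sigma>) l = 0" if "X \<in> tangent_space A x" for X
      using that \<open>\<And>X. X \<in> tangent_space A x \<Longrightarrow> ip (dir_deriv A x X \<sigma>) l \<noteq> 0 \<Longrightarrow> thesis\<close> by blast
    let ?c = "chart_at x"
    obtain X1 where X1: "X1 \<in> tangent_space A x" "X1 ?c = axis 1 1"
      using tangent_space_chart_ex[OF chart_at] by blast
    obtain X2 where X2: "X2 \<in> tangent_space A x" "X2 ?c = axis 2 1"
      using tangent_space_chart_ex[OF chart_at] by blast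
    obtain r t where rt: "r \<noteq> 0 \<or> t \<noteq> 0"
      "r *\<^sub>R dir_deriv A x X1 \<sigma> + t *\<^sub>R dir_deriv A x X2 \<sigma> \<in> f x"
      using dependent_mod_null_plane[OF null_plane_f dir_deriv_point_sphere_perp(1)[OF X1(1) \<sigma>]
        dir_deriv_point_sphere_perp(1)[OF X2(1) \<sigma>] l(1) lf zero[OF X1(1)] zero[OF X2(1)]] by blast
    let ?X = "\<lambda>c. r *\<^sub>R X1 c + t *\<^sub>R X2 c"
    have "dir_deriv A x ?X \<sigma> \<in> f x" using rt(2) by (simp add: dir_deriv_combination[OF sm])
    then have "?X = (\<lambda>_. 0)"
      using immersed_dir_deriv_notin[OF imm tangent_space_combination[OF X1(1) X2(1)] _ N(1-4) N(5)[OF N(2)] \<sigma>]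
      by blast
    from fun_cong[OF this, of ?c] have "r *\<^sub>R axis 1 1 + t *\<^sub>R axis 2 1 = (0 :: real^2)"
      by (simp add: X1(2) X2(2))
    then have "r = 0 \<and> t = 0" by (simp add: vec_eq_iff forall_2 axis_def)
    then show False using rt(1) by simp
  qed
  let ?a = "dir_deriv A x X \<sigma>"
  have ap: "?a \<in> derived_bundle A (\<Lambda> p) x"
    unfolding derived_bundle_def using X(1) \<sigma> by (intro span_base) blast
  have "ip ?a p = 0" by (rule dir_deriv_point_sphere_perp(2)[OF X(1) \<sigma>])
  then have an: "ip ?n ?a \<noteq> 0" using X(2) ip_commute[of ?a l] ip_commute[of ?a p] by (simp add: ip_simps)
  have derp: "derived_bundle A (\<Lambda> p) x \<subseteq> perp ip (\<Lambda> p x \<union> {p})"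
    using derived_point_sphere_perp[of p x] unfolding point_sphere_map_def perp_def by blast
  have nun: "perp ip (\<Lambda> p x \<union> {p} \<union> nu x) = perp ip (\<Lambda> p x \<union> {p}) \<inter> perp ip {?n}"
    unfolding nu using perp_span[of "{?n}"] unfolding perp_def by blast
  have "{a + b |a b. a \<in> derived_bundle A (\<Lambda> p) x \<and> b \<in> perp ip (\<Lambda> p x \<union> {p} \<union> nu x)}
      = perp ip (\<Lambda> p x \<union> {p})"
  proof
    show "{a + b |a b. a \<in> derived_bundle A (\<Lambda> p) x \<and> b \<in> perp ip (\<Lambda> p x \<union> {p} \<union> nu x)}
      \<subseteq> perp ip (\<Lambda> p x \<union> {p})"
      unfolding nun using derp subspace_add[OF subspace_perp] by blast
    show "perp ip (\<Lambda> p x \<union> {p}) \<subseteq>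
      {a + b |a b. a \<in> derived_bundle A (\<Lambda> p) x \<and> b \<in> perp ip (\<Lambda> p x \<union> {p} \<union> nu x)}"
    proof
      fix w assume w: "w \<in> perp ip (\<Lambda> p x \<union> {p})"
      define k where "k = ip ?n w / ip ?n ?a"
      have ka: "k *\<^sub>R ?a \<in> derived_bundle A (\<Lambda> p) x"
        using ap unfolding derived_bundle_def by (rule span_scale)
      have "w - k *\<^sub>R ?a \<in> perp ip (\<Lambda> p x \<union> {p})"
        using w ka derp by (intro subspace_diff[OF subspace_perp]) auto
      moreover have "ip ?n (w - k *\<^sub>R ?a) = ip ?n w - k * ip ?n ?a"
        by (simp only: bilinear_rsub[OF bilinear_ip] bilinear_rmul[OF bilinear_ip] real_scaleR_def)
      then have "w - k *\<^sub>R ?a \<in> perp ip {?n}" using an by (simp add: perp_def k_def)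
      ultimately have "w - k *\<^sub>R ?a \<in> perp ip (\<Lambda> p x \<union> {p} \<union> nu x)" unfolding nun by blast
      moreover have "w = k *\<^sub>R ?a + (w - k *\<^sub>R ?a)" by simp
      ultimately show "w \<in> {a + b |a b. a \<in> derived_bundle A (\<Lambda> p) x \<and> b \<in> perp ip (\<Lambda> p x \<union> {p} \<union> nu x)}"
        using ka by blast
    qed
  qed
  then show ?thesis using 1 unfolding transversal_at_def Let_def by blast
qed

lemma constant_line_imp_spherical:
  assumes L: "constant_spacelike_line A ip f T U L" and U: "open U" "simply_connected U"
    and p: "timelike ip p" and W: "open W" "W \<subseteq> U" "W \<subseteq> immersed_region A ip f p"
  shows "spherical_curvature_lines A ip f T p W"
proof -
  have Lb: "subbundle A 1 U L" and Lperp: "\<And>x. x \<in> U \<Longrightarrow> L x \<subseteq> perp ip (f x)"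
    and Lpos: "\<And>x v. x \<in> U \<Longrightarrow> v \<in> L x \<Longrightarrow> v \<noteq> 0 \<Longrightarrow> ip v v > 0"
    and Lc: "constant_along_leaves A T U L"
    using L unfolding constant_spacelike_line_def by blast+
  have triv: "\<exists>N s. open N \<and> x \<in> N \<and> N \<subseteq> U \<and> path_connected N \<and> continuous_on N s \<and>
       (\<forall>y\<in>N. L y = span {s y} \<and> s y \<noteq> 0)" if x: "x \<in> U" for x
  proof -
    obtain N s where N: "open N" "x \<in> N" "N \<subseteq> U" "smooth_map A N s"
      and Ls: "\<And>y. y \<in> N \<Longrightarrow> L y = span {s y}" "\<And>y. y \<in> N \<Longrightarrow> s y \<noteq> 0"
      using line_bundle_frame[OF Lb x] by metis
    obtain M where M: "open M" "x \<in> M" "M \<subseteq> N" "path_connected M"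
      using path_connected_neighbourhood[OF N(1,2)] by metis
    have "continuous_on M s"
      by (rule continuous_on_subset[OF smooth_map_imp_continuous_on[OF N(1,4)] M(3)])
    then show ?thesis using M N(3) Ls by (intro exI[of _ M] exI[of _ s]) auto
  qed
  obtain l where l: "continuous_on U l" "\<And>x. x \<in> U \<Longrightarrow> l x \<in> L x" "\<And>x. x \<in> U \<Longrightarrow> norm (l x) = 1"
    using line_field_orientable[OF U(2) triv] by metis
  have ll: "ip (l x) (l x) > 0" if "x \<in> U" for x
    using Lpos[OF that l(2)[OF that]] l(3)[OF that] by force
  have lp: "l x \<in> perp ip (f x)" if "x \<in> U" for x using Lperp[OF that] l(2)[OF that] by blast
  define n where "n y = l y + null_coeff p (l y) *\<^sub>R p" for y
  define nu where "nu y = span {n y}" for y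
  have n0: "n y \<noteq> 0" if "y \<in> U" for y
  proof
    assume "n y = 0"
    then have "l y = (- null_coeff p (l y)) *\<^sub>R p" unfolding n_def by (simp add: eq_neg_iff_add_eq_0)
    then obtain k where "l y = k *\<^sub>R p" by blast
    then have "ip (l y) (l y) = k * k * ip p p" by (simp add: ip_simps)
    also have "\<dots> \<le> 0" using p by (intro mult_nonneg_nonpos) (simp_all add: timelike_def)
    finally show False using ll[OF that] by simp
  qed
  have curv: "curvature_lines A ip f T W"
    using constant_line_imp_curvature_lines[OF L U(1)] W(2) unfolding curvature_lines_def by blast
  have nu_bundle: "subbundle A 1 W nu"
  proof (rule line_bundleI)
    fix x assume x: "x \<in> W"
    then have xU: "x \<in> U" using W(2) by blast
    obtain N where N: "open N" "x \<in> N" "N \<subseteq> U" "smooth_map A N l"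
      using normalised_section_smooth[OF Lb l xU] by metis
    let ?M = "N \<inter> W"
    have M: "open ?M" "x \<in> ?M" "?M \<subseteq> W" using N(1,2) W(1) x by auto
    have sl: "smooth_map A ?M l" by (rule smooth_map_subset[OF N(4)]) simp
    note ml = smooth_map_bilinear[OF bounded_bilinear_mult M(1)]
    let ?h = "\<lambda>y. ip (l y) p * ip (l y) p + (- ip p p) * ip (l y) (l y)"
    have sp: "smooth_map A ?M (\<lambda>y. ip (l y) p)" by (rule smooth_map_ip_const[OF M(1) sl])
    have sh: "smooth_map A ?M ?h"
      by (rule smooth_map_add[OF M(1) ml[OF sp sp] ml[OF smooth_map_const[OF M(1)] smooth_map_ip[OF M(1) sl sl]]])
    have "?h y > 0" if "y \<in> ?M" for y
    proof -
      have "- ip p p * ip (l y) (l y) > 0"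
        by (rule mult_pos_pos) (use p ll[of y] N(3) that in \<open>auto simp: timelike_def\<close>)
      then show ?thesis using zero_le_square[of "ip (l y) p"] by linarith
    qed
    from smooth_map_powr[OF M(1) sh this]
    have "smooth_map A ?M (\<lambda>y. ?h y powr (1/2))" .
    from ml[OF smooth_map_add[OF M(1) sp this] smooth_map_const[OF M(1)]]
    have "smooth_map A ?M (\<lambda>y. null_coeff p (l y))" unfolding null_coeff_def .
    from smooth_map_add[OF M(1) sl smooth_map_bilinear[OF bounded_bilinear_scaleR M(1) this smooth_map_const[OF M(1)]]]
    have "smooth_map A ?M n" unfolding n_def .
    then show "\<exists>N s. open N \<and> x \<in> N \<and> N \<subseteq> W \<and> smooth_map A N s \<and> (\<forall>y\<in>N. nu y = span {s y} \<and> s y \<noteq> 0)"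
      using M n0 W(2) by (intro exI[of _ ?M] exI[of _ n]) (auto simp: nu_def)
  qed
  have null: "ip v v = 0" if x: "x \<in> W" and v: "v \<in> nu x" for x v
  proof -
    obtain k where "v = k *\<^sub>R n x" using v unfolding nu_def span_singleton by blast
    then show ?thesis using null_coeff(2)[OF p ll[of x]] x W(2) unfolding n_def[symmetric] by (auto simp: ip_simps)
  qed
  have const: "constant_along_leaves A T W nu"
  proof (rule constant_along_leavesI)
    fix a b \<gamma> s t assume \<gamma>W: "integral_curve A T W a b \<gamma>" and st: "s \<in> {a<..<b}" "t \<in> {a<..<b}"
    have \<gamma>: "integral_curve A T U a b \<gamma>" by (rule integral_curve_mono[OF \<gamma>W W(2)])
    have \<gamma>U: "\<gamma> \<tau> \<in> U" if "\<tau> \<in> {a<..<b}" for \<tau> by (rule integral_curveD(1)[OF \<gamma> that])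
    \<comment> \<open>The line is constant along the curve, so its unit section can only change its sign; by continuity it
      does not.\<close>
    have pm: "l (\<gamma> \<tau>) = l (\<gamma> s) \<or> l (\<gamma> \<tau>) = - l (\<gamma> s)" if "\<tau> \<in> {a<..<b}" for \<tau>
    proof -
      have dim1: "\<exists>v. L (\<gamma> s) = span {v}" using line_bundle_frame[OF Lb \<gamma>U[OF st(1)]] by metis
      have "l (\<gamma> \<tau>) \<in> L (\<gamma> s)"
        using l(2)[OF \<gamma>U[OF that]] constant_along_leavesD[OF Lc \<gamma> st(1) that] by simp
      then obtain v k j where "l (\<gamma> \<tau>) = k *\<^sub>R v" "l (\<gamma> s) = j *\<^sub>R v"
        using dim1 l(2)[OF \<gamma>U[OF st(1)]] unfolding span_singleton by blast
      moreover from this have "\<bar>k\<bar> * norm v = 1" "\<bar>j\<bar> * norm v = 1"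
        using l(3)[OF \<gamma>U[OF that]] l(3)[OF \<gamma>U[OF st(1)]] by simp_all
      then have "\<bar>k\<bar> = \<bar>j\<bar>" by (metis mult_cancel_right mult_zero_right zero_neq_one)
      ultimately show ?thesis by (auto simp: abs_eq_iff)
    qed
    have cont: "continuous_on {a<..<b} (\<lambda>\<tau>. l (\<gamma> \<tau>))"
    proof (rule continuous_on_compose2[OF l(1)])
      show "continuous_on {a<..<b} \<gamma>"
        using integral_curveD(2)[OF \<gamma>] by (intro continuous_at_imp_continuous_on ballI)
    qed (use \<gamma>U in blast)
    let ?\<phi> = "\<lambda>\<tau>. l (\<gamma> \<tau>) \<bullet> l (\<gamma> s)"
    have unit: "l (\<gamma> s) \<bullet> l (\<gamma> s) = 1"
      using l(3)[OF \<gamma>U[OF st(1)]] by (simp add: dot_square_norm)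
    have fin: "finite (?\<phi> ` {a<..<b})"
    proof (rule finite_subset)
      show "?\<phi> ` {a<..<b} \<subseteq> {1, - 1}"
      proof (rule image_subsetI)
        fix \<tau> assume "\<tau> \<in> {a<..<b}"
        from pm[OF this] show "?\<phi> \<tau> \<in> {1, - 1}" using unit by (elim disjE) simp_all
      qed
    qed simp
    have "continuous_on {a<..<b} ?\<phi>" by (rule continuous_on_inner[OF cont continuous_on_const])
    from continuous_finite_range_constant[OF _ this fin]
    have "?\<phi> constant_on {a<..<b}" by simp
    then have "?\<phi> t = ?\<phi> s" using st unfolding constant_on_def by metis
    then have "l (\<gamma> t) = l (\<gamma> s)" using pm[OF st(2)] unit by (elim disjE) simp_all
    then show "nu (\<gamma> t) = nu (\<gamma> s)" by (simp add: nu_def n_def)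
  qed
  have orth: "ip u v = 0" if x: "x \<in> W" and u: "u \<in> \<Lambda> p x" and v: "v \<in> nu x" for x u v
  proof -
    obtain k where k: "v = k *\<^sub>R n x" using v unfolding nu_def span_singleton by blast
    have "ip u p = 0" using u ip_commute[of p] by (simp add: point_sphere_map_def perp_def)
    moreover have "ip u (l x) = 0" using u lp[of x] x W(2) unfolding point_sphere_map_def perp_def by blast
    ultimately show ?thesis unfolding k n_def by (simp add: ip_simps)
  qed
  have trans: "transversal_at A ip f p nu x" if x: "x \<in> W" for x
  proof -
    have xU: "x \<in> U" and imm: "x \<in> immersed_region A ip f p" using x W by auto
    show ?thesis
      by (rule transversalI[OF imm p lp[OF xU] ll[OF xU]])
        (use null_coeff(1)[OF p ll[OF xU]] in \<open>auto simp: nu_def n_def\<close>)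
  qed
  show ?thesis unfolding spherical_curvature_lines_def
    using curv nu_bundle null const orth trans by blast
qed

section \<open>The constant line of spherical curvature lines\<close>

lemma spherical_imp_constant_line:
  assumes sph: "spherical_curvature_lines A ip f T p W" and p: "timelike ip p"
    and W: "W \<subseteq> immersed_region A ip f p"
  shows "\<exists>L. constant_spacelike_line A ip f T W L"
proof -
  have curv: "curvature_lines A ip f T W" using sph unfolding spherical_curvature_lines_def by blast
  obtain nu where nu_bundle: "subbundle A 1 W nu" and null: "\<And>x v. x \<in> W \<Longrightarrow> v \<in> nu x \<Longrightarrow> ip v v = 0"
    and nuc: "constant_along_leaves A T W nu"
    and orth: "\<And>x u v. x \<in> W \<Longrightarrow> u \<in> \<Lambda> p x \<Longrightarrow> v \<in> nu x \<Longrightarrow> ip u v = 0"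
    and trans: "\<And>x. x \<in> W \<Longrightarrow> transversal_at A ip f p nu x"
    using sph unfolding spherical_curvature_lines_def by (elim conjE exE) blast
  \<comment> \<open>The vectors of the pencil spanned by \<open>\<nu>\<close> and \<open>p\<close> that are orthogonal to \<open>f\<close>.\<close>
  define L where "L y = {m + k *\<^sub>R p | m k. m \<in> nu y} \<inter> perp ip (f y)" for y
  have orthF: "\<forall>u\<in>f x \<inter> perp ip {p}. ip u m = 0" if "x \<in> W" "m \<in> nu x" for x m
    using orth[OF that(1) _ that(2)] unfolding point_sphere_map_def by blast
  have fib: "L x = span {ip s p *\<^sub>R m + ip s m *\<^sub>R (- p)}" "ip s m \<noteq> 0"
    "ip s p *\<^sub>R m + ip s m *\<^sub>R (- p) \<noteq> 0"
    if x: "x \<in> W" and m: "nu x = span {m}" "m \<noteq> 0" and s: "s \<in> f x" "ip s p \<noteq> 0" for x m s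
  proof -
    let ?l = "ip s p *\<^sub>R m + ip s m *\<^sub>R (- p)"
    have mnu: "m \<in> nu x" unfolding m(1) by (simp add: span_base)
    note pencil = null_plane_perp_pencil[OF null_plane_f orthF[OF x mnu] s]
    show sm: "ip s m \<noteq> 0"
    proof
      assume "ip s m = 0"
      then have "m \<in> perp ip (f x)" using pencil[of 1 0] by simp
      then have "m \<in> nu x \<inter> perp ip (f x)" using mnu by blast
      then show False using trans[OF x] m(2) unfolding transversal_at_def Let_def by blast
    qed
    show "?l \<noteq> 0"
    proof
      assume "?l = 0"
      then have "ip s m *\<^sub>R p = ip s p *\<^sub>R m" by simp
      then have "ip (ip s m *\<^sub>R p) (ip s m *\<^sub>R p) = ip (ip s p *\<^sub>R m) (ip s p *\<^sub>R m)" by simp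
      then have "ip s m * ip s m * ip p p = 0" using null[OF x mnu] by (simp add: ip_simps)
      then show False using sm p by (simp add: timelike_def)
    qed
    show "L x = span {?l}"
    proof
      show "L x \<subseteq> span {?l}"
      proof
        fix v assume "v \<in> L x"
        then obtain a k where v: "v = a *\<^sub>R m + k *\<^sub>R p" "v \<in> perp ip (f x)"
          unfolding L_def m(1) span_singleton by blast
        then have "a * ip s m + k * ip s p = 0" using pencil by blast
        then have "k = - a * ip s m / ip s p" using s(2) by (simp add: field_simps)
        then have v': "v = (a / ip s p) *\<^sub>R ?l" using s(2) by (simp add: v(1) algebra_simps)
        show "v \<in> span {?l}" unfolding v' by (intro span_scale span_base) simp
      qed
      show "span {?l} \<subseteq> L x"
      proof
        fix v assume "v \<in> span {?l}"
        then obtain j where "v = j *\<^sub>R ?l" unfolding span_singleton by blast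
        then have v: "v = (j * ip s p) *\<^sub>R m + (- j * ip s m) *\<^sub>R p" by (simp add: algebra_simps)
        have "v \<in> perp ip (f x)" unfolding v by (rule pencil[THEN iffD2]) algebra
        moreover have "(j * ip s p) *\<^sub>R m \<in> nu x" unfolding m(1) by (intro span_scale span_base) simp
        ultimately show "v \<in> L x" unfolding L_def using v by blast
      qed
    qed
  qed
  have bundleL: "subbundle A 1 W L"
  proof (rule line_bundleI)
    fix x assume x: "x \<in> W"
    obtain N m where N: "open N" "x \<in> N" "N \<subseteq> W" "smooth_map A N m"
      "\<And>y. y \<in> N \<Longrightarrow> nu y = span {m y}" "\<And>y. y \<in> N \<Longrightarrow> m y \<noteq> 0"
      using line_bundle_frame[OF nu_bundle x] by metis
    obtain N' s where N': "open N'" "x \<in> N'" "smooth_map A N' s" "\<And>y. y \<in> N' \<Longrightarrow> s y \<in> f y"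
      "\<And>y. y \<in> N' \<Longrightarrow> ip (s y) p \<noteq> 0"
      using f_section_not_perp[OF p, of x] by metis
    let ?M = "N \<inter> N'"
    let ?l = "\<lambda>y. ip (s y) p *\<^sub>R m y + ip (s y) (m y) *\<^sub>R (- p)"
    have M: "open ?M" using N(1) N'(1) by blast
    have sm: "smooth_map A ?M m" "smooth_map A ?M s"
      by (rule smooth_map_subset[OF N(4)], simp, rule smooth_map_subset[OF N'(3)], simp)
    have "smooth_map A ?M ?l"
      by (rule smooth_map_add[OF M
          smooth_map_bilinear[OF bounded_bilinear_scaleR M smooth_map_ip_const[OF M sm(2)] sm(1)]
          smooth_map_bilinear[OF bounded_bilinear_scaleR M smooth_map_ip[OF M sm(2,1)] smooth_map_const[OF M]]])
    moreover have "L y = span {?l y} \<and> ?l y \<noteq> 0" if "y \<in> ?M" for y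
      using fib[of y "m y" "s y"] N(3,5,6) N'(4,5) that by blast
    ultimately show "\<exists>N s. open N \<and> x \<in> N \<and> N \<subseteq> W \<and> smooth_map A N s \<and> (\<forall>y\<in>N. L y = span {s y} \<and> s y \<noteq> 0)"
      using M N(2,3) N'(2) by (intro exI[of _ ?M] exI[of _ ?l]) blast
  qed
  have spacelike: "ip v v > 0" if x: "x \<in> W" and v: "v \<in> L x" "v \<noteq> 0" for x v
  proof (rule perp_spacelike[OF null_plane_f])
    show vp: "v \<in> perp ip (f x)" using v(1) unfolding L_def by blast
    show "v \<notin> f x"
    proof
      assume vf: "v \<in> f x"
      obtain m where m: "nu x = span {m}" "m \<noteq> 0" using line_bundle_frame[OF nu_bundle x] by metis
      obtain s where s: "s \<in> f x" "ip s p \<noteq> 0" using timelike_not_perp[OF null_plane_f p] by blast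
      let ?l = "ip s p *\<^sub>R m + ip s m *\<^sub>R (- p)"
      note fibx = fib[OF x m s]
      have mnu: "m \<in> nu x" unfolding m(1) by (simp add: span_base)
      have mm: "ip m m = 0" by (rule null[OF x mnu])
      obtain j where j: "v = j *\<^sub>R ?l" using v(1) unfolding fibx(1) span_singleton by blast
      then have "j \<noteq> 0" using v(2) by auto
      have "subspace (f x)" using null_plane_f[of x] unfolding null_plane_def by blast
      then have "(1 / j) *\<^sub>R v \<in> f x" using vf by (rule subspace_scale)
      then have lf: "?l \<in> f x" unfolding j using \<open>j \<noteq> 0\<close> by simp
      have "ip ?l ?l = 0" using lf null_plane_f[of x] unfolding null_plane_def by blast
      then have "ip s m * (ip s m * ip p p - 2 * ip s p * ip p m) = 0"
        by (simp add: ip_simps mm ip_commute[of m p] algebra_simps)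
      then have rel: "ip s m * ip p p = 2 * ip s p * ip p m" using fibx(2) by simp
      \<comment> \<open>If \<open>l\<close> were in \<open>f\<close>, then the tangent plane of the surface would be orthogonal to \<open>\<nu>\<close>. The vector \<open>w\<close>,
        the projection of \<open>s\<close> orthogonally to \<open>p\<close> up to a factor, then contradicts transversality.\<close>
      let ?w = "ip p p *\<^sub>R s - ip s p *\<^sub>R p"
      have wperp: "?w \<in> perp ip (\<Lambda> p x \<union> {p})"
      proof -
        have "ip u ?w = 0" if "u \<in> \<Lambda> p x" for u
        proof -
          have "u \<in> f x" "ip u p = 0" using that ip_commute[of p u] by (auto simp: point_sphere_map_def perp_def)
          moreover have "ip u s = 0" using \<open>u \<in> f x\<close> s(1) null_plane_f[of x] unfolding null_plane_def by blast
          ultimately show ?thesis by (simp add: ip_simps)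
        qed
        moreover have "ip p ?w = 0" by (simp add: ip_simps ip_commute[of p s])
        ultimately show ?thesis unfolding perp_def by blast
      qed
      have der_m: "derived_bundle A (\<Lambda> p) x \<subseteq> perp ip {m}"
      proof
        fix a assume "a \<in> derived_bundle A (\<Lambda> p) x"
        then have "a \<in> perp ip (f x \<union> {p})" using derived_point_sphere_perp by blast
        then have "ip ?l a = 0" "ip p a = 0" using lf unfolding perp_def by blast+
        then have "ip s p * ip m a = 0" by (simp add: ip_simps)
        then show "a \<in> perp ip {m}" using s(2) by (simp add: perp_def)
      qed
      have nu_m: "perp ip (\<Lambda> p x \<union> {p} \<union> nu x) \<subseteq> perp ip {m}" using mnu unfolding perp_def by blast
      have "?w \<in> {a + b |a b. a \<in> derived_bundle A (\<Lambda> p) x \<and> b \<in> perp ip (\<Lambda> p x \<union> {p} \<union> nu x)}"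
        using wperp trans[OF x] unfolding transversal_at_def Let_def by blast
      then obtain a b where ab: "?w = a + b" "a \<in> derived_bundle A (\<Lambda> p) x"
        "b \<in> perp ip (\<Lambda> p x \<union> {p} \<union> nu x)" by blast
      have "?w \<in> perp ip {m}"
        unfolding ab(1) using ab(2,3) der_m nu_m by (intro subspace_add[OF subspace_perp]) blast+
      then have "ip m ?w = 0" by (simp add: perp_def)
      then have "ip p p * ip s m = ip s p * ip p m"
        using ip_commute[of m s] ip_commute[of m p] by (simp add: ip_simps)
      then have "ip s m * ip p p = 0" using rel by (simp add: mult.commute)
      then show False using fibx(2) p by (simp add: timelike_def)
    qed
  qed
  have constL: "constant_along_leaves A T W L"
  proof (rule constant_along_leavesI)
    fix a b \<gamma> t0 t1 assume \<gamma>: "integral_curve A T W a b \<gamma>" and t01: "t0 \<in> {a<..<b}" "t1 \<in> {a<..<b}"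
    have \<gamma>W: "\<gamma> t \<in> W" if "t \<in> {a<..<b}" for t by (rule integral_curveD(1)[OF \<gamma> that])
    obtain m where m: "nu (\<gamma> t0) = span {m}" "m \<noteq> 0"
      using line_bundle_frame[OF nu_bundle \<gamma>W[OF t01(1)]] by metis
    have num: "nu (\<gamma> t) = span {m}" if "t \<in> {a<..<b}" for t
      using constant_along_leavesD[OF nuc \<gamma> t01(1) that] m(1) by simp
    have mnu: "m \<in> nu (\<gamma> t)" if "t \<in> {a<..<b}" for t unfolding num[OF that] by (simp add: span_base)
    \<comment> \<open>The position of \<open>L\<close> in the pencil: \<open>(s, m) / (s, p)\<close>, for any \<open>s\<close> in \<open>f\<close> with \<open>(s, p) \<noteq> 0\<close>.\<close>
    define r where "r t = (SOME \<rho>. \<exists>s\<in>f (\<gamma> t). ip s p \<noteq> 0 \<and> \<rho> = ip s m / ip s p)" for t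
    have r: "r t = ip s m / ip s p" if t: "t \<in> {a<..<b}" and s: "s \<in> f (\<gamma> t)" "ip s p \<noteq> 0" for t s
    proof -
      have "\<exists>s\<in>f (\<gamma> t). ip s p \<noteq> 0 \<and> r t = ip s m / ip s p"
        unfolding r_def by (rule someI_ex) (use s in blast)
      then obtain u where u: "u \<in> f (\<gamma> t)" "ip u p \<noteq> 0" "r t = ip u m / ip u p" by blast
      have "ip u m * ip s p = ip u p * ip s m"
        by (rule null_plane_proportional[OF null_plane_f orthF[OF \<gamma>W[OF t] mnu[OF t]] s(1) u(1)])
      then show ?thesis unfolding u(3) frac_eq_eq[OF u(2) s(2)] by (simp add: mult.commute)
    qed
    have der: "(r has_vector_derivative 0) (at t)" if t: "t \<in> {a<..<b}" for t
    proof -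
      let ?x = "\<gamma> t" and ?V = "velocity A \<gamma> t"
      have imm: "?x \<in> immersed_region A ip f p" using W \<gamma>W[OF t] by blast
      have V: "?V \<in> T ?x" "?V \<noteq> (\<lambda>_. 0)" using integral_curveD(3)[OF \<gamma> t] by blast+
      have Vt: "?V \<in> tangent_space A ?x" by (rule tangent_T[OF V(1)])
      obtain N s where N: "open N" "?x \<in> N" "smooth_map A N s" "\<And>y. y \<in> N \<Longrightarrow> s y \<in> f y"
        "\<And>y. y \<in> N \<Longrightarrow> ip (s y) p \<noteq> 0"
        using f_section_not_perp[OF p, of ?x] by metis
      have s: "s \<in> local_sections A ?x f" by (rule local_sectionsI[OF N(1-4)])
      have sms: "smooth_at ?x s" by (rule smooth_atI[OF N(1-3)])
      obtain N' \<sigma> where N': "open N'" "?x \<in> N'" "smooth_map A N' \<sigma>" "\<And>y. y \<in> N' \<Longrightarrow> \<Lambda> p y = span {\<sigma> y}"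
        "\<And>y. y \<in> N' \<Longrightarrow> \<sigma> y \<noteq> 0" and \<sigma>: "\<sigma> \<in> local_sections A ?x f" "\<sigma> \<in> local_sections A ?x (\<Lambda> p)"
        using point_sphere_frame[OF p, of ?x] by metis
      have sm\<sigma>: "smooth_at ?x \<sigma>" by (rule smooth_atI[OF N'(1-3)])
      let ?u = "dir_deriv A ?x ?V \<sigma>" and ?v = "dir_deriv A ?x ?V s"
      let ?l = "ip (s ?x) p *\<^sub>R m + ip (s ?x) m *\<^sub>R (- p)"
      have unf: "?u \<notin> f ?x" by (rule immersed_dir_deriv_notin[OF imm Vt V(2) N'(1-4) N'(5)[OF N'(2)] \<sigma>(2)])
      have up: "?u \<in> perp ip (f ?x)" "ip ?u p = 0" using dir_deriv_point_sphere_perp[OF Vt \<sigma>(2)] by blast+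
      \<comment> \<open>The generator \<open>m\<close> of \<open>\<nu>\<close> is constant along the curve and orthogonal to \<open>\<Lambda>\<close>.\<close>
      have um: "ip ?u m = 0"
      proof -
        have d: "((\<lambda>\<tau>. ip (\<sigma> (\<gamma> \<tau>)) m) has_vector_derivative ip ?u m) (at t)"
          using integral_curveD(4)[OF \<gamma> t smooth_at_ip_const[OF sm\<sigma>, of m]] unfolding dir_deriv_ip_const[OF sm\<sigma>] .
        have z: "ip (\<sigma> (\<gamma> \<tau>)) m = 0" if \<tau>: "\<tau> \<in> {a<..<b} \<and> \<gamma> \<tau> \<in> N'" for \<tau>
        proof (rule orth[OF \<gamma>W[OF conjunct1[OF \<tau>]] _ mnu[OF conjunct1[OF \<tau>]]])
          show "\<sigma> (\<gamma> \<tau>) \<in> \<Lambda> p (\<gamma> \<tau>)"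
            unfolding N'(4)[OF conjunct2[OF \<tau>]] by (rule span_base) simp
        qed
        have ev: "eventually (\<lambda>\<tau>. ip (\<sigma> (\<gamma> \<tau>)) m = 0) (at t)"
          using eventually_along_curve[OF \<gamma> t N'(1,2)] by (rule eventually_mono) (rule z)
        have "((\<lambda>\<tau>. 0) has_derivative (\<lambda>h. h *\<^sub>R ip ?u m)) (at t)"
          by (rule has_derivative_transform_eventually[OF d[unfolded has_vector_derivative_def] ev _ UNIV_I])
            (rule z, use t N'(2) in blast)
        then have "((\<lambda>\<tau>. 0) has_vector_derivative ip ?u m) (at t)" unfolding has_vector_derivative_def .
        from vector_derivative_unique_at[OF this has_vector_derivative_const] show ?thesis .
      qed
      have ul: "ip ?u ?l = 0" using um up(2) by (simp add: ip_simps)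
      have lL: "?l \<in> L ?x"
        unfolding fib(1)[OF \<gamma>W[OF t] num[OF t] m(2) N(4)[OF N(2)] N(5)[OF N(2)]] by (simp add: span_base)
      then have lperp: "?l \<in> perp ip (f ?x)" unfolding L_def by blast
      have "curv_rep A ?x ?V ?V \<sigma> s \<in> contact_bivectors ip (f ?x)"
        using curv \<gamma>W[OF t] V(1) \<sigma>(1) s unfolding curvature_lines_def contact_bivectors_def by blast
      then have "wedge ?u ?v \<in> contact_bivectors ip (f ?x)"
        unfolding curv_rep_def by (simp flip: scaleR_2)
      from contact_bivectors_perp[OF null_plane_f up(1) lperp unf ul this]
      have vl: "ip ?v ?l = 0" .
      have dm: "((\<lambda>\<tau>. ip (s (\<gamma> \<tau>)) m) has_vector_derivative ip ?v m) (at t)"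
        using integral_curveD(4)[OF \<gamma> t smooth_at_ip_const[OF sms, of m]] unfolding dir_deriv_ip_const[OF sms] .
      have dp: "((\<lambda>\<tau>. ip (s (\<gamma> \<tau>)) p) has_vector_derivative ip ?v p) (at t)"
        using integral_curveD(4)[OF \<gamma> t smooth_at_ip_const[OF sms, of p]] unfolding dir_deriv_ip_const[OF sms] .
      have sp: "ip (s ?x) p \<noteq> 0" by (rule N(5)[OF N(2)])
      have "((\<lambda>\<tau>. ip (s (\<gamma> \<tau>)) m / ip (s (\<gamma> \<tau>)) p) has_real_derivative
          (ip ?v m * ip (s ?x) p - ip (s ?x) m * ip ?v p) / (ip (s ?x) p * ip (s ?x) p)) (at t)"
        by (rule DERIV_divide[OF dm[folded has_real_derivative_iff_has_vector_derivative]
             dp[folded has_real_derivative_iff_has_vector_derivative] sp])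
      moreover have "ip ?v m * ip (s ?x) p - ip (s ?x) m * ip ?v p = 0"
        using vl by (simp add: ip_simps mult.commute)
      ultimately have "((\<lambda>\<tau>. ip (s (\<gamma> \<tau>)) m / ip (s (\<gamma> \<tau>)) p) has_real_derivative 0) (at t)"
        by (simp only: div_0)
      then have q: "((\<lambda>\<tau>. ip (s (\<gamma> \<tau>)) m / ip (s (\<gamma> \<tau>)) p) has_derivative (\<lambda>h. h *\<^sub>R 0)) (at t)"
        unfolding has_real_derivative_iff_has_vector_derivative has_vector_derivative_def .
      have eqr: "ip (s (\<gamma> \<tau>)) m / ip (s (\<gamma> \<tau>)) p = r \<tau>" if \<tau>: "\<tau> \<in> {a<..<b} \<and> \<gamma> \<tau> \<in> N" for \<tau>
        by (rule r[symmetric, OF conjunct1[OF \<tau>] N(4,5)[OF conjunct2[OF \<tau>]]])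
      have ev: "eventually (\<lambda>\<tau>. ip (s (\<gamma> \<tau>)) m / ip (s (\<gamma> \<tau>)) p = r \<tau>) (at t)"
        using eventually_along_curve[OF \<gamma> t N(1,2)] by (rule eventually_mono) (rule eqr)
      show ?thesis unfolding has_vector_derivative_def
        by (rule has_derivative_transform_eventually[OF q ev _ UNIV_I])
          (rule eqr, use t N(2) in blast)
    qed
    have "\<exists>c. \<forall>t\<in>{a<..<b}. r t = c"
    proof (rule has_vector_derivative_zero_constant)
      show "convex {a<..<b}" by simp
      fix t assume "t \<in> {a<..<b}"
      from der[OF this] show "(r has_vector_derivative 0) (at t within {a<..<b})"
        by (rule has_vector_derivative_at_within)
    qed blast
    then have r01: "r t1 = r t0" using t01 by metis
    have memL: "v \<in> L (\<gamma> t) \<longleftrightarrow> (\<exists>c k. v = c *\<^sub>R m + k *\<^sub>R p \<and> c * r t + k = 0)" if t: "t \<in> {a<..<b}" for v t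
    proof -
      obtain s where s: "s \<in> f (\<gamma> t)" "ip s p \<noteq> 0" using timelike_not_perp[OF null_plane_f p] by blast
      have "c *\<^sub>R m + k *\<^sub>R p \<in> perp ip (f (\<gamma> t)) \<longleftrightarrow> c * r t + k = 0" for c k
        unfolding null_plane_perp_pencil[OF null_plane_f orthF[OF \<gamma>W[OF t] mnu[OF t]] s] r[OF t s]
        using s(2) by (simp add: field_simps)
      then show ?thesis unfolding L_def num[OF t] span_singleton by blast
    qed
    show "L (\<gamma> t1) = L (\<gamma> t0)"
      using memL[OF t01(1)] memL[OF t01(2)] unfolding r01 by blast
  qed
  show ?thesis
    unfolding constant_spacelike_line_def using bundleL spacelike constL
    by (intro exI[of _ L]) (auto simp: L_def)
qed

end

section \<open>The equivalence\<close>

theorem theorem4p3: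
  fixes A :: "'m::{t2_space, second_countable_topology} chart set"
    and ip :: "real^6 \<Rightarrow> real^6 \<Rightarrow> real"
    and f :: "'m \<Rightarrow> (real^6) set"
    and T :: "'m \<Rightarrow> 'm tvec set"
  assumes "smooth_atlas A"
    and "simply_connected (UNIV :: 'm set)"
    and "form_of_signature ip 4 2"
    and "legendre_map A ip f"
    and "rank1_distribution A T"
  shows
    "((\<exists>L. constant_spacelike_line A ip f T UNIV L) \<longrightarrow>
        (\<forall>p. timelike ip p \<longrightarrow> spherical_curvature_lines A ip f T p (immersed_region A ip f p))) \<and>
     (\<forall>p. timelike ip p \<and> spherical_curvature_lines A ip f T p (immersed_region A ip f p) \<longrightarrow>
        (\<exists>L. constant_spacelike_line A ip f T (immersed_region A ip f p) L)) \<and>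
     (\<forall>W. open W \<and> simply_connected W \<and>
        (\<exists>p. timelike ip p \<and> W \<subseteq> immersed_region A ip f p) \<longrightarrow>
        ((\<exists>L. constant_spacelike_line A ip f T W L) \<longleftrightarrow>
           (\<exists>p. timelike ip p \<and> W \<subseteq> immersed_region A ip f p \<and>
              spherical_curvature_lines A ip f T p W)) \<and>
        ((\<exists>L. constant_spacelike_line A ip f T W L) \<longleftrightarrow>
           (\<forall>p. timelike ip p \<and> W \<subseteq> immersed_region A ip f p \<longrightarrow>
              spherical_curvature_lines A ip f T p W)))"
proof -
  interpret legendre A ip f T
    by unfold_locales fact+
  have forward: "spherical_curvature_lines A ip f T p W"
    if "constant_spacelike_line A ip f T U L" "open U" "simply_connected U" "timelike ip p"
      "open W" "W \<subseteq> U" "W \<subseteq> immersed_region A ip f p" for U L p W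
    using that by (rule constant_line_imp_spherical)
  have backward: "\<exists>L. constant_spacelike_line A ip f T W L"
    if "spherical_curvature_lines A ip f T p W" "timelike ip p" "W \<subseteq> immersed_region A ip f p" for p W
    using that by (rule spherical_imp_constant_line)
  show ?thesis
  proof (intro conjI allI impI)
    fix p assume "\<exists>L. constant_spacelike_line A ip f T UNIV L" and p: "timelike ip p"
    then obtain L where "constant_spacelike_line A ip f T UNIV L" by blast
    then show "spherical_curvature_lines A ip f T p (immersed_region A ip f p)"
      using forward[OF _ open_UNIV assms(2) p open_immersed_region[OF p]] by blast
  next
    fix p assume "timelike ip p \<and> spherical_curvature_lines A ip f T p (immersed_region A ip f p)"
    then show "\<exists>L. constant_spacelike_line A ip f T (immersed_region A ip f p) L"
      using backward[of p "immersed_region A ip f p"] by blast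
  next
    fix W assume W: "open W \<and> simply_connected W \<and> (\<exists>p. timelike ip p \<and> W \<subseteq> immersed_region A ip f p)"
    then obtain p0 where p0: "timelike ip p0" "W \<subseteq> immersed_region A ip f p0" by blast
    have all: "spherical_curvature_lines A ip f T p W"
      if L: "\<exists>L. constant_spacelike_line A ip f T W L"
        and p: "timelike ip p" "W \<subseteq> immersed_region A ip f p" for p
    proof -
      obtain L where "constant_spacelike_line A ip f T W L" using L by blast
      from forward[OF this _ _ p(1) _ order_refl p(2)] show ?thesis using W by blast
    qed
    show "(\<exists>L. constant_spacelike_line A ip f T W L) \<longleftrightarrow>
           (\<exists>p. timelike ip p \<and> W \<subseteq> immersed_region A ip f p \<and> spherical_curvature_lines A ip f T p W)"
      using all p0 backward by blast
    show "(\<exists>L. constant_spacelike_line A ip f T W L) \<longleftrightarrow>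
           (\<forall>p. timelike ip p \<and> W \<subseteq> immersed_region A ip f p \<longrightarrow> spherical_curvature_lines A ip f T p W)"
      using all p0 backward by blast
  qed
qed

end
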